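(* Let $n\ge 1$. There exists a constant $c_n>0$ depending only on $n$ such that the following holds. Let $\alpha\in(0,n)$, $1<p<\frac{n}{\alpha}$, $1\le r\le p$ and $w\in A_r$, and put $p^*_\alpha=\frac{np}{n-\alpha p}$. If $r>1$, let $\sigma=w^{1-r'}$, $\tau_n=2^{n+1}$, and define $q_r$ by $$\frac1p-\frac1{q_r}=\frac{\alpha}{n}\,\frac{\tau_n[\sigma]_{A_\infty}}{1+r(\tau_n[\sigma]_{A_\infty}-1)};$$ if $r=1$, let $q_1=p^*_\alpha$. If $r>1$, then $$\left(\frac1{w(B)}\int_B|I_\alpha f(x)|^{q_r}w(x)\,dx\right)^{\frac1{q_r}}\le\frac{c_n}{\alpha}\,p^*_\alpha\,(p')^{\frac1{q_r}}[w]_{A_r}^{\frac1p}[\sigma]_{A_\infty}^{\frac1{q_r}}\,r(B)^\alpha\left(\frac1{w(B)}\int_B|f(x)|^pw(x)\,dx\right)^{\frac1p}$$ for any ball $B\subset\mathbb{R}^n$ and every $f\in L^p(B,w)$ (extended by $0$ outside $B$). If $r=1$, then $$\left(\frac1{w(B)}\int_B|I_\alpha f(x)|^{q_1}w(x)\,dx\right)^{\frac1{q_1}}\le\frac{c_n}{\alpha}\,p^*_\alpha\,(p')^{\frac1{q_1}}[w]_{A_1}^{\frac1p}\,r(B)^\alpha\left(\frac1{w(B)}\int_B|f(x)|^pw(x)\,dx\right)^{\frac1p}$$ for any ball $B\subset\mathbb{R}^n$ and every $f\in L^p(B,w)$ (extended by $0$ outside $B$).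
   Context: A weight is a non-negative locally integrable function on $\mathbb{R}^n$; $w(E)=\int_E w$; $r(B)$ is the radius of the ball $B$; $p'$ is the conjugate exponent, $\frac1p+\frac1{p'}=1$. $M$ is the Hardy–Littlewood maximal operator $Mf(x)=\sup_B\left(\frac1{|B|}\int_B|f|\right)\chi_B(x)$, supremum over all balls. $w\in A_p$ for $p>1$ means $[w]_{A_p}=\sup_B\left(\frac1{|B|}\int_Bw\right)\left(\frac1{|B|}\int_Bw^{1-p'}\right)^{p-1}<\infty$; $w\in A_1$ means $[w]_{A_1}=\|Mw/w\|_{L^\infty}<\infty$. $A_\infty=\bigcup_{p>1}A_p$, and $[w]_{A_\infty}=\sup_B\frac1{w(B)}\int_BM(w\chi_B)(x)\,dx$. Suprema are over all balls $B$. If $w\in A_r$ with $r>1$, then $\sigma=w^{1-r'}\in A_{r'}\subset A_\infty$. The Riesz potential of order $\alpha\in(0,n)$ is $I_\alpha f(x)=\int_{\mathbb{R}^n}\frac{f(y)}{|x-y|^{n-\alpha}}\,dy$. $L^p(B,w)$ is the space of $f$ on $B$ with $\int_B|f|^pw<\infty$. *)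

theory Defs
  imports "HOL-Probability.Probability"
begin

(* Powers on [0,\<infinity>]. Unlike real powr, 0 to a negative power is \<infinity>, so that the dual
   weight w^(1-r') is infinite, not zero, wherever w vanishes. *)
definition ennpowr :: "ennreal \<Rightarrow> real \<Rightarrow> ennreal" where
  "ennpowr x a =
    (if a = 0 then 1
     else if x = 0 then (if a < 0 then \<infinity> else 0)
     else if x = \<infinity> then (if a < 0 then 0 else \<infinity>)
     else ennreal (enn2real x powr a))"

definition conj_exp :: "real \<Rightarrow> real" where
  "conj_exp p = p / (p - 1)"

definition mass :: "('a::euclidean_space \<Rightarrow> ennreal) \<Rightarrow> 'a set \<Rightarrow> ennreal" where
  "mass w E = (\<integral>\<^sup>+x\<in>E. w x \<partial>lebesgue)"

definition average :: "'a::euclidean_space set \<Rightarrow> ('a \<Rightarrow> ennreal) \<Rightarrow> ennreal" where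
  "average B f = (\<integral>\<^sup>+x\<in>B. f x \<partial>lebesgue) / emeasure lebesgue B"

definition waverage :: "('a::euclidean_space \<Rightarrow> ennreal) \<Rightarrow> 'a set \<Rightarrow> ('a \<Rightarrow> ennreal) \<Rightarrow> ennreal" where
  "waverage w B f = (\<integral>\<^sup>+x\<in>B. f x * w x \<partial>lebesgue) / mass w B"

definition balls :: "'a::euclidean_space set set" where
  "balls = {ball z \<rho> | z \<rho>. \<rho> > 0}"

(* Local integrability is tested on balls. Values in [0,\<infinity>] are allowed so that w and its dual
   weight have the same type; local integrability makes w finite almost everywhere. *)
definition weight :: "('a::euclidean_space \<Rightarrow> ennreal) \<Rightarrow> bool" where
  "weight w \<longleftrightarrow> w \<in> borel_measurable lebesgue \<and> (\<forall>B\<in>balls. mass w B < \<infinity>)"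

(* Uncentred maximal operator, on non-negative functions. *)
definition maximal :: "('a::euclidean_space \<Rightarrow> ennreal) \<Rightarrow> 'a \<Rightarrow> ennreal" where
  "maximal f x = (SUP B\<in>balls. average B f * indicator B x)"

definition A_const :: "real \<Rightarrow> ('a::euclidean_space \<Rightarrow> ennreal) \<Rightarrow> ennreal" where
  "A_const p w =
    (if p = 1 then esssup lebesgue (\<lambda>x. maximal w x / w x)
     else (SUP B\<in>balls. average B w *
             ennpowr (average B (\<lambda>x. ennpowr (w x) (1 - conj_exp p))) (p - 1)))"

definition A_class :: "real \<Rightarrow> ('a::euclidean_space \<Rightarrow> ennreal) set" where
  "A_class p = {w. weight w \<and> A_const p w < \<infinity>}"

definition Ainf_const :: "('a::euclidean_space \<Rightarrow> ennreal) \<Rightarrow> ennreal" where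
  "Ainf_const w =
    (SUP B\<in>balls. (\<integral>\<^sup>+x\<in>B. maximal (\<lambda>y. w y * indicator B y) x \<partial>lebesgue) / mass w B)"

(* Lebesgue integral of a real function as the difference of the integrals of the positive and
   negative parts; note that ennreal truncates negative reals to 0. Unlike the Bochner integral it
   is not 0 for divergent integrals: it is infinite, also (since \<infinity> - \<infinity> = \<infinity> in ereal)
   when both parts are infinite. *)
definition ext_integral :: "'a measure \<Rightarrow> ('a \<Rightarrow> real) \<Rightarrow> ereal" where
  "ext_integral M f =
    enn2ereal (\<integral>\<^sup>+x. ennreal (f x) \<partial>M) - enn2ereal (\<integral>\<^sup>+x. ennreal (- f x) \<partial>M)"

definition riesz_potential :: "real \<Rightarrow> ('a::euclidean_space \<Rightarrow> real) \<Rightarrow> 'a \<Rightarrow> ereal" where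
  "riesz_potential \<alpha> f x =
    ext_integral lebesgue (\<lambda>y. f y / norm (x - y) powr (real DIM('a) - \<alpha>))"

definition Lp_on :: "real \<Rightarrow> 'a::euclidean_space set \<Rightarrow> ('a \<Rightarrow> ennreal) \<Rightarrow> ('a \<Rightarrow> real) set" where
  "Lp_on p B w = {f. set_borel_measurable lebesgue B f \<and>
                     (\<integral>\<^sup>+x\<in>B. ennreal (\<bar>f x\<bar> powr p) * w x \<partial>lebesgue) < \<infinity>}"

definition zero_ext :: "'a set \<Rightarrow> ('a \<Rightarrow> real) \<Rightarrow> 'a \<Rightarrow> real" where
  "zero_ext B f x = (if x \<in> B then f x else 0)"

end

theory Submission
  imports Defs
begin

text \<open>
  Let \<open>\<sigma>\<close> be the dual weight, \<open>s\<close> its \<open>A\<^sub>\<infinity>\<close> constant and \<open>f\<close> supported in \<open>B\<close>. By Hedberg's argument,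
  \<open>|I\<^sub>\<alpha> f(x)|\<close> is at most a multiple of the sum over \<open>j\<close> of \<open>t\<^sub>j powr \<alpha>\<close> times the average of \<open>|f|\<close> over
  the ball of radius \<open>t\<^sub>j = 2r(B) / 2^j\<close> about \<open>x\<close>, and each average is estimated in two ways.

  Large balls: by Hoelder and the \<open>A\<^sub>r\<close> condition the average is controlled by \<open>\<sigma>\<close> of the small ball.
  Testing \<open>A\<^sub>\<infinity>\<close> on dyadic annuli shows that the masses \<open>V\<^sub>j\<close> of the concentric balls satisfy
  \<open>V\<^sub>m + V\<^sub>m\<^sub>+\<^sub>1 + ... \<le> 2 s V\<^sub>m\<close>, hence \<open>V\<^sub>m \<le> exp (1 - m / (2 s)) V\<^sub>0\<close>; this decay gives the exponent \<open>q\<^sub>r\<close>.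

  Small balls: by the maximal function. That its norm on \<open>L\<^sup>p(w)\<close>, to the power \<open>p\<close>, is at most
  \<open>C\<^sup>p p' [w]\<^sub>A\<^sub>r s\<close> follows from Marcinkiewicz interpolation if \<open>r\<close> is far from \<open>p\<close>. Otherwise
  Jensen's inequality reduces it to \<open>p = r\<close>, where stopping cubes \<open>Q\<close>, compared with balls \<open>B\<^sub>Q\<close> that
  satisfy \<open>B\<^sub>Q \<subseteq> B\<^sub>P\<close> whenever \<open>Q \<subseteq> P\<close>, form a Carleson family for \<open>\<sigma>\<close>.
\<close>

text \<open>The obstacle is quantitative: the powers 1/p of the A_r constant, 1/q of
  \<open>s\<close> and of p', and a single factor p_star / \<alpha> must come out with a constant
  depending on the dimension alone. The maximal estimate may lose C^p, but no higher power of p' or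
  \<open>s\<close>. Interpolation costs 1/(p - r) and the Carleson argument 1/(r - 1); as (p - r) +
  (r - 1) = p - 1, one of the two is at most 2/(p - 1), which p' allows.

  The two estimates of the average of index j are M, independent of j, and K 2^(j \<beta>) with
  \<beta> = n r0 / p, r0 = r - (r - 1) / (\<tau> s). Summed against 2^(-j \<alpha>) they give M^(1 -
  \<alpha>/\<beta>) K^(\<alpha>/\<beta>), and 1 - \<alpha>/\<beta> = p/q is the definition of q_r.
  The A_r constant enters both M and K, hence the power 1/p; p' and \<open>s\<close> enter only M,
  hence the power 1/q.

  Stopping arguments need nested sets, but the constants are suprema over balls; so each dyadic cube
  carries a ball. Strong estimates concern a measurable majorant \<open>\<Phi>\<close> of all
  averages, a countable sum of indicators.\<close>

section \<open>Powers and integrals of extended nonnegative functions\<close>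

lemma ennpowr_0 [simp]: "ennpowr x 0 = 1"
  by (simp add: ennpowr_def)

lemma ennpowr_1 [simp]: "ennpowr x 1 = x"
  by (cases x) (auto simp: ennpowr_def)

lemma ennpowr_zero [simp]: "0 < a \<Longrightarrow> ennpowr 0 a = 0"
  by (simp add: ennpowr_def)

lemma ennpowr_top [simp]: "0 < a \<Longrightarrow> ennpowr top a = top"
  by (simp add: ennpowr_def)

lemma ennpowr_ennreal: "0 < x \<Longrightarrow> ennpowr (ennreal x) a = ennreal (x powr a)"
  by (auto simp: ennpowr_def)

lemma ennpowr_ennreal': "0 \<le> x \<Longrightarrow> 0 < a \<Longrightarrow> ennpowr (ennreal x) a = ennreal (x powr a)"
  by (auto simp: ennpowr_def)

lemma ennpowr_eq_0_iff: "0 < a \<Longrightarrow> ennpowr x a = 0 \<longleftrightarrow> x = 0"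
  by (cases x) (auto simp: ennpowr_def)

lemma ennpowr_less_top: "0 < a \<Longrightarrow> x < \<infinity> \<Longrightarrow> ennpowr x a < \<infinity>"
  by (cases x) (auto simp: ennpowr_def)

lemma ennpowr_mono: "0 \<le> a \<Longrightarrow> x \<le> y \<Longrightarrow> ennpowr x a \<le> ennpowr y a"
  by (cases x; cases y) (auto simp: ennpowr_def top_unique intro!: ennreal_leI powr_mono2)

lemma ennpowr_mult: "0 \<le> a \<Longrightarrow> ennpowr (x * y) a = ennpowr x a * ennpowr y a"
proof (cases "a = 0 \<or> x = 0 \<or> y = 0 \<or> x = top \<or> y = top")
  case True
  assume "0 \<le> a"
  with True show ?thesis
    by (auto simp: ennpowr_def ennreal_mult_top ennreal_top_mult ennreal_mult_eq_top_iff enn2real_eq_0_iff)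
next
  case False
  then show "0 \<le> a \<Longrightarrow> ennpowr (x * y) a = ennpowr x a * ennpowr y a"
    by (cases x; cases y) (auto simp: ennpowr_ennreal powr_mult simp flip: ennreal_mult)
qed

lemma ennpowr_ennpowr: "0 < a \<Longrightarrow> 0 < b \<Longrightarrow> ennpowr (ennpowr x a) b = ennpowr x (a * b)"
  by (cases x) (auto simp: ennpowr_def powr_powr mult_less_0_iff)

lemma ennpowr_add: "0 < a \<Longrightarrow> 0 < b \<Longrightarrow> ennpowr x (a + b) = ennpowr x a * ennpowr x b"
  by (cases x) (auto simp: ennpowr_def powr_add ennreal_mult ennreal_top_mult)

lemma ennpowr_cancel: "0 < a \<Longrightarrow> ennpowr (ennpowr x a) (1 / a) = x" "0 < a \<Longrightarrow> ennpowr (ennpowr x (1 / a)) a = x"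
  by (auto simp: ennpowr_ennpowr)

lemma ennpowr_le_iff: "0 < a \<Longrightarrow> ennpowr x a \<le> ennpowr y a \<longleftrightarrow> x \<le> y"
  by (metis ennpowr_cancel(1) ennpowr_mono less_imp_le zero_less_divide_1_iff)

lemma ennpowr_measurable [measurable]:
  assumes "f \<in> borel_measurable M"
  shows "(\<lambda>x. ennpowr (f x) a) \<in> borel_measurable M"
proof -
  have "(\<lambda>x::ennreal. ennpowr x a) \<in> borel_measurable borel"
    unfolding ennpowr_def
    by (intro measurable_If) (auto intro!: measurable_compose[OF borel_measurable_enn2real] pred_intros_logic)
  then show ?thesis by (rule measurable_compose[OF assms])
qed

lemma ennpowr_times_dual:
  assumes "0 < w" "w < \<infinity>" "0 < c"
  shows "w * ennpowr (ennpowr w (-c)) (1 / c) = 1"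
  using assms
  by (cases w) (auto simp: ennpowr_ennreal powr_powr powr_minus_divide powr_divide simp flip: ennreal_mult'' ennreal_1)

text \<open>The conjugate exponents are r and r / (r - 1). Writing the second factor as b^(r - 1)
  turns its conjugate power into b^r, so that a single real parameter is left to optimise.\<close>

lemma young_ennreal:
  assumes r: "1 < r" and b: "0 < b"
  shows "u * ennreal (b powr (r - 1)) \<le> ennpowr u r * ennreal (1 / r) + ennreal (b powr r * (r - 1) / r)"
proof (cases u)
  case (real x)
  have "x * b powr (r - 1) \<le> x powr r / r + (b powr (r - 1)) powr (r / (r - 1)) / (r / (r - 1))"
    by (rule Youngs_inequality) (use r b real in \<open>auto simp: field_simps\<close>)
  also have "(b powr (r - 1)) powr (r / (r - 1)) = b powr r"
    using r b by (simp add: powr_powr)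
  finally have "x * b powr (r - 1) \<le> x powr r * (1 / r) + b powr r * (r - 1) / r"
    by (simp add: field_simps)
  then have "ennreal (x * b powr (r - 1)) \<le> ennreal (x powr r * (1 / r) + b powr r * (r - 1) / r)"
    by (rule ennreal_leI)
  then show ?thesis
    using real r by (simp add: ennpowr_ennreal' flip: ennreal_mult'' ennreal_plus)
next
  case top
  then show ?thesis using r b by (simp add: ennpowr_def ennreal_top_mult)
qed

text \<open>Integrate Young's inequality with a constant b and take b = I / m, the mean of u: the
  last term is then the fraction (r - 1) / r of the left side and can be absorbed. Absorbing
  requires finite quantities, so the null and infinite cases are split off first.\<close>

lemma Jensen_nn_integral:
  assumes [measurable]: "u \<in> borel_measurable M" and r: "1 \<le> r" and fin: "emeasure M (space M) < \<infinity>"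
  shows "ennpowr (\<integral>\<^sup>+x. u x \<partial>M) r \<le> (\<integral>\<^sup>+x. ennpowr (u x) r \<partial>M) * ennpowr (emeasure M (space M)) (r - 1)"
proof (cases "r = 1")
  case False
  with r have r: "1 < r" by simp
  define I where "I = (\<integral>\<^sup>+x. u x \<partial>M)"
  define F where "F = (\<integral>\<^sup>+x. ennpowr (u x) r \<partial>M)"
  define m where "m = emeasure M (space M)"
  have young: "I * ennreal (b powr (r - 1)) \<le> F * ennreal (1 / r) + ennreal (b powr r * (r - 1) / r) * m"
    if "0 < b" for b :: real
  proof -
    have "I * ennreal (b powr (r - 1)) = (\<integral>\<^sup>+x. u x * ennreal (b powr (r - 1)) \<partial>M)"
      unfolding I_def by (simp add: nn_integral_multc)
    also have "\<dots> \<le> (\<integral>\<^sup>+x. ennpowr (u x) r * ennreal (1 / r) + ennreal (b powr r * (r - 1) / r) \<partial>M)"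
      by (intro nn_integral_mono young_ennreal r that)
    also have "\<dots> = F * ennreal (1 / r) + ennreal (b powr r * (r - 1) / r) * m"
      unfolding F_def m_def by (subst nn_integral_add) (auto simp: nn_integral_multc)
    finally show ?thesis .
  qed
  obtain m' where m': "m = ennreal m'" "0 \<le> m'"
    using fin unfolding m_def by (cases "emeasure M (space M)") auto
  show ?thesis
  proof (cases "m' = 0")
    case True
    then have "emeasure M (space M) = 0" using m' by (simp add: m_def)
    then have "AE x in M. u x = 0"
      by (intro AE_I[of _ _ "space M"]) auto
    then have "I = 0" unfolding I_def by (simp add: nn_integral_0_iff_AE)
    then show ?thesis using r by (simp add: I_def[symmetric])
  next
    case False
    with m' have m0: "0 < m'" by simp
    show ?thesis
    proof (cases "F = \<infinity>")
      case True
      then show ?thesis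
        using m0 m' r by (simp add: F_def[symmetric] m_def[symmetric] ennpowr_ennreal ennreal_top_mult)
    next
      case False
      then obtain F' where F': "F = ennreal F'" "0 \<le> F'" by (cases F) auto
      \<comment> \<open>Finiteness of I is itself read off from the integrated inequality, with b =
        1.\<close>
      have "I < \<infinity>"
      proof (rule ccontr)
        assume "\<not> I < \<infinity>"
        then have "I = top" by (simp add: less_top[symmetric])
        then show False
          using young[of 1] F' m' by (simp add: ennreal_mult_eq_top_iff top_unique)
      qed
      then obtain I' where I': "I = ennreal I'" "0 \<le> I'" by (cases I) auto
      show ?thesis
      proof (cases "I' = 0")
        case True
        then show ?thesis using I' r by (simp add: I_def[symmetric])
      next
        case False
        with I' have I0: "0 < I'" by simp
        have "ennreal (I' * (I' / m') powr (r - 1)) \<le> ennreal (F' * (1 / r) + (I' / m') powr r * (r - 1) / r * m')"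
        proof -
          have "ennreal (I' * (I' / m') powr (r - 1)) = I * ennreal ((I' / m') powr (r - 1))"
            using I' by (simp add: ennreal_mult'')
          also have "\<dots> \<le> F * ennreal (1 / r) + ennreal ((I' / m') powr r * (r - 1) / r) * m"
            using I0 m0 by (intro young) simp
          also have "\<dots> = ennreal (F' * (1 / r)) + ennreal ((I' / m') powr r * (r - 1) / r * m')"
            using r F' m' by (subst (1 2) ennreal_mult) auto
          also have "\<dots> = ennreal (F' * (1 / r) + (I' / m') powr r * (r - 1) / r * m')"
            using r F' m' by (subst ennreal_plus) auto
          finally show ?thesis .
        qed
        then have "I' * (I' / m') powr (r - 1) \<le> F' * (1 / r) + (I' / m') powr r * (r - 1) / r * m'"
          using F' m0 r by (subst (asm) ennreal_le_iff) auto
        moreover define X where "X = I' * (I' / m') powr (r - 1)"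
        moreover have "(I' / m') powr r = X / m'"
          using I0 m0 by (simp add: X_def powr_diff)
        ultimately have "X \<le> F' * (1 / r) + X / m' * (r - 1) / r * m'" by simp
        then have "X * r \<le> F' + X * (r - 1)"
          using r m0 by (simp add: field_simps)
        then have "X \<le> F'" by (simp add: algebra_simps)
        then have "I' * (I' / m') powr (r - 1) \<le> F'" unfolding X_def .
        moreover have "I' * (I' / m') powr (r - 1) = I' powr r / m' powr (r - 1)"
          using I0 m0 by (simp add: powr_diff powr_divide)
        ultimately have "I' powr r \<le> F' * m' powr (r - 1)"
          using m0 by (simp add: field_simps)
        then have "ennreal (I' powr r) \<le> ennreal F' * ennreal (m' powr (r - 1))"
          using F' by (simp flip: ennreal_mult)
        then have "ennpowr I r \<le> F * ennpowr m (r - 1)"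
          unfolding I'(1) F'(1) m'(1) ennpowr_ennreal[OF I0] ennpowr_ennreal[OF m0] .
        then show ?thesis
          unfolding I_def m_def F_def .
      qed
    qed
  qed
qed simp

section \<open>Geometric sums over dyadic levels\<close>

lemma nn_integral_int_shift:
  "(\<integral>\<^sup>+k. f k \<partial>count_space {..(K::int)}) = (\<Sum>j::nat. f (K - int j))"
proof -
  have "bij_betw (\<lambda>j::nat. K - int j) UNIV {..K}"
    by (rule bij_betw_byWitness[where f' = "\<lambda>k. nat (K - k)"]) auto
  then show ?thesis
    by (simp add: nn_integral_bij_count_space[symmetric] nn_integral_count_space_nat)
qed

text \<open>From 2^e = exp (e ln 2) \<ge> 1 + e / 2. This bound for a geometric series is the source
  of the factors 1 / (p - r), 1 / (r - 1) and 1 / \<alpha> below.\<close>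

lemma inverse_one_minus_powr_le:
  fixes e :: real
  assumes "0 < e"
  shows "1 / (1 - 2 powr (- e)) \<le> 2 + 2 / e"
proof -
  have "2 powr (- e) * (1 + e / 2) \<le> 1"
  proof -
    have "1 + e * ln 2 \<le> exp (e * ln 2)" by (rule exp_ge_add_one_self)
    moreover have "e * (1 / 2) \<le> e * ln 2" using ln2_ge_two_thirds assms by (intro mult_left_mono) auto
    ultimately have "1 + e / 2 \<le> exp (e * ln 2)" by linarith
    then have "1 + e / 2 \<le> 2 powr e" unfolding powr_def by simp
    then show ?thesis by (simp add: powr_minus field_simps)
  qed
  then have "2 powr (- e) \<le> 1 / (1 + e / 2)" using assms by (simp add: field_simps)
  then have "e / (2 + e) \<le> 1 - 2 powr (- e)" using assms by (simp add: field_simps)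
  moreover have "0 < e / (2 + e)" using assms by simp
  ultimately have "1 / (1 - 2 powr (- e)) \<le> 1 / (e / (2 + e))"
    by (intro divide_left_mono mult_pos_pos) linarith+
  also have "\<dots> \<le> 2 + 2 / e" using assms by (simp add: field_simps)
  finally show ?thesis .
qed

text \<open>A discrete layer-cake formula: the levels below v form a geometric progression whose
  largest term is below v^e. With v = g x it turns a sum of estimates over the levels 2^k back into
  a power of g x.\<close>

lemma dyadic_level_sum_le:
  fixes v :: ennreal
  assumes e: "0 < e"
  shows "(\<integral>\<^sup>+k. ennreal (2 powr (real_of_int k * e)) * indicator {k. ennreal (2 powr real_of_int k) < v} k
            \<partial>count_space UNIV) \<le> ennreal (2 + 2 / e) * ennpowr v e"
proof (cases v)
  case top
  moreover have "2 + 2 / e \<noteq> 0" using e by (simp add: add_pos_pos less_imp_neq[symmetric])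
  ultimately show ?thesis using e by (simp add: ennreal_mult_top del: ennreal_plus)
next
  case (real x)
  show ?thesis
  proof (cases "x = 0")
    case True
    with real show ?thesis by simp
  next
    case False
    with real have x: "0 < x" by simp
    \<comment> \<open>The largest k with 2^k strictly below x; the ceiling minus one, not the floor,
      because the inequality is strict.\<close>
    define K where "K = \<lceil>log 2 x\<rceil> - 1"
    have lt: "2 powr real_of_int k < x \<longleftrightarrow> k \<le> K" for k
    proof -
      have "2 powr real_of_int k < x \<longleftrightarrow> real_of_int k < log 2 x"
        using x by (simp add: less_log_iff)
      also have "\<dots> \<longleftrightarrow> k \<le> K" unfolding K_def by (simp add: less_ceiling_iff[symmetric])
      finally show ?thesis .
    qed
    define y where "y = 2 powr (- e)"
    have y: "0 < y" "y < 1" using e gr_one_powr[of 2 e] by (auto simp: y_def powr_minus inverse_less_1_iff)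
    have tm: "2 powr (real_of_int (K - int j) * e) = 2 powr (real_of_int K * e) * y ^ j" for j
      by (simp add: y_def powr_add[symmetric] powr_realpow[symmetric] powr_powr algebra_simps)
    have "(\<integral>\<^sup>+k. ennreal (2 powr (real_of_int k * e)) * indicator {k. ennreal (2 powr real_of_int k) < v} k
            \<partial>count_space UNIV) = (\<integral>\<^sup>+k. ennreal (2 powr (real_of_int k * e)) \<partial>count_space {..K})"
      using real lt by (auto simp: nn_integral_count_space_indicator ennreal_less_iff
          intro!: nn_integral_cong split: split_indicator)
    also have "\<dots> = (\<Sum>j. ennreal (2 powr (real_of_int K * e)) * ennreal (y ^ j))"
      unfolding nn_integral_int_shift tm using y by (simp add: ennreal_mult)
    also have "\<dots> = ennreal (2 powr (real_of_int K * e)) * ennreal (1 / (1 - y))"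
      using y by (simp add: ennreal_suminf_cmult suminf_ennreal2 summable_geometric suminf_geometric)
    also have "\<dots> \<le> ennreal (x powr e) * ennreal (2 + 2 / e)"
    proof (intro mult_mono ennreal_leI)
      have "2 powr real_of_int K < x" using lt by simp
      then have "(2 powr real_of_int K) powr e \<le> x powr e" using e by (intro powr_mono2) auto
      then show "2 powr (real_of_int K * e) \<le> x powr e" by (simp add: powr_powr)
      show "1 / (1 - y) \<le> 2 + 2 / e" unfolding y_def by (rule inverse_one_minus_powr_le[OF e])
    qed auto
    finally show ?thesis using real x by (simp add: ennpowr_ennreal mult.commute)
  qed
qed

section \<open>Dyadic cubes\<close>

text \<open>A cube is named by its generation and its lower corner. Cubes are then half-open,
  nesting is arithmetic of floors, and the side length 2^k is part of the name.\<close>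

definition corner :: "int \<Rightarrow> 'a::euclidean_space \<Rightarrow> 'a" where
  "corner k x = (\<Sum>i\<in>Basis. (2 powr k * \<lfloor>(x \<bullet> i) / 2 powr k\<rfloor>) *\<^sub>R i)"

definition cubes :: "(int \<times> 'a::euclidean_space) set" where
  "cubes = {Q. corner (fst Q) (snd Q) = snd Q}"

definition cube :: "int \<times> 'a \<Rightarrow> 'a::euclidean_space set" where
  "cube Q = {y. corner (fst Q) y = snd Q}"

text \<open>The centre is the lower corner, at distance at most DIM 2^k from the points of the cube.
  The factor 4 leaves room for nesting: for l > k one has DIM 2^l + 4 DIM 2^k \<le> 3 DIM 2^l, so
  the ball of an ancestor contains the ball of Q.\<close>

definition cube_ball :: "int \<times> 'a \<Rightarrow> 'a::euclidean_space set" where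
  "cube_ball Q = ball (snd Q) (4 * DIM('a) * 2 powr real_of_int (fst Q))"

definition ancestor :: "int \<Rightarrow> int \<times> 'a \<Rightarrow> int \<times> 'a::euclidean_space" where
  "ancestor l Q = (l, corner l (snd Q))"

lemma corner_inner: "i \<in> Basis \<Longrightarrow> corner k x \<bullet> i = 2 powr k * \<lfloor>(x \<bullet> i) / 2 powr k\<rfloor>"
  by (simp add: corner_def inner_sum_left_Basis)

lemma corner_eq_iff:
  "corner k x = corner k y \<longleftrightarrow> (\<forall>i\<in>Basis. \<lfloor>(x \<bullet> i) / 2 powr k\<rfloor> = \<lfloor>(y \<bullet> i) / 2 powr k\<rfloor>)"
  by (subst euclidean_eq_iff) (auto simp: corner_inner)

text \<open>The grids are nested: rounding down to multiples of 2^k first does not change floor (t /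
  2^l), because dividing by the integer 2^(l - k) commutes with the floor in this sense.\<close>

lemma corner_corner:
  assumes "k \<le> l"
  shows "corner l (corner k y) = corner l y"
proof -
  define m where "m = nat (l - k)"
  have l: "2 powr real_of_int l = 2 powr k * real_of_int (2 ^ m)"
    using assms by (simp add: m_def powr_realpow[symmetric] powr_add[symmetric])
  have "\<lfloor>(2 powr k * \<lfloor>t / 2 powr k\<rfloor>) / 2 powr l\<rfloor> = \<lfloor>t / 2 powr l\<rfloor>" for t :: real
  proof -
    have "\<lfloor>t / 2 powr l\<rfloor> = \<lfloor>(t / 2 powr k) / real_of_int (2 ^ m)\<rfloor>" unfolding l by simp
    also have "\<dots> = \<lfloor>t / 2 powr k\<rfloor> div 2 ^ m" by (rule floor_divide_real_eq_div) simp
    also have "\<dots> = \<lfloor>real_of_int \<lfloor>t / 2 powr k\<rfloor> / real_of_int (2 ^ m)\<rfloor>"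
      by (rule floor_divide_of_int_eq[symmetric])
    also have "\<dots> = \<lfloor>(2 powr k * \<lfloor>t / 2 powr k\<rfloor>) / 2 powr l\<rfloor>" unfolding l by simp
    finally show ?thesis by simp
  qed
  then show ?thesis by (simp add: corner_eq_iff corner_inner)
qed

lemma corner_in_cubes [simp]: "(k, corner k y) \<in> cubes"
  by (simp add: cubes_def corner_corner)

lemma ancestor_in_cubes [simp]: "ancestor l Q \<in> cubes"
  by (simp add: ancestor_def)

lemma fst_ancestor [simp]: "fst (ancestor l Q) = l"
  by (simp add: ancestor_def)

lemma in_cube_corner [simp]: "y \<in> cube (k, corner k y)"
  by (simp add: cube_def)

lemma ancestor_eq: "y \<in> cube Q \<Longrightarrow> fst Q \<le> l \<Longrightarrow> ancestor l Q = (l, corner l y)"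
  by (simp add: cube_def ancestor_def) (metis corner_corner)

lemma ancestor_self: "Q \<in> cubes \<Longrightarrow> ancestor (fst Q) Q = Q"
  by (simp add: cubes_def ancestor_def prod_eq_iff)

lemma ancestor_ancestor: "k \<le> l \<Longrightarrow> ancestor l (ancestor k Q) = ancestor l Q"
  by (simp add: ancestor_def corner_corner)

lemma cube_subset_ancestor: "fst Q \<le> l \<Longrightarrow> cube Q \<subseteq> cube (ancestor l Q)"
  by (auto simp: cube_def ancestor_def) (metis corner_corner)

lemma dist_corner: "dist (corner k y) y \<le> DIM('a) * 2 powr k" for y :: "'a::euclidean_space"
proof -
  have "norm (corner k y - y) \<le> (\<Sum>i\<in>Basis. \<bar>(corner k y - y) \<bullet> i\<bar>)" by (rule norm_le_l1)
  also have "\<dots> \<le> (\<Sum>i\<in>(Basis::'a set). 2 powr k)"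
  proof (rule sum_mono)
    fix i :: 'a assume i: "i \<in> Basis"
    define t where "t = (y \<bullet> i) / 2 powr k"
    have "(corner k y - y) \<bullet> i = 2 powr k * (\<lfloor>t\<rfloor> - t)"
      using i by (simp add: inner_diff_left corner_inner t_def algebra_simps)
    moreover have "\<bar>\<lfloor>t\<rfloor> - t\<bar> \<le> 1" by linarith
    ultimately show "\<bar>(corner k y - y) \<bullet> i\<bar> \<le> 2 powr k"
      by (simp add: abs_mult mult_left_le)
  qed
  finally show ?thesis by (simp add: dist_norm)
qed

lemma dist_cube:
  fixes Q :: "int \<times> 'a::euclidean_space"
  shows "y \<in> cube Q \<Longrightarrow> dist (snd Q) y \<le> DIM('a) * 2 powr real_of_int (fst Q)"
  using dist_corner[of "fst Q" y] by (simp add: cube_def)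

lemma cube_subset_ball: "cube Q \<subseteq> cube_ball Q" for Q :: "int \<times> 'a::euclidean_space"
proof
  fix y assume "y \<in> cube Q"
  from dist_cube[OF this] have "dist (snd Q) y \<le> DIM('a) * 2 powr real_of_int (fst Q)" .
  also have "\<dots> < 4 * DIM('a) * 2 powr real_of_int (fst Q)" by simp
  finally show "y \<in> cube_ball Q" by (simp add: cube_ball_def)
qed

lemma cube_ball_subset_ancestor:
  fixes Q :: "int \<times> 'a::euclidean_space"
  assumes "Q \<in> cubes" "fst Q \<le> l"
  shows "cube_ball Q \<subseteq> cube_ball (ancestor l Q)"
proof (cases "l = fst Q")
  case True
  then show ?thesis using ancestor_self[OF assms(1)] by simp
next
  case False
  have "2 * 2 powr real_of_int (fst Q) = 2 powr (1 + real_of_int (fst Q))" by (simp add: powr_add)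
  also have "\<dots> \<le> 2 powr real_of_int l" using False assms by (intro powr_mono) auto
  finally have p: "2 * 2 powr real_of_int (fst Q) \<le> 2 powr real_of_int l" .
  show ?thesis
  proof
    fix y assume y: "y \<in> cube_ball Q"
    have "dist (corner l (snd Q)) y \<le> dist (corner l (snd Q)) (snd Q) + dist (snd Q) y"
      by (rule dist_triangle)
    also have "\<dots> < DIM('a) * 2 powr l + 4 * DIM('a) * 2 powr real_of_int (fst Q)"
      using y dist_corner[of l "snd Q"] by (simp add: cube_ball_def)
    also have "\<dots> \<le> DIM('a) * 2 powr l + 2 * DIM('a) * 2 powr l"
      using mult_left_mono[OF p, of "2 * real DIM('a)"] by simp
    also have "\<dots> \<le> 4 * DIM('a) * 2 powr l" by simp
    finally show "y \<in> cube_ball (ancestor l Q)" by (simp add: cube_ball_def ancestor_def)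
  qed
qed

lemma cube_eq_PiE:
  assumes "Q \<in> cubes"
  shows "cube Q = {y. \<forall>i\<in>Basis. snd Q \<bullet> i \<le> y \<bullet> i \<and> y \<bullet> i < snd Q \<bullet> i + 2 powr real_of_int (fst Q)}"
proof -
  obtain k c where Q: "Q = (k, c)" by (cases Q)
  have c: "corner k c = c" using assms by (simp add: cubes_def Q)
  have "corner k y = c \<longleftrightarrow> (\<forall>i\<in>Basis. c \<bullet> i \<le> y \<bullet> i \<and> y \<bullet> i < c \<bullet> i + 2 powr k)" for y
  proof -
    have "corner k y = c \<longleftrightarrow> (\<forall>i\<in>Basis. \<lfloor>(y \<bullet> i) / 2 powr k\<rfloor> = \<lfloor>(c \<bullet> i) / 2 powr k\<rfloor>)"
      using corner_eq_iff[of k y c] c by simp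
    also have "\<dots> \<longleftrightarrow> (\<forall>i\<in>Basis. c \<bullet> i \<le> y \<bullet> i \<and> y \<bullet> i < c \<bullet> i + 2 powr k)"
    proof (rule ball_cong[OF refl])
      fix i :: 'a assume "i \<in> Basis"
      then have e: "c \<bullet> i = 2 powr k * \<lfloor>(c \<bullet> i) / 2 powr k\<rfloor>"
        using corner_inner[of i k c] c by simp
      have "\<lfloor>(y \<bullet> i) / 2 powr k\<rfloor> = \<lfloor>(c \<bullet> i) / 2 powr k\<rfloor> \<longleftrightarrow>
          real_of_int \<lfloor>(c \<bullet> i) / 2 powr k\<rfloor> \<le> (y \<bullet> i) / 2 powr k \<and>
          (y \<bullet> i) / 2 powr k < real_of_int \<lfloor>(c \<bullet> i) / 2 powr k\<rfloor> + 1"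
        by (simp add: floor_eq_iff)
      also have "\<dots> \<longleftrightarrow> c \<bullet> i \<le> y \<bullet> i \<and> y \<bullet> i < c \<bullet> i + 2 powr k"
        by (subst (3 4) e) (simp add: pos_le_divide_eq pos_divide_less_eq algebra_simps)
      finally show "(\<lfloor>(y \<bullet> i) / 2 powr k\<rfloor> = \<lfloor>(c \<bullet> i) / 2 powr k\<rfloor>) =
          (c \<bullet> i \<le> y \<bullet> i \<and> y \<bullet> i < c \<bullet> i + 2 powr k)" .
    qed
    finally show ?thesis .
  qed
  then show ?thesis by (simp add: cube_def Q)
qed

section \<open>Volumes of cubes and of their balls\<close>

lemma corner_measurable [measurable]: "corner k \<in> borel_measurable borel"
  unfolding corner_def by measurable

lemma cube_borel [measurable]: "cube Q \<in> sets borel"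
  unfolding cube_def by measurable

lemma cube_lebesgue [measurable]: "cube Q \<in> sets lebesgue"
  using cube_borel by simp

lemma cube_ball_lebesgue [measurable]: "cube_ball Q \<in> sets lebesgue"
  by (simp add: cube_ball_def)

text \<open>The half-open cube lies between an open and a closed box of the same volume.\<close>

lemma emeasure_cube:
  fixes Q :: "int \<times> 'a::euclidean_space"
  assumes "Q \<in> cubes"
  shows "emeasure lebesgue (cube Q) = ennreal ((2 powr real_of_int (fst Q)) ^ DIM('a))"
proof -
  define c where "c = snd Q"
  define d where "d = c + (2 powr real_of_int (fst Q)) *\<^sub>R One"
  have d: "d \<bullet> i = c \<bullet> i + 2 powr real_of_int (fst Q)" if "i \<in> Basis" for i
    using that by (simp add: d_def inner_add_left)
  have "emeasure lborel (box c d) = ennreal ((2 powr real_of_int (fst Q)) ^ DIM('a))"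
    by (subst emeasure_lborel_box) (auto simp: d inner_diff_left)
  moreover have "emeasure lborel (cbox c d) = ennreal ((2 powr real_of_int (fst Q)) ^ DIM('a))"
    by (subst emeasure_lborel_cbox) (auto simp: d inner_diff_left)
  moreover have "emeasure lborel (box c d) \<le> emeasure lborel (cube Q)"
    by (intro emeasure_mono) (auto simp: cube_eq_PiE[OF assms] mem_box d c_def[symmetric] less_imp_le)
  moreover have "emeasure lborel (cube Q) \<le> emeasure lborel (cbox c d)"
    by (intro emeasure_mono) (auto simp: cube_eq_PiE[OF assms] mem_box d c_def[symmetric] less_imp_le)
  ultimately show ?thesis by simp
qed

lemma emeasure_lborel_cube:
  "Q \<in> cubes \<Longrightarrow> emeasure lborel (cube Q) = ennreal ((2 powr real_of_int (fst Q)) ^ DIM('a))"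
  for Q :: "int \<times> 'a::euclidean_space"
  using emeasure_cube[of Q] by simp

lemma emeasure_lebesgue_ball:
  "0 \<le> t \<Longrightarrow> emeasure lebesgue (ball x t) = ennreal (unit_ball_vol DIM('a) * t ^ DIM('a))" for x :: "'a::euclidean_space"
  by (simp add: emeasure_ball)

lemma emeasure_ball_pos: "0 < t \<Longrightarrow> 0 < emeasure lborel (ball x t)" for x :: "'a::euclidean_space"
  by (simp add: emeasure_ball)

lemma emeasure_ball_finite: "emeasure lborel (ball x t) < \<infinity>" for x :: "'a::euclidean_space"
  by (cases "0 \<le> t") (auto simp: emeasure_ball less_top[symmetric] ball_empty)

lemma emeasure_cube_ball:
  fixes Q :: "int \<times> 'a::euclidean_space"
  assumes "Q \<in> cubes"
  shows "emeasure lebesgue (cube_ball Q) =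
    ennreal (unit_ball_vol DIM('a) * (4 * DIM('a)) ^ DIM('a)) * emeasure lebesgue (cube Q)"
  unfolding emeasure_cube[OF assms] cube_ball_def
  by (subst emeasure_lebesgue_ball) (auto simp: power_mult_distrib mult_ac simp flip: ennreal_mult)

text \<open>The ratio of the volumes of \<open>cube_ball Q\<close> and \<open>cube Q\<close>,
  independent of Q. The added 1 makes it at least 1, so that its powers increase with the
  exponent.\<close>

definition ball_const :: "'a::euclidean_space itself \<Rightarrow> real" where
  "ball_const _ = 1 + unit_ball_vol DIM('a) * (4 * DIM('a)) ^ DIM('a)"

lemma ball_const_ge_1: "1 \<le> ball_const TYPE('a::euclidean_space)"
  by (simp add: ball_const_def)

lemma emeasure_cube_ball_le:
  fixes Q :: "int \<times> 'a::euclidean_space"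
  assumes "Q \<in> cubes"
  shows "emeasure lebesgue (cube_ball Q) \<le> ennreal (ball_const TYPE('a)) * emeasure lebesgue (cube Q)"
  unfolding emeasure_cube_ball[OF assms] by (intro mult_right_mono ennreal_leI) (auto simp: ball_const_def)

lemma countable_cubes: "countable (cubes :: (int \<times> 'a::euclidean_space) set)"
proof -
  have "range (corner k) \<subseteq> (\<lambda>m. \<Sum>i\<in>Basis. (2 powr k * real_of_int (m i)) *\<^sub>R i) ` (PiE Basis (\<lambda>_::'a. UNIV))" for k
  proof clarify
    fix x :: 'a
    show "corner k x \<in> (\<lambda>m. \<Sum>i\<in>Basis. (2 powr k * real_of_int (m i)) *\<^sub>R i) ` (PiE Basis (\<lambda>_::'a. UNIV))"
      by (rule image_eqI[where x = "restrict (\<lambda>i. \<lfloor>(x \<bullet> i) / 2 powr k\<rfloor>) Basis"]) (auto simp: corner_def)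
  qed
  moreover have "countable (PiE Basis (\<lambda>_::'a. UNIV :: int set))" by (intro countable_PiE) auto
  ultimately have "countable (range (corner k :: 'a \<Rightarrow> 'a))" for k
    by (meson countable_image countable_subset)
  then have "countable (Sigma UNIV (\<lambda>k. range (corner k :: 'a \<Rightarrow> 'a)))" by (intro countable_SIGMA) auto
  then show ?thesis
    by (rule countable_subset[rotated]) (auto simp: cubes_def image_iff, metis)
qed

text \<open>Within a ball of radius at most 2^k each coordinate differs from that of the centre by
  less than one side length, hence each floor by -1, 0 or 1. This gives 3^DIM candidates.\<close>

lemma corner_neighbours:
  fixes x :: "'a::euclidean_space"
  assumes "t \<le> 2 powr k"
  obtains N where "finite N" "card N \<le> 3 ^ DIM('a)" "corner k ` ball x t \<subseteq> N" "N \<subseteq> range (corner k)"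
proof
  let ?F = "\<lambda>m. \<Sum>i\<in>Basis. (2 powr k * (\<lfloor>(x \<bullet> i) / 2 powr k\<rfloor> + real_of_int (m i))) *\<^sub>R i"
  let ?M = "PiE Basis (\<lambda>_::'a. {-1, 0, 1::int})"
  let ?N = "?F ` ?M \<inter> range (corner k)"
  have M: "finite ?M" "card ?M = 3 ^ DIM('a)"
    by (auto simp: finite_PiE card_PiE numeral_3_eq_3)
  show "finite ?N" using M by simp
  have "card ?N \<le> card (?F ` ?M)" using M by (intro card_mono) auto
  also have "\<dots> \<le> card ?M" using M by (intro card_image_le) auto
  finally show "card ?N \<le> 3 ^ DIM('a)" using M by simp
  show "?N \<subseteq> range (corner k)" by simp
  show "corner k ` ball x t \<subseteq> ?N"
  proof clarify
    fix y assume y: "y \<in> ball x t"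
    let ?m = "restrict (\<lambda>i. \<lfloor>(y \<bullet> i) / 2 powr k\<rfloor> - \<lfloor>(x \<bullet> i) / 2 powr k\<rfloor>) Basis"
    have "\<lfloor>(y \<bullet> i) / 2 powr k\<rfloor> - \<lfloor>(x \<bullet> i) / 2 powr k\<rfloor> \<in> {-1, 0, 1}" if "i \<in> Basis" for i
    proof -
      have "\<bar>(y - x) \<bullet> i\<bar> \<le> norm (y - x)" using that by (rule Basis_le_norm)
      also have "\<dots> < 2 powr k" using y assms by (simp add: dist_norm norm_minus_commute)
      finally have "\<bar>(y \<bullet> i) / 2 powr k - (x \<bullet> i) / 2 powr k\<bar> < 1"
        by (simp add: inner_diff_left diff_divide_distrib[symmetric] abs_divide)
      then have "\<bar>\<lfloor>(y \<bullet> i) / 2 powr k\<rfloor> - \<lfloor>(x \<bullet> i) / 2 powr k\<rfloor>\<bar> \<le> 1" by linarith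
      then show ?thesis by (simp add: abs_le_iff) linarith
    qed
    then have "?m \<in> ?M" by auto
    moreover have "corner k y = ?F ?m" by (simp add: corner_def)
    ultimately show "corner k y \<in> ?N" by blast
  qed
qed

section \<open>Maximal dyadic cubes and the Calderon-Zygmund decomposition\<close>

definition tops :: "(int \<times> 'a::euclidean_space \<Rightarrow> bool) \<Rightarrow> (int \<times> 'a) set" where
  "tops P = {Q \<in> cubes. P Q \<and> (\<forall>l > fst Q. \<not> P (ancestor l Q))}"

lemma countable_tops: "countable (tops P)"
  by (rule countable_subset[OF _ countable_cubes]) (auto simp: tops_def)

text \<open>Of two cubes with a common point, the larger is an ancestor of the smaller, and
  maximality excludes a strict one.\<close>

lemma tops_disjoint:
  assumes "Q \<in> tops P" "Q' \<in> tops P" "y \<in> cube Q" "y \<in> cube Q'"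
  shows "Q = Q'"
proof (rule ccontr)
  have *: "\<not> fst Q < fst Q'" if "Q \<in> tops P" "Q' \<in> tops P" "y \<in> cube Q" "y \<in> cube Q'" for Q Q'
  proof
    assume l: "fst Q < fst Q'"
    have "ancestor (fst Q') Q = Q'"
      using ancestor_eq[OF that(3), of "fst Q'"] that(4) l by (simp add: cube_def prod_eq_iff)
    then show False using that l by (auto simp: tops_def)
  qed
  assume "Q \<noteq> Q'"
  moreover have "fst Q = fst Q'" using *[OF assms] *[OF assms(2,1,4,3)] by simp
  ultimately show False using assms(3,4) by (simp add: cube_def prod_eq_iff)
qed

text \<open>The property fails from generation K on, so there is a largest generation, not merely a
  first one, at which an ancestor has it.\<close>

lemma tops_exists:
  assumes "Q \<in> cubes" "P Q" "\<And>l. K \<le> l \<Longrightarrow> \<not> P (ancestor l Q)"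
  obtains Q' where "Q' \<in> tops P" "fst Q \<le> fst Q'" "Q' = ancestor (fst Q') Q"
proof -
  define S where "S = {l. fst Q \<le> l \<and> P (ancestor l Q)}"
  have "S \<subseteq> {fst Q..K}" 
  proof
    fix l assume "l \<in> S"
    then show "l \<in> {fst Q..K}" using assms(3)[of l] by (cases "K \<le> l") (auto simp: S_def)
  qed
  then have fin: "finite S" by (rule finite_subset) simp
  have ne: "fst Q \<in> S" using assms by (simp add: S_def ancestor_self)
  define m where "m = Max S"
  have m: "m \<in> S" using fin ne unfolding m_def by (intro Max_in) auto
  have "ancestor m Q \<in> tops P"
    unfolding tops_def
  proof (intro CollectI conjI allI impI)
    fix l assume l: "fst (ancestor m Q) < l"
    show "\<not> P (ancestor l (ancestor m Q))"
    proof
      assume "P (ancestor l (ancestor m Q))"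
      then have "l \<in> S" using l m by (simp add: S_def ancestor_ancestor)
      then have "l \<le> m" unfolding m_def using fin by simp
      then show False using l by simp
    qed
  qed (use m in \<open>auto simp: S_def\<close>)
  then show thesis using m by (intro that[of "ancestor m Q"]) (auto simp: S_def)
qed

definition cube_integral :: "('a::euclidean_space \<Rightarrow> ennreal) \<Rightarrow> int \<times> 'a \<Rightarrow> ennreal" where
  "cube_integral g Q = (\<integral>\<^sup>+x\<in>cube Q. g x \<partial>lebesgue)"

text \<open>The Calderon-Zygmund cubes of g at height \<open>\<mu>\<close>, with means written
  without quotients.\<close>

definition level_cubes :: "('a::euclidean_space \<Rightarrow> ennreal) \<Rightarrow> ennreal \<Rightarrow> (int \<times> 'a) set" where
  "level_cubes g \<mu> = tops (\<lambda>Q. \<mu> * emeasure lebesgue (cube Q) < cube_integral g Q)"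

lemma cube_integral_le: "cube_integral g Q \<le> (\<integral>\<^sup>+x. g x \<partial>lebesgue)"
  unfolding cube_integral_def by (intro nn_integral_mono) (auto split: split_indicator)

lemma ennreal_le_large_power:
  assumes "G < \<infinity>" "0 < \<mu>"
  obtains K :: int where "\<And>l. K \<le> l \<Longrightarrow> G \<le> \<mu> * ennreal ((2 powr l) ^ DIM('a::euclidean_space))"
proof -
  obtain G' where G: "G = ennreal G'" "0 \<le> G'" using assms by (cases G) auto
  obtain \<epsilon> where \<epsilon>: "0 < \<epsilon>" "ennreal \<epsilon> \<le> \<mu>" using assms(2)
    by (cases \<mu>) (auto intro: that[of 1])
  define K where "K = max 0 \<lceil>log 2 (G' / \<epsilon> + 1)\<rceil>"
  have "G \<le> \<mu> * ennreal ((2 powr l) ^ DIM('a))" if "K \<le> l" for l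
  proof -
    have "log 2 (G' / \<epsilon> + 1) \<le> real_of_int l" using that unfolding K_def by linarith
    then have "G' / \<epsilon> + 1 \<le> 2 powr l" using G \<epsilon> by (subst (asm) log_le_iff) (auto simp: add_nonneg_pos)
    moreover have "2 powr l \<le> (2 powr l) ^ DIM('a)"
      using that by (intro self_le_power) (auto simp: K_def ge_one_powr_ge_zero DIM_positive)
    ultimately have "G' / \<epsilon> \<le> (2 powr l) ^ DIM('a)" by linarith
    then have "G' \<le> \<epsilon> * (2 powr l) ^ DIM('a)" using \<epsilon> by (simp add: field_simps)
    then have "G \<le> ennreal \<epsilon> * ennreal ((2 powr l) ^ DIM('a))"
      using \<epsilon> G by (simp add: ennreal_leI flip: ennreal_mult)
    also have "\<dots> \<le> \<mu> * ennreal ((2 powr l) ^ DIM('a))" using \<epsilon> by (intro mult_right_mono) auto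
    finally show ?thesis .
  qed
  then show thesis by (rule that)
qed

lemma level_cubes_exists:
  assumes "(\<integral>\<^sup>+x. g x \<partial>lebesgue) < \<infinity>" "0 < \<mu>" "Q \<in> cubes" "\<mu> * emeasure lebesgue (cube Q) < cube_integral g Q"
  obtains Q' where "Q' \<in> level_cubes g \<mu>" "fst Q \<le> fst Q'" "Q' = ancestor (fst Q') Q"
proof -
  obtain K :: int where K: "\<And>l. K \<le> l \<Longrightarrow> (\<integral>\<^sup>+x. g x \<partial>lebesgue) \<le> \<mu> * ennreal ((2 powr l) ^ DIM('a))"
    using ennreal_le_large_power[OF assms(1,2)] by blast
  have "\<not> \<mu> * emeasure lebesgue (cube (ancestor l Q)) < cube_integral g (ancestor l Q)" if "K \<le> l" for l
    using cube_integral_le[of g "ancestor l Q"] K[OF that]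
    by (simp add: emeasure_lborel_cube not_less)
  from tops_exists[where P = "\<lambda>Q. \<mu> * emeasure lebesgue (cube Q) < cube_integral g Q", OF assms(3,4) this]
  show thesis using that unfolding level_cubes_def by blast
qed

text \<open>By maximality the mean over the parent, whose volume is 2^DIM times larger, is at most
  \<open>\<mu>\<close>.\<close>

lemma level_cubes_upper:
  fixes g :: "'a::euclidean_space \<Rightarrow> ennreal"
  assumes "Q \<in> level_cubes g \<mu>"
  shows "cube_integral g Q \<le> 2 ^ DIM('a) * \<mu> * emeasure lebesgue (cube Q)"
proof -
  let ?Q' = "ancestor (fst Q + 1) Q"
  have Q: "Q \<in> cubes" using assms by (simp add: level_cubes_def tops_def)
  have "cube_integral g Q \<le> cube_integral g ?Q'"
    unfolding cube_integral_def using cube_subset_ancestor[of Q "fst Q + 1"]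
    by (intro nn_integral_mono) (auto split: split_indicator)
  also have "\<dots> \<le> \<mu> * emeasure lebesgue (cube ?Q')"
    using assms by (auto simp: level_cubes_def tops_def not_less)
  also have "emeasure lebesgue (cube ?Q') = 2 ^ DIM('a) * emeasure lebesgue (cube Q)"
    using Q by (simp add: emeasure_lborel_cube powr_add power_mult_distrib ennreal_mult mult.commute
        ennreal_power[symmetric] del: ennreal_power)
  finally show ?thesis by (simp add: mult_ac)
qed

text \<open>Compares 3^DIM neighbouring cubes of side at most 2 t with a ball of radius t.\<close>

definition cover_const :: "'a::euclidean_space itself \<Rightarrow> real" where
  "cover_const _ = 1 + 6 ^ DIM('a) / unit_ball_vol DIM('a)"

lemma cover_const_ge_1: "1 \<le> cover_const TYPE('a::euclidean_space)"
  by (simp add: cover_const_def)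

text \<open>If all dyadic cubes of side between t and 2 t that meet the ball had mean at most
  \<open>\<mu>\<close>, adding up at most 3^DIM of them would contradict \<open>avg\<close>. The
  maximal cube above an exceptional one need not contain x, but its ball does, because the balls are
  nested along ancestors.\<close>

lemma level_cubes_cover:
  fixes g :: "'a::euclidean_space \<Rightarrow> ennreal"
  assumes [measurable]: "g \<in> borel_measurable lebesgue" and fin: "(\<integral>\<^sup>+x. g x \<partial>lebesgue) < \<infinity>"
    and \<mu>: "0 < \<mu>" and t: "0 < t"
    and avg: "ennreal (cover_const TYPE('a)) * \<mu> < average (ball x t) g"
  obtains Q where "Q \<in> level_cubes g \<mu>" "x \<in> cube_ball Q"
proof -
  define k where "k = \<lceil>log 2 t\<rceil>"
  have k: "t \<le> 2 powr k" "2 powr k \<le> 2 * t"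
  proof -
    have "log 2 t \<le> k" unfolding k_def by linarith
    then show "t \<le> 2 powr k" using t by (simp add: log_le_iff)
    have "k \<le> log 2 t + 1" unfolding k_def by linarith
    then have "2 powr k \<le> 2 powr (log 2 t + 1)" by (intro powr_mono) auto
    then show "2 powr k \<le> 2 * t" using t by (simp add: powr_add)
  qed
  obtain N where N: "finite N" "card N \<le> 3 ^ DIM('a)" "corner k ` ball x t \<subseteq> N" "N \<subseteq> range (corner k)"
    using corner_neighbours[OF k(1)] by blast
  define N' where "N' = corner k ` ball x t"
  have N': "finite N'" "card N' \<le> 3 ^ DIM('a)"
    using N finite_subset[of N' N] card_mono[of N N'] unfolding N'_def by auto
  have vol: "emeasure lebesgue (cube (k, c)) = ennreal ((2 powr k) ^ DIM('a))" if "c \<in> N'" for c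
    using that by (subst emeasure_cube) (auto simp: N'_def)
  have "\<exists>c\<in>N'. \<mu> * emeasure lebesgue (cube (k, c)) < cube_integral g (k, c)"
  proof (rule ccontr)
    assume "\<not> ?thesis"
    then have le: "cube_integral g (k, c) \<le> \<mu> * ennreal ((2 powr k) ^ DIM('a))" if "c \<in> N'" for c
      using that vol by (auto simp: not_less)
    have "(\<integral>\<^sup>+y\<in>ball x t. g y \<partial>lebesgue) \<le> (\<integral>\<^sup>+y. (\<Sum>c\<in>N'. g y * indicator (cube (k, c)) y) \<partial>lebesgue)"
    proof (rule nn_integral_mono)
      fix y
      show "g y * indicator (ball x t) y \<le> (\<Sum>c\<in>N'. g y * indicator (cube (k, c)) y)"
      proof (cases "y \<in> ball x t")
        case True
        then have "corner k y \<in> N'" by (simp add: N'_def)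
        from member_le_sum[OF this, of "\<lambda>c. g y * indicator (cube (k, c)) y"] N'(1) True
        show ?thesis by simp
      qed simp
    qed
    also have "\<dots> = (\<Sum>c\<in>N'. cube_integral g (k, c))"
      by (subst nn_integral_sum) (auto simp: cube_integral_def)
    also have "\<dots> \<le> (\<Sum>c\<in>N'. \<mu> * ennreal ((2 powr k) ^ DIM('a)))" by (intro sum_mono le)
    also have "\<dots> = of_nat (card N') * (\<mu> * ennreal ((2 powr k) ^ DIM('a)))" by simp
    also have "\<dots> \<le> of_nat (3 ^ DIM('a)) * (\<mu> * ennreal ((2 * t) ^ DIM('a)))"
    proof (intro mult_mono order_refl ennreal_leI power_mono k)
      show "(of_nat (card N') :: ennreal) \<le> of_nat (3 ^ DIM('a))" using N'(2) by (rule of_nat_mono)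
    qed auto
    also have "\<dots> = ennreal ((6 * t) ^ DIM('a)) * \<mu>"
    proof -
      have "(of_nat (3 ^ DIM('a)) :: ennreal) = ennreal (3 ^ DIM('a))"
        by (simp add: ennreal_of_nat_eq_real_of_nat)
      moreover have "ennreal (3 ^ DIM('a)) * ennreal ((2 * t) ^ DIM('a)) = ennreal ((6 * t) ^ DIM('a))"
      proof -
        have "3 ^ DIM('a) * (2 * t) ^ DIM('a) = (3 * (2 * t)) ^ DIM('a)" by (rule power_mult_distrib[symmetric])
        also have "3 * (2 * t) = 6 * t" by simp
        finally show ?thesis using t by (subst ennreal_mult[symmetric]) simp_all
      qed
      ultimately show ?thesis by (metis mult.assoc mult.commute)
    qed
    also have "\<dots> \<le> ennreal (cover_const TYPE('a)) * \<mu> * emeasure lebesgue (ball x t)"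
    proof -
      have "(6 * t) ^ DIM('a) \<le> cover_const TYPE('a) * (unit_ball_vol DIM('a) * t ^ DIM('a))"
        using t unit_ball_vol_pos[of "real DIM('a)"]
        by (simp add: cover_const_def power_mult_distrib distrib_right less_imp_neq[symmetric])
      then have "ennreal ((6 * t) ^ DIM('a)) \<le> ennreal (cover_const TYPE('a)) * emeasure lebesgue (ball x t)"
        using t cover_const_ge_1[where 'a = 'a]
        by (simp only: emeasure_lebesgue_ball less_imp_le) (auto intro!: ennreal_leI simp flip: ennreal_mult)
      from mult_right_mono[OF this, of \<mu>] show ?thesis by (simp add: mult_ac)
    qed
    finally have "average (ball x t) g \<le> ennreal (cover_const TYPE('a)) * \<mu>"
      unfolding average_def using t
      by (intro divide_le_posI_ennreal) (auto simp: emeasure_ball_pos mult_ac)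
    with avg show False by simp
  qed
  then obtain y where y: "y \<in> ball x t"
    and P: "\<mu> * emeasure lebesgue (cube (k, corner k y)) < cube_integral g (k, corner k y)"
    by (auto simp: N'_def)
  obtain Q' where Q': "Q' \<in> level_cubes g \<mu>" "k \<le> fst Q'" "Q' = ancestor (fst Q') (k, corner k y)"
    using level_cubes_exists[OF fin \<mu> _ P] by auto
  have "x \<in> cube_ball (k, corner k y)"
  proof -
    have "dist (corner k y) x \<le> dist (corner k y) y + dist y x" by (rule dist_triangle)
    also have "\<dots> < DIM('a) * 2 powr k + 2 powr k"
      using y k dist_corner[of k y] by (simp add: dist_commute)
    also have "\<dots> \<le> 4 * DIM('a) * 2 powr k"
    proof -
      have "1 \<le> real DIM('a)" using DIM_ge_Suc0[where 'a = 'a] by linarith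
      then have "real DIM('a) + 1 \<le> 4 * real DIM('a)" by linarith
      then have "(real DIM('a) + 1) * 2 powr k \<le> 4 * real DIM('a) * 2 powr k" by (intro mult_right_mono) (assumption, simp)
      then show ?thesis by (simp add: distrib_right)
    qed
    finally show ?thesis by (simp add: cube_ball_def)
  qed
  then have "x \<in> cube_ball Q'"
    using cube_ball_subset_ancestor[of "(k, corner k y)" "fst Q'"] Q' by auto
  with Q' show thesis by (intro that)
qed

section \<open>Weak type estimates\<close>

lemma nn_integral_count_space_measurable:
  fixes f :: "'i \<Rightarrow> 'a \<Rightarrow> ennreal"
  assumes "countable I" and [measurable]: "\<And>i. i \<in> I \<Longrightarrow> f i \<in> borel_measurable M"
  shows "(\<lambda>x. \<integral>\<^sup>+i. f i x \<partial>count_space I) \<in> borel_measurable M"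
proof (cases "finite I")
  case True
  then show ?thesis by (simp add: nn_integral_count_space_finite)
next
  case False
  have bij: "bij_betw (from_nat_into I) UNIV I"
    using bij_betw_from_nat_into[OF assms(1) False] .
  then have "from_nat_into I n \<in> I" for n by (auto simp: bij_betw_def)
  then show ?thesis
    unfolding nn_integral_bij_count_space[OF bij, symmetric] nn_integral_count_space_nat by measurable
qed

lemma nn_integral_count_space_disjoint:
  assumes "\<And>i j. i \<in> I \<Longrightarrow> j \<in> I \<Longrightarrow> y \<in> E i \<Longrightarrow> y \<in> E j \<Longrightarrow> i = j"
    and "\<And>i. i \<in> I \<Longrightarrow> y \<in> E i \<Longrightarrow> c i \<le> B"
  shows "(\<integral>\<^sup>+i. c i * indicator (E i) y \<partial>count_space I) \<le> B"
proof (cases "\<exists>i\<in>I. y \<in> E i")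
  case True
  then obtain i where i: "i \<in> I" "y \<in> E i" by blast
  have "(\<integral>\<^sup>+j. c j * indicator (E j) y \<partial>count_space I) = (\<integral>\<^sup>+j. c i * indicator {i} j \<partial>count_space I)"
    using assms(1) i by (intro nn_integral_cong) (auto split: split_indicator)
  also have "\<dots> = c i" using i by (subst nn_integral_cmult_indicator) auto
  finally show ?thesis using assms(2)[OF i] by simp
next
  case False
  then have "(\<integral>\<^sup>+j. c j * indicator (E j) y \<partial>count_space I) = (\<integral>\<^sup>+j. 0 \<partial>count_space I)"
    by (intro nn_integral_cong) auto
  then show ?thesis by simp
qed

lemma set_nn_integral_disjoint_le:
  assumes "countable I" "f \<in> borel_measurable M" "\<And>i. i \<in> I \<Longrightarrow> E i \<in> sets M"
    and "\<And>i j y. i \<in> I \<Longrightarrow> j \<in> I \<Longrightarrow> y \<in> E i \<Longrightarrow> y \<in> E j \<Longrightarrow> i = j"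
  shows "(\<integral>\<^sup>+i. (\<integral>\<^sup>+x\<in>E i. f x \<partial>M) \<partial>count_space I) \<le> (\<integral>\<^sup>+x. f x \<partial>M)"
proof -
  have "(\<integral>\<^sup>+i. (\<integral>\<^sup>+x\<in>E i. f x \<partial>M) \<partial>count_space I) = (\<integral>\<^sup>+x. \<integral>\<^sup>+i. f x * indicator (E i) x \<partial>count_space I \<partial>M)"
    using assms(1,2,3) by (intro nn_integral_count_space_nn_integral[symmetric]) auto
  also have "\<dots> \<le> (\<integral>\<^sup>+x. f x \<partial>M)"
    using assms(4) by (intro nn_integral_mono nn_integral_count_space_disjoint) auto
  finally show ?thesis .
qed

lemma mass_UN_le:
  assumes "countable I" and [measurable]: "w \<in> borel_measurable lebesgue" "\<And>i. i \<in> I \<Longrightarrow> E i \<in> sets lebesgue"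
  shows "mass w (\<Union>i\<in>I. E i) \<le> (\<integral>\<^sup>+i. mass w (E i) \<partial>count_space I)"
proof -
  have "mass w (\<Union>i\<in>I. E i) \<le> (\<integral>\<^sup>+x. \<integral>\<^sup>+i. w x * indicator (E i) x \<partial>count_space I \<partial>lebesgue)"
    unfolding mass_def
  proof (rule nn_integral_mono)
    fix x
    show "w x * indicator (\<Union>i\<in>I. E i) x \<le> (\<integral>\<^sup>+i. w x * indicator (E i) x \<partial>count_space I)"
    proof (cases "\<exists>i\<in>I. x \<in> E i")
      case True
      then obtain i where i: "i \<in> I" "x \<in> E i" by blast
      from nn_integral_ge_point[OF i(1), of "\<lambda>i. w x * indicator (E i) x"] i
      show ?thesis by (auto simp: indicator_def)
    qed auto
  qed
  also have "\<dots> = (\<integral>\<^sup>+i. mass w (E i) \<partial>count_space I)"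
    unfolding mass_def using assms(1) by (intro nn_integral_count_space_nn_integral) auto
  finally show ?thesis .
qed

lemma level_exists:
  fixes v :: ennreal
  assumes "0 < v" "v < \<infinity>" "0 < c" "1 < b"
  obtains k :: int where "ennreal (c * b powr k) < v" "v \<le> ennreal (b * c * b powr k)"
proof -
  obtain x where x: "v = ennreal x" "0 < x" using assms(1,2) by (cases v) auto
  define k where "k = \<lceil>log b (x / c)\<rceil> - 1"
  have "k < log b (x / c)" unfolding k_def by linarith
  then have "b powr k < x / c" using x assms(3,4) by (subst (asm) less_log_iff) auto
  moreover have "log b (x / c) \<le> k + 1" unfolding k_def by linarith
  then have "x / c \<le> b powr (k + 1)" using x assms(3,4) by (subst (asm) log_le_iff) auto
  ultimately show thesis
    using x assms(3,4) by (intro that[of k]) (auto simp: ennreal_less_iff powr_add field_simps intro!: ennreal_leI)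
qed

text \<open>This form of the \<open>A\<^sub>r\<close> condition avoids the dual weight, so that it makes sense also for \<open>r = 1\<close>.\<close>

definition Ar_bound :: "real \<Rightarrow> ennreal \<Rightarrow> ('a::euclidean_space \<Rightarrow> ennreal) \<Rightarrow> bool" where
  "Ar_bound r A w \<longleftrightarrow> (\<forall>z t E g. 0 < t \<longrightarrow> E \<in> sets lebesgue \<longrightarrow> E \<subseteq> ball z t \<longrightarrow> g \<in> borel_measurable lebesgue \<longrightarrow>
     ennpowr (\<integral>\<^sup>+x\<in>E. g x \<partial>lebesgue) r * mass w (ball z t)
       \<le> A * ennpowr (emeasure lebesgue (ball z t)) r * (\<integral>\<^sup>+x\<in>E. ennpowr (g x) r * w x \<partial>lebesgue))"

text \<open>\<open>Ar_bound\<close> is tested on the ball of Q with the cube as the subset E. The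
  volume of the ball is exchanged for that of the cube, which cancels against the lower bound for
  the mean.\<close>

lemma Ar_bound_cube:
  fixes w :: "'a::euclidean_space \<Rightarrow> ennreal"
  assumes "Ar_bound r A w" "1 \<le> r" "g \<in> borel_measurable lebesgue" "Q \<in> cubes"
    "\<mu> * emeasure lebesgue (cube Q) \<le> cube_integral g Q"
  shows "ennpowr \<mu> r * mass w (cube_ball Q)
    \<le> ennreal (ball_const TYPE('a) powr r) * A * (\<integral>\<^sup>+x\<in>cube Q. ennpowr (g x) r * w x \<partial>lebesgue)"
proof -
  let ?I = "\<integral>\<^sup>+x\<in>cube Q. ennpowr (g x) r * w x \<partial>lebesgue"
  let ?C = "ennreal (ball_const TYPE('a))"
  define v where "v = (2 powr real_of_int (fst Q)) ^ DIM('a)"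
  have v: "emeasure lebesgue (cube Q) = ennreal v" "0 < v"
    using emeasure_cube[OF assms(4)] by (auto simp: v_def)
  have C: "0 < ball_const TYPE('a)" using ball_const_ge_1[where 'a = 'a] by simp
  have "ennpowr \<mu> r * ennreal (v powr r) * mass w (cube_ball Q)
      = ennpowr (\<mu> * emeasure lebesgue (cube Q)) r * mass w (cube_ball Q)"
    using ennpowr_ennreal[OF v(2)] assms(2) by (simp only: v) (simp add: ennpowr_mult)
  also have "\<dots> \<le> ennpowr (cube_integral g Q) r * mass w (cube_ball Q)"
    using assms by (intro mult_right_mono ennpowr_mono) auto
  also have "\<dots> \<le> A * ennpowr (emeasure lebesgue (cube_ball Q)) r * ?I"
    using assms(1,3) cube_subset_ball[of Q]
    unfolding Ar_bound_def cube_integral_def cube_ball_def by auto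
  also have "\<dots> \<le> A * ennpowr (?C * ennreal v) r * ?I"
    using emeasure_cube_ball_le[OF assms(4)] assms(2) unfolding v
    by (intro mult_right_mono mult_left_mono ennpowr_mono) auto
  also have "\<dots> = ennreal (v powr r) * (ennreal (ball_const TYPE('a) powr r) * A * ?I)"
    using v(2) C assms(2) by (simp add: ennpowr_mult ennpowr_ennreal mult_ac)
  finally have "ennreal (v powr r) * (ennpowr \<mu> r * mass w (cube_ball Q))
      \<le> ennreal (v powr r) * (ennreal (ball_const TYPE('a) powr r) * A * ?I)"
    by (simp add: mult_ac)
  then show ?thesis
    using v(2) by (subst (asm) ennreal_mult_le_mult_iff) auto
qed

text \<open>For integrable g and \<open>\<mu>\<close> > 0, by \<open>level_cubes_cover\<close>, it
  contains every x for which some average over a ball about x exceeds \<open>cover_const\<close>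
  times \<open>\<mu>\<close>. It stands in for a superlevel set of the maximal function.\<close>

definition level_set :: "('a::euclidean_space \<Rightarrow> ennreal) \<Rightarrow> ennreal \<Rightarrow> 'a set" where
  "level_set g \<mu> = (\<Union>Q\<in>level_cubes g \<mu>. cube_ball Q)"

lemma countable_level_cubes: "countable (level_cubes g \<mu>)"
  unfolding level_cubes_def by (rule countable_tops)

lemma level_cubes_cubes: "Q \<in> level_cubes g \<mu> \<Longrightarrow> Q \<in> cubes"
  unfolding level_cubes_def tops_def by auto

lemma level_cubes_disjoint:
  "Q \<in> level_cubes g \<mu> \<Longrightarrow> Q' \<in> level_cubes g \<mu> \<Longrightarrow> y \<in> cube Q \<Longrightarrow> y \<in> cube Q' \<Longrightarrow> Q = Q'"
  unfolding level_cubes_def by (rule tops_disjoint)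

lemma level_cubes_gt: "Q \<in> level_cubes g \<mu> \<Longrightarrow> \<mu> * emeasure lebesgue (cube Q) < cube_integral g Q"
  unfolding level_cubes_def tops_def by auto

lemma level_set_measurable [measurable]: "level_set g \<mu> \<in> sets lebesgue"
  unfolding level_set_def using countable_level_cubes by (intro sets.countable_UN'') auto

text \<open>The balls of the level cubes cover the set, while the cubes themselves are disjoint, so
  the right-hand sides of \<open>Ar_bound_cube\<close> add up to at most the full integral.\<close>

lemma weak_type:
  fixes w :: "'a::euclidean_space \<Rightarrow> ennreal"
  assumes "Ar_bound r A w" "1 \<le> r" and [measurable]: "g \<in> borel_measurable lebesgue" "w \<in> borel_measurable lebesgue"
  shows "ennpowr \<mu> r * mass w (level_set g \<mu>)
    \<le> ennreal (ball_const TYPE('a) powr r) * A * (\<integral>\<^sup>+x. ennpowr (g x) r * w x \<partial>lebesgue)"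
proof -
  let ?I = "level_cubes g \<mu>"
  let ?f = "\<lambda>x. ennpowr (g x) r * w x"
  let ?C = "ennreal (ball_const TYPE('a) powr r) * A"
  have "ennpowr \<mu> r * mass w (level_set g \<mu>) \<le> ennpowr \<mu> r * (\<integral>\<^sup>+Q. mass w (cube_ball Q) \<partial>count_space ?I)"
    unfolding level_set_def by (intro mult_left_mono mass_UN_le countable_level_cubes) auto
  also have "\<dots> = (\<integral>\<^sup>+Q. ennpowr \<mu> r * mass w (cube_ball Q) \<partial>count_space ?I)"
    by (rule nn_integral_cmult[symmetric]) simp
  also have "\<dots> \<le> (\<integral>\<^sup>+Q. ?C * (\<integral>\<^sup>+x\<in>cube Q. ?f x \<partial>lebesgue) \<partial>count_space ?I)"
    using assms(1,2) by (intro nn_integral_mono Ar_bound_cube)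
      (auto dest: level_cubes_cubes level_cubes_gt)
  also have "\<dots> = ?C * (\<integral>\<^sup>+Q. (\<integral>\<^sup>+x\<in>cube Q. ?f x \<partial>lebesgue) \<partial>count_space ?I)"
    by (rule nn_integral_cmult) simp
  also have "\<dots> \<le> ?C * (\<integral>\<^sup>+x. ?f x \<partial>lebesgue)"
    by (intro mult_left_mono set_nn_integral_disjoint_le countable_level_cubes)
      (measurable, rule level_cubes_disjoint, auto)
  finally show ?thesis .
qed

section \<open>Interpolation of the weak estimate\<close>

lemma ball_lebesgue [measurable]: "ball x t \<in> sets lebesgue"
  by simp

lemma average_finite:
  assumes "(\<integral>\<^sup>+x. g x \<partial>lebesgue) < \<infinity>" "0 < t"
  shows "average (ball x t) g < \<infinity>"
proof -
  have "(\<integral>\<^sup>+y\<in>ball x t. g y \<partial>lebesgue) \<le> (\<integral>\<^sup>+x. g x \<partial>lebesgue)"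
    by (intro nn_integral_mono) (auto split: split_indicator)
  then show ?thesis
    using assms emeasure_ball_pos[of t x] unfolding average_def
    by (auto simp: ennreal_divide_eq_top_iff less_top[symmetric] top_unique)
qed

text \<open>The part of g below c contributes at most c: this is the L^\<infinity> endpoint of the
  interpolation.\<close>

lemma average_le_truncated:
  assumes [measurable]: "g \<in> borel_measurable lebesgue" and t: "0 < t"
  shows "average (ball x t) g \<le> average (ball x t) (\<lambda>y. g y * indicator {y. c < g y} y) + c"
proof -
  let ?V = "emeasure lebesgue (ball x t)"
  have "(\<integral>\<^sup>+y\<in>ball x t. g y \<partial>lebesgue)
      \<le> (\<integral>\<^sup>+y. g y * indicator {y. c < g y} y * indicator (ball x t) y + c * indicator (ball x t) y \<partial>lebesgue)"
    by (intro nn_integral_mono) (auto split: split_indicator)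
  also have "\<dots> = (\<integral>\<^sup>+y\<in>ball x t. (g y * indicator {y. c < g y} y) \<partial>lebesgue) + c * ?V"
    by (subst nn_integral_add) (measurable, simp add: nn_integral_cmult_indicator)
  finally have "average (ball x t) g
      \<le> ((\<integral>\<^sup>+y\<in>ball x t. (g y * indicator {y. c < g y} y) \<partial>lebesgue) + c * ?V) / ?V"
    unfolding average_def by (rule divide_right_mono_ennreal)
  also have "\<dots> = average (ball x t) (\<lambda>y. g y * indicator {y. c < g y} y) + c"
    using emeasure_ball_pos[OF t, of x] emeasure_ball_finite[of x t] unfolding average_def
    by (simp add: add_divide_distrib_ennreal ennreal_mult_divide_eq less_top[symmetric])
  finally show ?thesis .
qed

text \<open>At level 2^k only the part \<open>h k\<close> of g above C 2^k is used, and the weak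
  estimate of exponent r is applied to it. Discrete levels make \<open>\<Phi>\<close> a countable
  sum, hence measurable. The factor 2 + 2 / (p - r) is the geometric sum over the levels below g x
  and blows up as r approaches p.\<close>

lemma marcinkiewicz:
  fixes w :: "'a::euclidean_space \<Rightarrow> ennreal"
  assumes Ar: "Ar_bound r A w" and r: "1 \<le> r" and p: "r < p"
    and [measurable]: "g \<in> borel_measurable lebesgue" "w \<in> borel_measurable lebesgue"
    and fin: "(\<integral>\<^sup>+x. g x \<partial>lebesgue) < \<infinity>"
  shows "\<exists>\<Phi>\<in>borel_measurable lebesgue. (\<forall>x t. 0 < t \<longrightarrow> ennpowr (average (ball x t) g) p \<le> \<Phi> x) \<and>
    (\<integral>\<^sup>+x. \<Phi> x * w x \<partial>lebesgue)
      \<le> ennreal ((4 * cover_const TYPE('a)) powr p * ball_const TYPE('a) powr r * (2 + 2 / (p - r)))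
          * A * (\<integral>\<^sup>+x. ennpowr (g x) p * w x \<partial>lebesgue)"
proof -
  define C where "C = cover_const TYPE('a)"
  have C: "1 \<le> C" unfolding C_def by (rule cover_const_ge_1)
  define D where "D = ball_const TYPE('a) powr r"
  define h where "h k y = g y * indicator {y. ennreal (C * 2 powr real_of_int k) < g y} y" for k y
  have h [measurable]: "h k \<in> borel_measurable lebesgue" for k unfolding h_def by measurable
  define \<Lambda> where "\<Lambda> k = level_set (h k) (ennreal (2 powr real_of_int k))" for k
  have [measurable]: "\<Lambda> k \<in> sets lebesgue" for k unfolding \<Lambda>_def by measurable
  define c where "c k = ennreal ((4 * C * 2 powr real_of_int k) powr p)" for k
  define \<Phi> where "\<Phi> x = (\<integral>\<^sup>+k. c k * indicator (\<Lambda> k) x \<partial>count_space UNIV)" for x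
  have \<Phi>: "\<Phi> \<in> borel_measurable lebesgue"
    unfolding \<Phi>_def by (intro nn_integral_count_space_measurable) auto
  have maj: "ennpowr (average (ball x t) g) p \<le> \<Phi> x" if t: "0 < t" for x t
  proof (cases "average (ball x t) g = 0")
    case True
    then show ?thesis using r p by simp
  next
    case False
    \<comment> \<open>The average lies in (2 C 2^k, 4 C 2^k]. After discarding the part of g below C
      2^k it still exceeds C 2^k, as \<open>level_cubes_cover\<close> requires; the upper end is the
      base of the power in \<open>c k\<close>.\<close>
    then obtain k where k: "ennreal (2 * C * 2 powr real_of_int k) < average (ball x t) g"
        "average (ball x t) g \<le> ennreal (2 * (2 * C) * 2 powr real_of_int k)"
      using level_exists[of "average (ball x t) g" "2 * C" 2] average_finite[OF fin t] C
      by (auto simp: zero_less_iff_neq_zero)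
    have "\<not> average (ball x t) (h k) \<le> ennreal C * ennreal (2 powr real_of_int k)"
    proof
      assume "average (ball x t) (h k) \<le> ennreal C * ennreal (2 powr real_of_int k)"
      then have "average (ball x t) (h k) + ennreal (C * 2 powr real_of_int k)
          \<le> ennreal (C * 2 powr real_of_int k) + ennreal (C * 2 powr real_of_int k)"
        using C by (intro add_mono) (auto simp: ennreal_mult)
      then have "average (ball x t) g \<le> ennreal (2 * C * 2 powr real_of_int k)"
        using average_le_truncated[OF \<open>g \<in> borel_measurable lebesgue\<close> t, of x "ennreal (C * 2 powr real_of_int k)"] C
        by (auto simp: h_def[abs_def] mult.assoc simp flip: ennreal_plus)
      then show False using k by simp
    qed
    moreover have "(\<integral>\<^sup>+x. h k x \<partial>lebesgue) < \<infinity>"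
      by (rule le_less_trans[OF nn_integral_mono fin]) (auto simp: h_def split: split_indicator)
    ultimately obtain Q where "Q \<in> level_cubes (h k) (ennreal (2 powr real_of_int k))" "x \<in> cube_ball Q"
      using level_cubes_cover[OF h _ _ t] unfolding C_def by (metis not_le ennreal_less_zero_iff powr_gt_zero zero_neq_numeral)
    then have x: "x \<in> \<Lambda> k" by (auto simp: \<Lambda>_def level_set_def)
    have "ennpowr (average (ball x t) g) p \<le> ennpowr (ennreal (2 * (2 * C) * 2 powr real_of_int k)) p"
      using k r p by (intro ennpowr_mono) auto
    also have "\<dots> = c k * indicator (\<Lambda> k) x" using C x by (simp add: c_def ennpowr_ennreal)
    also have "\<dots> \<le> \<Phi> x" unfolding \<Phi>_def by (rule nn_integral_ge_point) simp
    finally show ?thesis .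
  qed
  let ?L = "\<lambda>k. {y. ennreal (2 powr real_of_int k) < g y}"
  have "(\<integral>\<^sup>+x. \<Phi> x * w x \<partial>lebesgue) = (\<integral>\<^sup>+x. \<integral>\<^sup>+k. c k * (w x * indicator (\<Lambda> k) x) \<partial>count_space UNIV \<partial>lebesgue)"
    unfolding \<Phi>_def by (intro nn_integral_cong) (simp add: nn_integral_multc[symmetric] mult.assoc mult.commute[of "w _"])
  also have "\<dots> = (\<integral>\<^sup>+k. c k * mass w (\<Lambda> k) \<partial>count_space UNIV)"
    by (subst nn_integral_count_space_nn_integral) (auto simp: nn_integral_cmult mass_def)
  also have "\<dots> \<le> (\<integral>\<^sup>+k. \<integral>\<^sup>+x. (ennreal ((4 * C) powr p * D) * A) *
        (ennpowr (g x) r * w x * (ennreal (2 powr (real_of_int k * (p - r))) * indicator (?L k) x)) \<partial>lebesgue \<partial>count_space UNIV)"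
  proof (rule nn_integral_mono)
    fix k :: int
    have c: "c k = ennreal ((4 * C) powr p * 2 powr (real_of_int k * (p - r))) * ennpowr (ennreal (2 powr real_of_int k)) r"
      using C by (simp add: c_def ennpowr_ennreal powr_mult powr_powr flip: ennreal_mult powr_add)
        (simp add: algebra_simps)
    have "c k * mass w (\<Lambda> k) \<le> ennreal ((4 * C) powr p * 2 powr (real_of_int k * (p - r))) *
        (ennreal D * A * (\<integral>\<^sup>+x. ennpowr (h k x) r * w x \<partial>lebesgue))"
      unfolding c D_def \<Lambda>_def mult.assoc[of _ _ "mass w _"] using r Ar
      by (intro mult_left_mono weak_type) auto
    also have "\<dots> \<le> ennreal ((4 * C) powr p * 2 powr (real_of_int k * (p - r))) *
        (ennreal D * A * (\<integral>\<^sup>+x. ennpowr (g x) r * w x * indicator (?L k) x \<partial>lebesgue))"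
    proof (intro mult_left_mono nn_integral_mono)
      fix x
      \<comment> \<open>Lowering the threshold from C 2^k to 2^k enlarges the set and brings the sum
        over k into the form of \<open>dyadic_level_sum_le\<close>.\<close>
      have "ennreal (2 powr real_of_int k) \<le> ennreal (C * 2 powr real_of_int k)"
        using C by (intro ennreal_leI) simp
      then show "ennpowr (h k x) r * w x \<le> ennpowr (g x) r * w x * indicator (?L k) x"
        using r unfolding h_def by (auto split: split_indicator simp: not_less)
    qed auto
    also have "\<dots> = (ennreal ((4 * C) powr p * D) * A) * (ennreal (2 powr (real_of_int k * (p - r))) *
         (\<integral>\<^sup>+x. ennpowr (g x) r * w x * indicator (?L k) x \<partial>lebesgue))"
      by (simp add: D_def ennreal_mult mult_ac)
    also have "\<dots> = (\<integral>\<^sup>+x. (ennreal ((4 * C) powr p * D) * A) *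
        (ennpowr (g x) r * w x * (ennreal (2 powr (real_of_int k * (p - r))) * indicator (?L k) x)) \<partial>lebesgue)"
      by (simp add: nn_integral_cmult[symmetric] mult_ac)
    finally show "c k * mass w (\<Lambda> k) \<le> (\<integral>\<^sup>+x. (ennreal ((4 * C) powr p * D) * A) *
        (ennpowr (g x) r * w x * (ennreal (2 powr (real_of_int k * (p - r))) * indicator (?L k) x)) \<partial>lebesgue)" .
  qed
  also have "\<dots> = (\<integral>\<^sup>+x. \<integral>\<^sup>+k. (ennreal ((4 * C) powr p * D) * A) *
        (ennpowr (g x) r * w x * (ennreal (2 powr (real_of_int k * (p - r))) * indicator (?L k) x)) \<partial>count_space UNIV \<partial>lebesgue)"
    by (intro nn_integral_count_space_nn_integral[symmetric]) auto
  also have "\<dots> = (\<integral>\<^sup>+x. (ennreal ((4 * C) powr p * D) * A) * (ennpowr (g x) r * w x *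
        (\<integral>\<^sup>+k. ennreal (2 powr (real_of_int k * (p - r))) * indicator {k. ennreal (2 powr real_of_int k) < g x} k \<partial>count_space UNIV)) \<partial>lebesgue)"
    by (simp add: nn_integral_cmult indicator_def)
  also have "\<dots> \<le> (\<integral>\<^sup>+x. (ennreal ((4 * C) powr p * D) * A) * (ennpowr (g x) r * w x *
        (ennreal (2 + 2 / (p - r)) * ennpowr (g x) (p - r))) \<partial>lebesgue)"
    using p by (intro nn_integral_mono mult_left_mono dyadic_level_sum_le) auto
  also have "\<dots> = (\<integral>\<^sup>+x. (ennreal ((4 * C) powr p * D * (2 + 2 / (p - r))) * A) * (ennpowr (g x) p * w x) \<partial>lebesgue)"
  proof (intro nn_integral_cong)
    fix x
    have "ennpowr (g x) p = ennpowr (g x) r * ennpowr (g x) (p - r)"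
      using ennpowr_add[of r "p - r" "g x"] r p by simp
    moreover have "ennreal ((4 * C) powr p * D * (2 + 2 / (p - r))) = ennreal ((4 * C) powr p * D) * ennreal (2 + 2 / (p - r))"
      using p by (intro ennreal_mult) (auto simp: D_def)
    ultimately show "(ennreal ((4 * C) powr p * D) * A) * (ennpowr (g x) r * w x * (ennreal (2 + 2 / (p - r)) * ennpowr (g x) (p - r)))
        = (ennreal ((4 * C) powr p * D * (2 + 2 / (p - r))) * A) * (ennpowr (g x) p * w x)"
      by (simp only: mult_ac)
  qed
  also have "\<dots> = ennreal ((4 * C) powr p * D * (2 + 2 / (p - r))) * A * (\<integral>\<^sup>+x. ennpowr (g x) p * w x \<partial>lebesgue)"
    by (rule nn_integral_cmult) simp
  finally show ?thesis using \<Phi> maj unfolding C_def D_def by blast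
qed

section \<open>Decay of the dual weight\<close>

text \<open>For the tails G one has G m \<le> y v m and G m = v m + G (m + 1), so G (m + 1) \<le> (1
  - 1/y) G m \<le> exp (-1/y) G m. The remaining point is to return from G to v without losing a
  factor y.\<close>

lemma geometric_decay:
  fixes v :: "nat \<Rightarrow> real"
  assumes dec: "\<And>i j. i \<le> j \<Longrightarrow> v j \<le> v i" and nn: "\<And>j. 0 \<le> v j" and y: "0 < y"
    and sum: "\<And>m M. (\<Sum>j\<in>{m..<M}. v j) \<le> y * v m"
  shows "v m \<le> exp (1 - m / y) * v 0"
proof -
  have "summable v"
    using nn sum[of 0] by (intro summableI_nonneg_bounded[of v "y * v 0"]) (auto simp: atLeast0LessThan)
  define G where "G m = (\<Sum>j. v (j + m))" for m
  have sm: "summable (\<lambda>j. v (j + m))" for m using \<open>summable v\<close> by (rule summable_ignore_initial_segment)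
  have G_le: "G m \<le> y * v m" for m
    unfolding G_def
  proof (rule suminf_le_const[OF sm])
    fix M
    have "(\<Sum>j<M. v (j + m)) = (\<Sum>j\<in>{m..<m + M}. v j)"
      by (rule sum.reindex_bij_witness[of _ "\<lambda>j. j - m" "\<lambda>j. j + m"]) auto
    then show "(\<Sum>j<M. v (j + m)) \<le> y * v m" using sum[of m "m + M"] by simp
  qed
  have G_nn: "0 \<le> G m" for m unfolding G_def using nn by (intro suminf_nonneg sm) auto
  have G_Suc: "G m = v m + G (Suc m)" for m
    unfolding G_def using suminf_split_head[OF sm[of m]] by simp
  have step: "G (Suc m) \<le> exp (- 1 / y) * G m" for m
  proof -
    have "G m / y \<le> v m" using G_le[of m] y by (simp add: field_simps)
    then have "G (Suc m) \<le> G m - G m / y" using G_Suc[of m] by linarith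
    then have "G (Suc m) \<le> (1 + (- 1 / y)) * G m" by (simp add: left_diff_distrib)
    also have "\<dots> \<le> exp (- 1 / y) * G m" using G_nn by (intro mult_right_mono exp_ge_add_one_self)
    finally show ?thesis .
  qed
  have G_exp: "G m \<le> exp (- (m / y)) * G 0" for m
  proof (induction m)
    case (Suc m)
    have "G (Suc m) \<le> exp (- 1 / y) * G m" by (rule step)
    also have "\<dots> \<le> exp (- 1 / y) * (exp (- (m / y)) * G 0)" by (intro mult_left_mono Suc) auto
    also have "\<dots> = exp (- (Suc m / y)) * G 0"
      by (simp add: exp_add[symmetric] mult.assoc[symmetric] add_divide_distrib)
    finally show ?case .
  qed simp
  \<comment> \<open>The k terms ending at v m are each at least v m, so y v m \<le> G (m + 1 - k).
    The shift by k - 1 < y costs at most a factor e; comparing v m directly with G m would cost the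
    factor y, in the application a multiple of \<open>s\<close>.\<close>
  define k where "k = nat \<lceil>y\<rceil>"
  have k: "y \<le> k" "k < y + 1" "0 < k" using y unfolding k_def by linarith+
  show ?thesis
  proof (cases "m + 1 < k")
    case True
    then have "real m < y" using k by linarith
    then have "1 \<le> exp (1 - m / y)" using y by (simp add: field_simps)
    then show ?thesis using dec[of 0 m] nn[of 0] mult_right_mono[of 1 "exp (1 - m / y)" "v 0"] by simp
  next
    case False
    then have mk: "k \<le> m + 1" by simp
    have "y * v m \<le> k * v m" using k nn by (intro mult_right_mono) auto
    also have "\<dots> = (\<Sum>j<k. v m)" by simp
    also have "\<dots> \<le> (\<Sum>j<k. v (j + (m + 1 - k)))" using mk by (intro sum_mono dec) auto
    also have "\<dots> \<le> G (m + 1 - k)" unfolding G_def using nn by (intro sum_le_suminf sm) auto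
    also have "\<dots> \<le> exp (- (real (m + 1 - k) / y)) * (y * v 0)"
      using G_exp[of "m + 1 - k"] G_le[of 0] by (meson exp_ge_zero mult_left_mono order_trans)
    also have "\<dots> \<le> exp (1 - m / y) * (y * v 0)"
    proof (intro mult_right_mono)
      have "(real m - real (m + 1 - k)) / y \<le> 1" using mk k y by (simp add: of_nat_diff)
      then show "exp (- (real (m + 1 - k) / y)) \<le> exp (1 - m / y)" by (simp add: diff_divide_distrib)
    qed (use y nn in auto)
    finally have "y * v m \<le> y * (exp (1 - m / y) * v 0)" by (simp add: mult_ac)
    then show ?thesis using y by simp
  qed
qed

lemma ball_in_balls: "0 < t \<Longrightarrow> ball x t \<in> balls"
  by (auto simp: balls_def)

lemma maximal_ge: "0 < t \<Longrightarrow> x \<in> ball z t \<Longrightarrow> average (ball z t) f \<le> maximal f x" for f :: "'a::euclidean_space \<Rightarrow> ennreal"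
  unfolding maximal_def by (rule SUP_upper2[of "ball z t"]) (auto simp: balls_def)

lemma mass_mono: "E \<subseteq> F \<Longrightarrow> mass f E \<le> mass f F" for f :: "'a::euclidean_space \<Rightarrow> ennreal"
  unfolding mass_def by (intro nn_integral_mono) (auto split: split_indicator)

lemma average_restricted:
  fixes f :: "'a::euclidean_space \<Rightarrow> ennreal"
  assumes "E \<subseteq> F"
  shows "average E (\<lambda>y. f y * indicator F y) = mass f E / emeasure lebesgue E"
proof -
  have "(\<integral>\<^sup>+x\<in>E. (f x * indicator F x) \<partial>lebesgue) = mass f E"
    unfolding mass_def using assms by (intro nn_integral_cong) (auto split: split_indicator)
  then show ?thesis by (simp add: average_def)
qed

text \<open>\<open>dual\<close> says \<sigma>^(r - 1) = 1 / w, almost everywhere because \<sigma> is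
  \<infinity> where w vanishes; \<open>Ar\<close> is the A_r condition freed from quotients, with
  bound A.\<close>

locale dual_pair =
  fixes r :: real and A :: ennreal and w \<sigma> :: "'a::euclidean_space \<Rightarrow> ennreal"
  assumes r: "1 < r"
    and w_measurable [measurable]: "w \<in> borel_measurable lebesgue"
    and \<sigma>_measurable [measurable]: "\<sigma> \<in> borel_measurable lebesgue"
    and dual: "AE x in lebesgue. 0 < \<sigma> x \<and> \<sigma> x < \<infinity> \<and> w x * ennpowr (\<sigma> x) (r - 1) = 1"
    and mass_pos: "\<And>z t. 0 < t \<Longrightarrow> 0 < mass \<sigma> (ball z t)"
    and mass_finite: "\<And>z t. 0 < t \<Longrightarrow> mass \<sigma> (ball z t) < \<infinity>"
    and Ar: "\<And>z t. 0 < t \<Longrightarrow> mass w (ball z t) * ennpowr (mass \<sigma> (ball z t)) (r - 1)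
      \<le> A * ennpowr (emeasure lebesgue (ball z t)) r"

locale dual_weights = dual_pair r A w \<sigma>
  for r :: real and A :: ennreal and w \<sigma> :: "'a::euclidean_space \<Rightarrow> ennreal" +
  fixes s :: real
  assumes s: "1 \<le> s"
    and Ainf: "\<And>z t. 0 < t \<Longrightarrow>
      (\<integral>\<^sup>+x\<in>ball z t. maximal (\<lambda>y. \<sigma> y * indicator (ball z t) y) x \<partial>lebesgue) \<le> ennreal s * mass \<sigma> (ball z t)"
begin

text \<open>On E i the maximal function of the restricted \<open>\<sigma>\<close> is at least the
  mean of \<open>\<sigma>\<close> over B i. As the E i are disjoint and fill a fixed proportion of
  the B i, the masses of the B i add up to at most C times the integral of that maximal function.
  Both the decay of \<open>\<sigma>\<close> and its Carleson condition are instances.\<close>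

lemma Ainf_disjoint:
  fixes B :: "'i \<Rightarrow> 'a set"
  assumes "countable I" "0 < t" "\<And>i. i \<in> I \<Longrightarrow> E i \<in> sets lebesgue" "\<And>i. i \<in> I \<Longrightarrow> E i \<subseteq> B i"
    and B: "\<And>i. i \<in> I \<Longrightarrow> B i \<in> balls" "\<And>i. i \<in> I \<Longrightarrow> B i \<subseteq> ball z t"
    and "\<And>i j y. i \<in> I \<Longrightarrow> j \<in> I \<Longrightarrow> y \<in> E i \<Longrightarrow> y \<in> E j \<Longrightarrow> i = j"
    and C: "\<And>i. i \<in> I \<Longrightarrow> emeasure lebesgue (B i) \<le> C * emeasure lebesgue (E i)"
  shows "(\<integral>\<^sup>+i. mass \<sigma> (B i) \<partial>count_space I) \<le> C * (ennreal s * mass \<sigma> (ball z t))"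
proof -
  let ?M = "maximal (\<lambda>y. \<sigma> y * indicator (ball z t) y)"
  let ?a = "\<lambda>i. mass \<sigma> (B i) / emeasure lebesgue (B i)"
  have "(\<integral>\<^sup>+i. mass \<sigma> (B i) \<partial>count_space I) \<le> (\<integral>\<^sup>+i. C * (?a i * emeasure lebesgue (E i)) \<partial>count_space I)"
  proof (rule nn_integral_mono)
    fix i assume "i \<in> space (count_space I)"
    then have i: "i \<in> I" by simp
    obtain x u where xu: "B i = ball x u" "0 < u" using B(1)[OF i] by (auto simp: balls_def)
    have "mass \<sigma> (B i) = ?a i * emeasure lebesgue (B i)"
      using emeasure_ball_pos[OF xu(2), of x] emeasure_ball_finite[of x u] xu
      by (simp add: ennreal_divide_times less_top[symmetric] ennreal_mult_divide_eq)
    also have "\<dots> \<le> ?a i * (C * emeasure lebesgue (E i))" by (intro mult_left_mono C i) auto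
    finally show "mass \<sigma> (B i) \<le> C * (?a i * emeasure lebesgue (E i))" by (simp add: mult_ac)
  qed
  also have "\<dots> = C * (\<integral>\<^sup>+i. \<integral>\<^sup>+x. ?a i * indicator (E i) x \<partial>lebesgue \<partial>count_space I)"
    using assms(3) by (subst nn_integral_cmult) (auto simp: nn_integral_cmult_indicator intro!: arg_cong2[where f = "(*)"] nn_integral_cong)
  also have "\<dots> = C * (\<integral>\<^sup>+x. \<integral>\<^sup>+i. ?a i * indicator (E i) x \<partial>count_space I \<partial>lebesgue)"
    using assms(1,3) by (subst nn_integral_count_space_nn_integral) auto
  also have "\<dots> \<le> C * (\<integral>\<^sup>+x\<in>ball z t. ?M x \<partial>lebesgue)"
  proof (intro mult_left_mono nn_integral_mono)
    fix x
    show "(\<integral>\<^sup>+i. ?a i * indicator (E i) x \<partial>count_space I) \<le> ?M x * indicator (ball z t) x"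
    proof (rule nn_integral_count_space_disjoint)
      fix i assume i: "i \<in> I" "x \<in> E i"
      obtain c u where cu: "B i = ball c u" "0 < u" using B(1)[OF i(1)] by (auto simp: balls_def)
      have "x \<in> ball c u" using assms(4)[OF i(1)] i cu by auto
      from maximal_ge[OF cu(2) this, of "\<lambda>y. \<sigma> y * indicator (ball z t) y"] B(2)[OF i(1)] i
      show "?a i \<le> ?M x * indicator (ball z t) x"
        using assms(4)[OF i(1)] by (simp add: cu average_restricted subset_iff)
    qed (rule assms(7))
  qed auto
  also have "\<dots> \<le> C * (ennreal s * mass \<sigma> (ball z t))"
    by (intro mult_left_mono Ainf assms) auto
  finally show ?thesis .
qed

text \<open>\<open>Ainf_disjoint\<close> with dyadic annuli has C = 2, so
  \<open>geometric_decay\<close> applies with y = 2 s.\<close>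

lemma mass_decay:
  assumes R: "0 < R"
  shows "mass \<sigma> (ball x (R / 2 ^ m)) \<le> ennreal (exp (1 - m / (2 * s))) * mass \<sigma> (ball x R)"
proof -
  define v where "v j = enn2real (mass \<sigma> (ball x (R / 2 ^ j)))" for j :: nat
  have v: "mass \<sigma> (ball x (R / 2 ^ j)) = ennreal (v j)" for j
    unfolding v_def using mass_finite[of "R / 2 ^ j" x] R by (simp add: less_top[symmetric])
  have v_nn: "0 \<le> v j" for j by (simp add: v_def)
  have "v m \<le> exp (1 - m / (2 * s)) * v 0"
  proof (rule geometric_decay)
    show "v j \<le> v i" if "i \<le> j" for i j
      unfolding v_def
    proof (intro enn2real_mono mass_mono subset_ball)
      show "R / 2 ^ j \<le> R / 2 ^ i" using that R by (intro divide_left_mono power_increasing) auto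
      show "mass \<sigma> (ball x (R / 2 ^ i)) < top" using mass_finite[of "R / 2 ^ i" x] R by simp
    qed
    show "(\<Sum>j\<in>{m..<M}. v j) \<le> 2 * s * v m" for m M
    proof -
      let ?B = "\<lambda>j::nat. ball x (R / 2 ^ j)"
      have sub: "?B j \<subseteq> ?B i" if "i \<le> j" for i j
        using that R by (intro subset_ball divide_left_mono power_increasing) auto
      have "(\<integral>\<^sup>+j. mass \<sigma> (?B j) \<partial>count_space {m..<M}) \<le> ennreal 2 * (ennreal s * mass \<sigma> (?B m))"
      proof (rule Ainf_disjoint[where E = "\<lambda>j. ?B j - ?B (Suc j)"])
        fix i j y assume ij: "y \<in> ?B i - ?B (Suc i)" "y \<in> ?B j - ?B (Suc j)"
        show "i = j"
        proof (rule ccontr)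
          assume "i \<noteq> j"
          then have "Suc i \<le> j \<or> Suc j \<le> i" by linarith
          then show False using ij sub[of "Suc i" j] sub[of "Suc j" i] by blast
        qed
      next
        fix j assume "j \<in> {m..<M}"
        show "emeasure lebesgue (?B j) \<le> ennreal 2 * emeasure lebesgue (?B j - ?B (Suc j))"
        proof -
          define q where "q = unit_ball_vol DIM('a) * (R / 2 ^ j) ^ DIM('a)"
          have q: "0 \<le> q" using R by (simp add: q_def)
          have eq: "R / 2 ^ Suc j = (1 / 2) * (R / 2 ^ j)" by simp
          have e1: "emeasure lebesgue (?B j) = ennreal q"
            unfolding q_def using R by (intro emeasure_lebesgue_ball) simp
          have e2: "emeasure lebesgue (?B (Suc j)) = ennreal ((1 / 2) ^ DIM('a) * q)"
            unfolding q_def eq using R by (subst emeasure_lebesgue_ball) (auto simp only: power_mult_distrib mult_ac, simp)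
          have "emeasure lebesgue (?B j - ?B (Suc j)) = ennreal q - ennreal ((1 / 2) ^ DIM('a) * q)"
            unfolding e1[symmetric] e2[symmetric] using sub[of j "Suc j"] e2 by (intro emeasure_Diff) auto
          also have "\<dots> = ennreal (q - (1 / 2) ^ DIM('a) * q)" using q by (simp add: ennreal_minus)
          finally have e3: "emeasure lebesgue (?B j - ?B (Suc j)) = ennreal (q - (1 / 2) ^ DIM('a) * q)" .
          \<comment> \<open>The inner ball has at most half the volume, in every dimension, so the
            annulus keeps at least half.\<close>
          have "(1 / 2 :: real) ^ DIM('a) \<le> (1 / 2) ^ 1"
            using DIM_ge_Suc0[where 'a = 'a] by (intro power_decreasing) auto
          then have h: "(1 / 2) ^ DIM('a) * q \<le> (1 / 2) * q" using q by (intro mult_right_mono) auto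
          show ?thesis unfolding e1 e3
            by (subst ennreal_mult[symmetric]) (use h q in \<open>auto intro!: ennreal_leI\<close>)
        qed
      qed (use R sub in \<open>auto intro: ball_in_balls\<close>)
      also have "(\<integral>\<^sup>+j. mass \<sigma> (?B j) \<partial>count_space {m..<M}) = ennreal (\<Sum>j\<in>{m..<M}. v j)"
        by (subst nn_integral_count_space_finite) (auto simp: v v_nn sum_nonneg)
      finally have "ennreal (\<Sum>j\<in>{m..<M}. v j) \<le> ennreal (2 * s * v m)"
        using s v_nn by (simp add: v ennreal_mult mult.assoc)
      then show ?thesis using s v_nn by (subst (asm) ennreal_le_iff) auto
    qed
  qed (use s v_nn in auto)
  then have "ennreal (v m) \<le> ennreal (exp (1 - m / (2 * s)) * v 0)" by (rule ennreal_leI)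
  then show ?thesis using v[of m] v[of 0] v_nn by (simp add: ennreal_mult)
qed

text \<open>\<open>mass_decay\<close> read from small to large radii is exponential growth. It
  provides the maximal cubes in \<open>stopping_level_mass\<close>, where g is compared with
  \<open>\<sigma>\<close> instead of Lebesgue measure.\<close>

lemma mass_unbounded:
  assumes "K < \<infinity>"
  obtains L :: int where "\<And>l. L \<le> l \<Longrightarrow> K \<le> mass \<sigma> (ball x (2 powr l))"
proof -
  obtain K' where K: "K = ennreal K'" "0 \<le> K'" using assms by (cases K) auto
  define v where "v = enn2real (mass \<sigma> (ball x 1))"
  have v: "mass \<sigma> (ball x 1) = ennreal v" "0 < v"
    unfolding v_def using mass_finite[of 1 x] mass_pos[of 1 x]
    by (auto simp: less_top[symmetric] enn2real_positive_iff)
  \<comment> \<open>By exp u \<ge> u it suffices that m / (2 s) - 1 \<ge> K' / v.\<close>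
  define L where "L = max 0 \<lceil>2 * s * (1 + K' / v)\<rceil>"
  have "K \<le> mass \<sigma> (ball x (2 powr l))" if l: "L \<le> l" for l
  proof -
    obtain m where m: "l = int m" using l by (metis L_def max.boundedE zero_le_imp_eq_int)
    have "2 * s * (1 + K' / v) \<le> real m" using l unfolding L_def m by linarith
    then have "K' / v \<le> real m / (2 * s) - 1" using s by (simp add: field_simps)
    also have "\<dots> \<le> exp (real m / (2 * s) - 1)" using exp_ge_add_one_self[of "real m / (2 * s) - 1"] by linarith
    finally have "K' \<le> exp (real m / (2 * s) - 1) * v" using v by (simp add: field_simps)
    then have "K \<le> ennreal (exp (real m / (2 * s) - 1)) * ennreal v"
      using v by (simp add: K ennreal_leI flip: ennreal_mult)
    also have "ennreal v \<le> ennreal (exp (1 - m / (2 * s))) * mass \<sigma> (ball x (2 ^ m))"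
      using mass_decay[of "2 ^ m" x m] v by simp
    then have "ennreal (exp (real m / (2 * s) - 1)) * ennreal v
      \<le> ennreal (exp (real m / (2 * s) - 1)) * (ennreal (exp (1 - m / (2 * s))) * mass \<sigma> (ball x (2 ^ m)))"
      by (intro mult_left_mono) auto
    also have "\<dots> = mass \<sigma> (ball x (2 powr l))"
      by (simp add: mult.assoc[symmetric] exp_add[symmetric] m powr_realpow flip: ennreal_mult)
    finally show ?thesis .
  qed
  then show thesis by (rule that)
qed

end

section \<open>The strong type estimate\<close>

lemma divide_le_ennreal:
  fixes a b c :: ennreal
  assumes "b \<noteq> 0" "b < top"
  shows "a / b \<le> c \<longleftrightarrow> a \<le> c * b"
proof
  assume "a / b \<le> c"
  then have "a / b * b \<le> c * b" by (rule mult_right_mono) simp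
  then show "a \<le> c * b"
    using assms by (simp add: ennreal_divide_times less_top[symmetric])
next
  assume "a \<le> c * b"
  then show "a / b \<le> c"
    using assms by (intro divide_le_posI_ennreal) (auto simp: zero_less_iff_neq_zero mult.commute)
qed

lemma less_divide_ennreal:
  fixes a b c :: ennreal
  shows "b \<noteq> 0 \<Longrightarrow> b < top \<Longrightarrow> c < a / b \<longleftrightarrow> c * b < a"
  using divide_le_ennreal[of b a c] by (simp add: not_le[symmetric])

lemma nn_integral_count_space_subset:
  fixes f :: "'i \<Rightarrow> ennreal"
  assumes "Y \<subseteq> X"
  shows "(\<integral>\<^sup>+i. f i * indicator Y i \<partial>count_space X) = (\<integral>\<^sup>+i. f i \<partial>count_space Y)"
  using assms by (subst (1 2) nn_integral_count_space_indicator)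
    (auto simp: mult.assoc indicator_inter_arith[symmetric] Int_absorb2 intro!: nn_integral_cong split: split_indicator)

lemma nn_integral_count_space_UN_le:
  fixes f :: "'i \<Rightarrow> ennreal"
  assumes "countable J" "X \<subseteq> (\<Union>j\<in>J. Y j)" "\<And>j. j \<in> J \<Longrightarrow> Y j \<subseteq> X"
  shows "(\<integral>\<^sup>+i. f i \<partial>count_space X) \<le> (\<integral>\<^sup>+j. \<integral>\<^sup>+i. f i \<partial>count_space (Y j) \<partial>count_space J)"
proof -
  have "(\<integral>\<^sup>+i. f i \<partial>count_space X) \<le> (\<integral>\<^sup>+i. \<integral>\<^sup>+j. f i * indicator (Y j) i \<partial>count_space J \<partial>count_space X)"
  proof (rule nn_integral_mono)
    fix i assume "i \<in> space (count_space X)"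
    then obtain j where j: "j \<in> J" "i \<in> Y j" using assms(2) by auto
    from nn_integral_ge_point[OF j(1), of "\<lambda>j. f i * indicator (Y j) i"] j
    show "f i \<le> (\<integral>\<^sup>+j. f i * indicator (Y j) i \<partial>count_space J)" by simp
  qed
  also have "\<dots> = (\<integral>\<^sup>+j. \<integral>\<^sup>+i. f i * indicator (Y j) i \<partial>count_space X \<partial>count_space J)"
    using assms(1) by (intro nn_integral_count_space_nn_integral) auto
  also have "\<dots> = (\<integral>\<^sup>+j. \<integral>\<^sup>+i. f i \<partial>count_space (Y j) \<partial>count_space J)"
  proof (rule nn_integral_cong)
    fix j assume "j \<in> space (count_space J)"
    then have "Y j \<subseteq> X" using assms(3) by auto
    then show "(\<integral>\<^sup>+i. f i * indicator (Y j) i \<partial>count_space X) = (\<integral>\<^sup>+i. f i \<partial>count_space (Y j))"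
      by (rule nn_integral_count_space_subset)
  qed
  finally show ?thesis .
qed

section \<open>Stopping cubes and their large disjoint parts\<close>

definition stopping_level :: "'a::euclidean_space itself \<Rightarrow> int \<Rightarrow> ennreal" where
  "stopping_level _ k = ennreal ((2 ^ (DIM('a) + 1)) powr real_of_int k)"

definition stopping_cubes :: "('a::euclidean_space \<Rightarrow> ennreal) \<Rightarrow> int \<Rightarrow> (int \<times> 'a) set" where
  "stopping_cubes g k = level_cubes g (stopping_level TYPE('a) k)"

definition stopping_part :: "('a::euclidean_space \<Rightarrow> ennreal) \<Rightarrow> int \<Rightarrow> int \<times> 'a \<Rightarrow> 'a set" where
  "stopping_part g k Q = cube Q - (\<Union>Q'\<in>stopping_cubes g (k + 1). cube Q')"

lemma stopping_level_pos: "0 < stopping_level TYPE('a::euclidean_space) k"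
  by (simp add: stopping_level_def)

lemma stopping_level_finite: "stopping_level TYPE('a::euclidean_space) k < \<infinity>"
  by (simp add: stopping_level_def)

text \<open>The base is twice the factor 2^DIM lost in \<open>level_cubes_upper\<close>; the extra 2
  is what leaves half of each cube in \<open>stopping_part_large\<close>.\<close>

lemma stopping_level_Suc:
  "stopping_level TYPE('a::euclidean_space) (k + 1) = 2 * 2 ^ DIM('a) * stopping_level TYPE('a) k"
proof -
  define b :: real where "b = 2 * 2 ^ DIM('a)"
  have b: "0 < b" "ennreal b = 2 * 2 ^ DIM('a)" by (auto simp: b_def ennreal_mult ennreal_power[symmetric] simp del: ennreal_power)
  have "b powr (real_of_int k + 1) = b * b powr k" using b by (simp add: powr_add)
  then have "ennreal (b powr real_of_int (k + 1)) = ennreal b * ennreal (b powr k)"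
    using b(1) by (simp add: ennreal_mult)
  then show ?thesis unfolding b(2) by (simp add: stopping_level_def b_def)
qed

lemma stopping_level_mono: "k \<le> l \<Longrightarrow> stopping_level TYPE('a::euclidean_space) k \<le> stopping_level TYPE('a) l"
  unfolding stopping_level_def using one_le_power[of "2::real" "DIM('a) + 1"]
  by (intro ennreal_leI powr_mono) auto

lemma stopping_part_measurable [measurable]: "stopping_part g k Q \<in> sets lebesgue"
  unfolding stopping_part_def stopping_cubes_def
  by (intro sets.Diff sets.countable_UN'' countable_level_cubes) auto

text \<open>The next-level cubes inside Q are disjoint with means above 2 2^DIM times the current
  level, whereas the mean over Q is at most 2^DIM times that level. So they fill at most half of
  Q.\<close>

lemma stopping_part_large:
  fixes g :: "'a::euclidean_space \<Rightarrow> ennreal"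
  assumes [measurable]: "g \<in> borel_measurable lebesgue" and Q: "Q \<in> stopping_cubes g k"
  shows "emeasure lebesgue (cube Q) \<le> 2 * emeasure lebesgue (stopping_part g k Q)"
proof -
  let ?a = "stopping_level TYPE('a) k" and ?b = "stopping_level TYPE('a) (k + 1)"
  define T where "T = {Q' \<in> stopping_cubes g (k + 1). cube Q' \<subseteq> cube Q}"
  have Q': "Q \<in> cubes" using Q by (auto simp: stopping_cubes_def level_cubes_cubes)
  have T1: "T \<subseteq> level_cubes g ?b" unfolding T_def stopping_cubes_def by auto
  note T = T1 countable_subset[OF T1 countable_level_cubes]
  \<comment> \<open>A next-level cube that meets Q is contained in Q or a strict ancestor of Q. In
    the latter case its mean would be at most the current level, by the maximality of Q.\<close>
  have inside: "cube Q' \<subseteq> cube Q" if "Q' \<in> stopping_cubes g (k + 1)" "y \<in> cube Q'" "y \<in> cube Q" for Q' y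
  proof (cases "fst Q' \<le> fst Q")
    case True
    have "ancestor (fst Q) Q' = Q"
      using ancestor_eq[OF that(2) True] that(3) by (simp add: cube_def prod_eq_iff)
    then show ?thesis using cube_subset_ancestor[OF True] by simp
  next
    case False
    then have "ancestor (fst Q') Q = Q'"
      using ancestor_eq[OF that(3), of "fst Q'"] that(2) by (simp add: cube_def prod_eq_iff)
    moreover have "\<forall>l>fst Q. \<not> ?a * emeasure lebesgue (cube (ancestor l Q)) < cube_integral g (ancestor l Q)"
      using Q unfolding stopping_cubes_def level_cubes_def tops_def by blast
    ultimately have "\<not> ?a * emeasure lebesgue (cube Q') < cube_integral g Q'"
      using False by (metis not_le)
    moreover have "?b * emeasure lebesgue (cube Q') < cube_integral g Q'"
      using that(1) unfolding stopping_cubes_def by (rule level_cubes_gt)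
    moreover have "?a * emeasure lebesgue (cube Q') \<le> ?b * emeasure lebesgue (cube Q')"
      by (intro mult_right_mono stopping_level_mono) auto
    ultimately show ?thesis by (meson le_less_trans)
  qed
  let ?U = "\<Union>Q'\<in>T. cube Q'"
  have U [measurable]: "?U \<in> sets lebesgue" using T(2) by (intro sets.countable_UN'') auto
  have part: "stopping_part g k Q = cube Q - ?U"
    unfolding stopping_part_def T_def using inside by blast
  have "?b * emeasure lebesgue ?U \<le> ?b * (\<integral>\<^sup>+Q'. emeasure lebesgue (cube Q') \<partial>count_space T)"
    using mass_UN_le[OF T(2), of "\<lambda>_. 1" "cube"] by (intro mult_left_mono) (auto simp: mass_def)
  also have "\<dots> = (\<integral>\<^sup>+Q'. ?b * emeasure lebesgue (cube Q') \<partial>count_space T)"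
    by (rule nn_integral_cmult[symmetric]) simp
  also have "\<dots> \<le> (\<integral>\<^sup>+Q'. (\<integral>\<^sup>+x\<in>cube Q'. (g x * indicator (cube Q) x) \<partial>lebesgue) \<partial>count_space T)"
  proof (rule nn_integral_mono)
    fix Q' assume "Q' \<in> space (count_space T)"
    then have Q': "Q' \<in> level_cubes g ?b" "cube Q' \<subseteq> cube Q" using T by (auto simp: T_def)
    have "?b * emeasure lebesgue (cube Q') \<le> cube_integral g Q'" using level_cubes_gt[OF Q'(1)] by simp
    also have "\<dots> = (\<integral>\<^sup>+x\<in>cube Q'. (g x * indicator (cube Q) x) \<partial>lebesgue)"
      unfolding cube_integral_def using Q'(2) by (intro nn_integral_cong) (auto split: split_indicator)
    finally show "?b * emeasure lebesgue (cube Q') \<le> (\<integral>\<^sup>+x\<in>cube Q'. (g x * indicator (cube Q) x) \<partial>lebesgue)" .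
  qed
  also have "\<dots> \<le> (\<integral>\<^sup>+x. g x * indicator (cube Q) x \<partial>lebesgue)"
  proof (rule set_nn_integral_disjoint_le[OF T(2)])
    fix i j y assume "i \<in> T" "j \<in> T" "y \<in> cube i" "y \<in> cube j"
    then show "i = j" using T(1) by (meson level_cubes_disjoint subsetD)
  qed measurable
  also have "\<dots> \<le> 2 ^ DIM('a) * ?a * emeasure lebesgue (cube Q)"
    using level_cubes_upper[of Q g ?a] Q by (simp add: stopping_cubes_def cube_integral_def)
  finally have "(2 ^ DIM('a) * ?a) * (2 * emeasure lebesgue ?U) \<le> (2 ^ DIM('a) * ?a) * emeasure lebesgue (cube Q)"
    by (simp add: stopping_level_Suc mult_ac)
  moreover have "0 < 2 ^ DIM('a) * ?a" "2 ^ DIM('a) * ?a < \<infinity>"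
    using stopping_level_pos[where 'a = 'a, of k] stopping_level_finite[where 'a = 'a, of k]
    by (auto simp: ennreal_zero_less_mult_iff ennreal_mult_less_top power_less_top_ennreal zero_less_iff_neq_zero)
  ultimately have half: "2 * emeasure lebesgue ?U \<le> emeasure lebesgue (cube Q)"
    by (subst (asm) ennreal_mult_le_mult_iff) auto
  have sub: "?U \<subseteq> cube Q" by (auto simp: T_def)
  obtain q where q: "emeasure lebesgue (cube Q) = ennreal q" "0 \<le> q"
    using emeasure_cube[OF Q'] by simp
  have "emeasure lebesgue ?U \<le> ennreal q" using emeasure_mono[OF sub] q by (metis cube_lebesgue)
  then obtain u where u: "emeasure lebesgue ?U = ennreal u" "0 \<le> u"
    by (cases "emeasure lebesgue ?U") (auto simp: top_unique)
  have "2 * u \<le> q" using half q u by (simp add: ennreal_mult''[symmetric] ennreal_numeral[symmetric] del: ennreal_numeral)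
  have "emeasure lebesgue (stopping_part g k Q) = ennreal q - ennreal u"
    unfolding part q(1)[symmetric] u(1)[symmetric] using sub u(1) U
    by (intro emeasure_Diff) (auto simp del: emeasure_completion)
  also have "\<dots> = ennreal (q - u)" using u by (simp add: ennreal_minus)
  finally have p: "emeasure lebesgue (stopping_part g k Q) = ennreal (q - u)" .
  have "ennreal q \<le> ennreal (2 * (q - u))" using \<open>2 * u \<le> q\<close> by (intro ennreal_leI) simp
  also have "\<dots> = 2 * ennreal (q - u)" using \<open>2 * u \<le> q\<close> u(2) by (subst ennreal_mult) auto
  finally show ?thesis unfolding q(1) p .
qed

text \<open>If k < l, then Q' is contained in a selected cube of level k + 1, whose points have been
  removed from every part of level k.\<close>

lemma stopping_part_disjoint:
  fixes g :: "'a::euclidean_space \<Rightarrow> ennreal"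
  assumes fin: "(\<integral>\<^sup>+x. g x \<partial>lebesgue) < \<infinity>" and Q: "Q \<in> stopping_cubes g k" "Q' \<in> stopping_cubes g l"
    and y: "y \<in> stopping_part g k Q" "y \<in> stopping_part g l Q'"
  shows "k = l \<and> Q = Q'"
proof -
  have *: "\<not> k < l" if Q: "Q \<in> stopping_cubes g k" "Q' \<in> stopping_cubes g l"
    and y: "y \<in> stopping_part g k Q" "y \<in> stopping_part g l Q'" for k l Q Q'
  proof
    assume "k < l"
    then have "stopping_level TYPE('a) (k + 1) \<le> stopping_level TYPE('a) l" by (intro stopping_level_mono) auto
    then have "stopping_level TYPE('a) (k + 1) * emeasure lebesgue (cube Q')
        \<le> stopping_level TYPE('a) l * emeasure lebesgue (cube Q')" by (intro mult_right_mono) auto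
    also have "\<dots> < cube_integral g Q'" using Q(2) unfolding stopping_cubes_def by (rule level_cubes_gt)
    finally obtain \<pi> where \<pi>: "\<pi> \<in> level_cubes g (stopping_level TYPE('a) (k + 1))"
        "fst Q' \<le> fst \<pi>" "\<pi> = ancestor (fst \<pi>) Q'"
      using level_cubes_exists[OF fin stopping_level_pos] level_cubes_cubes[OF Q(2)[unfolded stopping_cubes_def]] by metis
    have "y \<in> cube \<pi>" using cube_subset_ancestor[OF \<pi>(2)] \<pi>(3) y(2) by (auto simp: stopping_part_def)
    then show False using y(1) \<pi>(1) by (auto simp: stopping_part_def stopping_cubes_def)
  qed
  have "k = l" using *[OF Q y] *[OF Q(2,1) y(2,1)] by simp
  moreover have "Q = Q'" using Q y \<open>k = l\<close>
    by (auto simp: stopping_part_def stopping_cubes_def intro: level_cubes_disjoint)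
  ultimately show ?thesis by simp
qed

section \<open>The Carleson embedding for the dual weight\<close>

context dual_weights
begin

definition stopping_family :: "('a \<Rightarrow> ennreal) \<Rightarrow> (int \<times> int \<times> 'a) set" where
  "stopping_family g = Sigma UNIV (stopping_cubes g)"

lemma countable_stopping_family: "countable (stopping_family g)"
  unfolding stopping_family_def stopping_cubes_def by (intro countable_SIGMA countable_level_cubes) auto

lemma cube_ball_in_balls: "cube_ball Q \<in> balls"
  unfolding cube_ball_def by (intro ball_in_balls) auto

lemma mass_cube_ball: "0 < mass \<sigma> (cube_ball Q)" "mass \<sigma> (cube_ball Q) < \<infinity>"
  unfolding cube_ball_def by (rule mass_pos mass_finite, simp)+

text \<open>\<open>Ainf_disjoint\<close> inside the ball of \<open>\<pi>\<close>, with the stopping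
  parts as disjoint sets. The nesting of the balls along ancestors puts each
  \<open>cube_ball Q\<close> inside the ball of \<open>\<pi>\<close>, where the A_\<infinity>
  condition can be tested.\<close>

lemma carleson:
  assumes g: "g \<in> borel_measurable lebesgue" and fin: "(\<integral>\<^sup>+x. g x \<partial>lebesgue) < \<infinity>"
  shows "(\<integral>\<^sup>+(k, Q). mass \<sigma> (cube_ball Q)
      \<partial>count_space {(k, Q) \<in> stopping_family g. fst Q \<le> fst \<pi> \<and> ancestor (fst \<pi>) Q = \<pi>})
    \<le> 2 * ennreal (ball_const TYPE('a)) * (ennreal s * mass \<sigma> (cube_ball \<pi>))"
proof -
  let ?X = "{(k, Q) \<in> stopping_family g. fst Q \<le> fst \<pi> \<and> ancestor (fst \<pi>) Q = \<pi>}"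
  have X: "x \<in> ?X \<Longrightarrow> snd x \<in> stopping_cubes g (fst x) \<and> snd x \<in> cubes \<and> fst (snd x) \<le> fst \<pi> \<and> ancestor (fst \<pi>) (snd x) = \<pi>" for x
    by (auto simp: stopping_family_def stopping_cubes_def dest: level_cubes_cubes)
  have "(\<integral>\<^sup>+x. mass \<sigma> (cube_ball (snd x)) \<partial>count_space ?X)
    \<le> 2 * ennreal (ball_const TYPE('a)) * (ennreal s * mass \<sigma> (ball (snd \<pi>) (4 * DIM('a) * 2 powr real_of_int (fst \<pi>))))"
  proof (rule Ainf_disjoint[where E = "\<lambda>x. stopping_part g (fst x) (snd x)"])
    show "countable ?X" by (rule countable_subset[OF _ countable_stopping_family[of g]]) auto
    fix x assume "x \<in> ?X"
    note x = X[OF this]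
    show "cube_ball (snd x) \<subseteq> ball (snd \<pi>) (4 * DIM('a) * 2 powr real_of_int (fst \<pi>))"
      using cube_ball_subset_ancestor[of "snd x" "fst \<pi>"] x by (simp add: cube_ball_def)
    show "stopping_part g (fst x) (snd x) \<subseteq> cube_ball (snd x)"
      using cube_subset_ball[of "snd x"] by (auto simp: stopping_part_def)
    have "emeasure lebesgue (cube_ball (snd x)) \<le> ennreal (ball_const TYPE('a)) * emeasure lebesgue (cube (snd x))"
      using x by (intro emeasure_cube_ball_le) auto
    also have "\<dots> \<le> ennreal (ball_const TYPE('a)) * (2 * emeasure lebesgue (stopping_part g (fst x) (snd x)))"
      using x by (intro mult_left_mono stopping_part_large g) auto
    finally show "emeasure lebesgue (cube_ball (snd x))
        \<le> 2 * ennreal (ball_const TYPE('a)) * emeasure lebesgue (stopping_part g (fst x) (snd x))"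
      by (simp only: mult_ac)
  next
    fix x x' y assume "x \<in> ?X" "x' \<in> ?X" "y \<in> stopping_part g (fst x) (snd x)" "y \<in> stopping_part g (fst x') (snd x')"
    then show "x = x'"
      using stopping_part_disjoint[OF fin, of "snd x" "fst x" "snd x'" "fst x'" y] X by (simp add: prod_eq_iff)
  qed (auto intro: cube_ball_in_balls)
  then show ?thesis unfolding cube_ball_def[of \<pi>] case_prod_beta .
qed

text \<open>A weak-type estimate for the quotients of the integral over Q by the
  \<open>\<sigma>\<close>-mass of its ball. Group the cubes under the maximal \<open>\<pi>\<close>
  with large quotient; \<open>carleson\<close> bounds each group by the mass of the ball of
  \<open>\<pi>\<close>. The part of g below \<open>\<mu>\<close> times \<open>\<sigma>\<close>
  accounts for at most half of what the condition demands on \<open>\<pi>\<close>, so the other half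
  comes from the set where g is larger. The cubes \<open>\<pi>\<close> are disjoint.\<close>

lemma stopping_level_mass:
  assumes [measurable]: "g \<in> borel_measurable lebesgue" and fin: "(\<integral>\<^sup>+x. g x \<partial>lebesgue) < \<infinity>" and \<mu>: "0 < \<mu>" "\<mu> < \<infinity>"
  shows "\<mu> * (\<integral>\<^sup>+(k, Q). mass \<sigma> (cube_ball Q)
      \<partial>count_space {(k, Q) \<in> stopping_family g. 2 * \<mu> * mass \<sigma> (cube_ball Q) < cube_integral g Q})
    \<le> 2 * ennreal (ball_const TYPE('a)) * ennreal s * (\<integral>\<^sup>+x. g x * indicator {x. \<mu> * \<sigma> x < g x} x \<partial>lebesgue)"
proof -
  define P where "P = (\<lambda>Q. 2 * \<mu> * mass \<sigma> (cube_ball Q) < cube_integral g Q)"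
  let ?C = "2 * ennreal (ball_const TYPE('a))"
  let ?X = "{(k, Q) \<in> stopping_family g. P Q}"
  let ?Y = "\<lambda>\<pi>. {(k, Q) \<in> stopping_family g. fst Q \<le> fst \<pi> \<and> ancestor (fst \<pi>) Q = \<pi>}"
  let ?h = "\<lambda>x. g x * indicator {x. \<mu> * \<sigma> x < g x} x"
  \<comment> \<open>g has finite integral, while the balls of high ancestors have arbitrarily large
    \<open>\<sigma>\<close>-mass.\<close>
  have big: "\<exists>K. \<forall>l\<ge>K. \<not> P (ancestor l Q)" for Q
  proof -
    have "(\<integral>\<^sup>+x. g x \<partial>lebesgue) / (2 * \<mu>) < \<infinity>"
      using fin \<mu> by (auto simp: ennreal_divide_eq_top_iff less_top[symmetric] ennreal_mult_eq_top_iff)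
    then obtain L :: int where L: "\<And>l. L \<le> l \<Longrightarrow> (\<integral>\<^sup>+x. g x \<partial>lebesgue) / (2 * \<mu>) \<le> mass \<sigma> (ball (snd Q) (2 powr l))"
      using mass_unbounded by blast
    have "\<not> P (ancestor l Q)" if "L \<le> l" for l
    proof -
      have "ball (snd Q) (2 powr l) \<subseteq> cube_ball (ancestor l Q)"
      proof
        fix y assume y: "y \<in> ball (snd Q) (2 powr l)"
        have "dist (corner l (snd Q)) y \<le> dist (corner l (snd Q)) (snd Q) + dist (snd Q) y" by (rule dist_triangle)
        also have "\<dots> < DIM('a) * 2 powr l + 1 * 2 powr l"
          using y dist_corner[of l "snd Q"] by simp
        also have "\<dots> \<le> DIM('a) * 2 powr l + real DIM('a) * 2 powr l"
          using DIM_ge_Suc0[where 'a = 'a] by (intro add_left_mono mult_right_mono) auto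
        also have "\<dots> \<le> 4 * DIM('a) * 2 powr l" by simp
        finally show "y \<in> cube_ball (ancestor l Q)" by (simp add: cube_ball_def ancestor_def)
      qed
      then have "(\<integral>\<^sup>+x. g x \<partial>lebesgue) / (2 * \<mu>) \<le> mass \<sigma> (cube_ball (ancestor l Q))"
        using L[OF that] mass_mono by (meson order_trans)
      then have "(\<integral>\<^sup>+x. g x \<partial>lebesgue) \<le> 2 * \<mu> * mass \<sigma> (cube_ball (ancestor l Q))"
        using \<mu> by (subst (asm) divide_le_ennreal) (auto simp: ennreal_mult_less_top mult_ac ennreal_zero_less_mult_iff)
      then show ?thesis using cube_integral_le[of g "ancestor l Q"] by (simp add: P_def not_less)
    qed
    then show ?thesis by blast
  qed
  have "(\<integral>\<^sup>+(k, Q). mass \<sigma> (cube_ball Q) \<partial>count_space ?X)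
     \<le> (\<integral>\<^sup>+\<pi>. \<integral>\<^sup>+(k, Q). mass \<sigma> (cube_ball Q) \<partial>count_space (?X \<inter> ?Y \<pi>) \<partial>count_space (tops P))"
  proof (rule nn_integral_count_space_UN_le[OF countable_tops])
    show "?X \<subseteq> (\<Union>\<pi>\<in>tops P. ?X \<inter> ?Y \<pi>)"
    proof
      fix x assume x: "x \<in> ?X"
      obtain k Q where k: "x = (k, Q)" by (cases x)
      have Q: "Q \<in> cubes" "P Q" using x k
        by (auto simp: stopping_family_def stopping_cubes_def dest: level_cubes_cubes)
      obtain K where "\<And>l. K \<le> l \<Longrightarrow> \<not> P (ancestor l Q)" using big by blast
      from tops_exists[where P = P, OF Q this] obtain \<pi> where
        "\<pi> \<in> tops P" "fst Q \<le> fst \<pi>" "\<pi> = ancestor (fst \<pi>) Q" by blast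
      then show "x \<in> (\<Union>\<pi>\<in>tops P. ?X \<inter> ?Y \<pi>)" using x k by auto
    qed
  qed auto
  also have "\<dots> \<le> (\<integral>\<^sup>+\<pi>. ?C * (ennreal s * mass \<sigma> (cube_ball \<pi>)) \<partial>count_space (tops P))"
  proof (rule nn_integral_mono)
    fix \<pi>
    have "(\<integral>\<^sup>+(k, Q). mass \<sigma> (cube_ball Q) \<partial>count_space (?X \<inter> ?Y \<pi>)) \<le> (\<integral>\<^sup>+(k, Q). mass \<sigma> (cube_ball Q) \<partial>count_space (?Y \<pi>))"
      by (subst (1 2) nn_integral_count_space_indicator) (auto intro!: nn_integral_mono split: split_indicator)
    also have "\<dots> \<le> ?C * (ennreal s * mass \<sigma> (cube_ball \<pi>))" by (rule carleson) fact+
    finally show "(\<integral>\<^sup>+(k, Q). mass \<sigma> (cube_ball Q) \<partial>count_space (?X \<inter> ?Y \<pi>)) \<le> ?C * (ennreal s * mass \<sigma> (cube_ball \<pi>))" .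
  qed
  finally have "\<mu> * (\<integral>\<^sup>+(k, Q). mass \<sigma> (cube_ball Q) \<partial>count_space ?X)
      \<le> \<mu> * (\<integral>\<^sup>+\<pi>. ?C * (ennreal s * mass \<sigma> (cube_ball \<pi>)) \<partial>count_space (tops P))"
    by (rule mult_left_mono) simp
  also have "\<dots> = (\<integral>\<^sup>+\<pi>. ?C * ennreal s * (\<mu> * mass \<sigma> (cube_ball \<pi>)) \<partial>count_space (tops P))"
    by (subst nn_integral_cmult[symmetric]) (auto simp: mult_ac)
  also have "\<dots> \<le> (\<integral>\<^sup>+\<pi>. ?C * ennreal s * cube_integral ?h \<pi> \<partial>count_space (tops P))"
  proof (intro nn_integral_mono mult_left_mono)
    fix \<pi> assume "\<pi> \<in> space (count_space (tops P))"
    then have \<pi>: "P \<pi>" by (auto simp: tops_def)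
    have "cube_integral g \<pi> \<le> (\<integral>\<^sup>+x. ?h x * indicator (cube \<pi>) x + \<mu> * (\<sigma> x * indicator (cube_ball \<pi>) x) \<partial>lebesgue)"
      unfolding cube_integral_def using cube_subset_ball[of \<pi>]
      by (intro nn_integral_mono) (auto split: split_indicator)
    also have "\<dots> = cube_integral ?h \<pi> + \<mu> * mass \<sigma> (cube_ball \<pi>)"
      unfolding cube_integral_def mass_def by (subst nn_integral_add) (auto simp: nn_integral_cmult)
    finally have "2 * \<mu> * mass \<sigma> (cube_ball \<pi>) < cube_integral ?h \<pi> + \<mu> * mass \<sigma> (cube_ball \<pi>)"
      using \<pi> by (simp add: P_def)
    then have "\<mu> * mass \<sigma> (cube_ball \<pi>) + \<mu> * mass \<sigma> (cube_ball \<pi>) < \<mu> * mass \<sigma> (cube_ball \<pi>) + cube_integral ?h \<pi>"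
      by (simp add: mult_2 distrib_right add.commute)
    then show "\<mu> * mass \<sigma> (cube_ball \<pi>) \<le> cube_integral ?h \<pi>"
      by (auto simp: ennreal_add_left_cancel_less)
  qed auto
  also have "\<dots> = ?C * ennreal s * (\<integral>\<^sup>+\<pi>. cube_integral ?h \<pi> \<partial>count_space (tops P))"
    by (rule nn_integral_cmult) simp
  also have "\<dots> \<le> ?C * ennreal s * (\<integral>\<^sup>+x. ?h x \<partial>lebesgue)"
    unfolding cube_integral_def
    by (intro mult_left_mono set_nn_integral_disjoint_le countable_tops) (measurable, rule tops_disjoint, auto)
  finally show ?thesis by (simp add: P_def)
qed

text \<open>Group the cubes by the dyadic size 2^l of the quotient, multiply
  \<open>stopping_level_mass\<close> by 2^(l (r - 1)) and sum over l. The levels below g / \<sigma>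
  add up to a multiple of (g / \<sigma>)^(r - 1), and g (g / \<sigma>)^(r - 1) = g^r w by
  duality.\<close>

lemma carleson_embedding:
  assumes g [measurable]: "g \<in> borel_measurable lebesgue" and fin: "(\<integral>\<^sup>+x. g x \<partial>lebesgue) < \<infinity>"
  shows "(\<integral>\<^sup>+(k, Q). ennpowr (cube_integral g Q / mass \<sigma> (cube_ball Q)) r * mass \<sigma> (cube_ball Q) \<partial>count_space (stopping_family g))
    \<le> ennreal (4 powr r * 2 * ball_const TYPE('a) * s * (2 + 2 / (r - 1))) * (\<integral>\<^sup>+x. ennpowr (g x) r * w x \<partial>lebesgue)"
proof -
  let ?X = "stopping_family g"
  define e where "e Q = cube_integral g Q / mass \<sigma> (cube_ball Q)" for Q
  let ?m = "\<lambda>l::int. ennreal (2 powr real_of_int l)"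
  let ?P = "\<lambda>l Q. 2 * ?m l * mass \<sigma> (cube_ball Q) < cube_integral g Q"
  let ?c = "\<lambda>l::int. ennreal (4 powr r * 2 powr (real_of_int l * r))"
  define D where "D = 2 * ball_const TYPE('a) * s"
  have D: "0 \<le> D" "2 * ennreal (ball_const TYPE('a)) * ennreal s = ennreal D"
    using s ball_const_ge_1[where 'a = 'a] by (auto simp: D_def ennreal_mult)
  have "(\<integral>\<^sup>+x. ennpowr (e (snd x)) r * mass \<sigma> (cube_ball (snd x)) \<partial>count_space ?X)
    \<le> (\<integral>\<^sup>+x. \<integral>\<^sup>+l. ?c l * (mass \<sigma> (cube_ball (snd x)) * indicator {x. ?P l (snd x)} x) \<partial>count_space UNIV \<partial>count_space ?X)"
  proof (rule nn_integral_mono)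
    fix x assume "x \<in> space (count_space ?X)"
    then obtain k Q where k: "x = (k, Q)" "Q \<in> stopping_cubes g k" by (auto simp: stopping_family_def)
    have "0 < cube_integral g Q"
      using level_cubes_gt[OF k(2)[unfolded stopping_cubes_def]] by (rule le_less_trans[OF zero_le])
    moreover have "cube_integral g Q < \<infinity>" using cube_integral_le[of g Q] fin by (rule le_less_trans)
    ultimately have e: "0 < e Q" "e Q < \<infinity>"
      using mass_cube_ball[of Q]
      by (auto simp: e_def ennreal_zero_less_divide ennreal_divide_eq_top_iff less_top[symmetric])
    \<comment> \<open>The lower end is the condition of \<open>stopping_level_mass\<close> with
      \<open>\<mu>\<close> = 2^l, the upper end gives the factor 4^r.\<close>
    obtain l :: int where l: "ennreal (2 * 2 powr real_of_int l) < e Q" "e Q \<le> ennreal (2 * 2 * 2 powr real_of_int l)"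
      using level_exists[OF e, of 2 2] by auto
    have "2 * ?m l < e Q" using l(1) by (simp add: ennreal_mult)
    then have "?P l Q"
      unfolding e_def using mass_cube_ball[of Q] by (subst (asm) less_divide_ennreal) auto
    have "ennpowr (e Q) r \<le> ennpowr (ennreal (2 * 2 * 2 powr real_of_int l)) r"
      using l r by (intro ennpowr_mono) auto
    also have "\<dots> = ?c l" by (simp add: ennpowr_ennreal powr_mult powr_powr)
    finally have "ennpowr (e Q) r * mass \<sigma> (cube_ball Q) \<le> ?c l * (mass \<sigma> (cube_ball Q) * indicator {x. ?P l (snd x)} x)"
      using \<open>?P l Q\<close> k by (simp add: mult_right_mono)
    also have "\<dots> \<le> (\<integral>\<^sup>+l. ?c l * (mass \<sigma> (cube_ball Q) * indicator {x. ?P l (snd x)} x) \<partial>count_space UNIV)"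
      by (rule nn_integral_ge_point) simp
    finally show "ennpowr (e (snd x)) r * mass \<sigma> (cube_ball (snd x))
      \<le> (\<integral>\<^sup>+l. ?c l * (mass \<sigma> (cube_ball (snd x)) * indicator {x. ?P l (snd x)} x) \<partial>count_space UNIV)"
      by (simp add: k)
  qed
  also have "\<dots> = (\<integral>\<^sup>+l. \<integral>\<^sup>+x. ?c l * (mass \<sigma> (cube_ball (snd x)) * indicator {x. ?P l (snd x)} x) \<partial>count_space ?X \<partial>count_space UNIV)"
    by (intro nn_integral_count_space_nn_integral) auto
  also have "\<dots> \<le> (\<integral>\<^sup>+l. \<integral>\<^sup>+x. ennreal (4 powr r * D) *
      (g x * (ennreal (2 powr (real_of_int l * (r - 1))) * indicator {x. ?m l * \<sigma> x < g x} x)) \<partial>lebesgue \<partial>count_space UNIV)"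
  proof (rule nn_integral_mono)
    fix l :: int
    let ?Z = "{(k, Q) \<in> ?X. ?P l Q}"
    have "(\<integral>\<^sup>+x. ?c l * (mass \<sigma> (cube_ball (snd x)) * indicator {x. ?P l (snd x)} x) \<partial>count_space ?X)
      = ?c l * (\<integral>\<^sup>+(k, Q). mass \<sigma> (cube_ball Q) \<partial>count_space ?Z)"
    proof -
      have "(\<integral>\<^sup>+x. mass \<sigma> (cube_ball (snd x)) * indicator {x. ?P l (snd x)} x \<partial>count_space ?X)
        = (\<integral>\<^sup>+x. mass \<sigma> (cube_ball (snd x)) * indicator ?Z x \<partial>count_space ?X)"
        by (intro nn_integral_cong) (auto split: split_indicator)
      also have "\<dots> = (\<integral>\<^sup>+(k, Q). mass \<sigma> (cube_ball Q) \<partial>count_space ?Z)"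
        unfolding case_prod_beta by (subst nn_integral_count_space_subset) auto
      finally show ?thesis by (simp add: nn_integral_cmult)
    qed
    also have "\<dots> = ennreal (4 powr r) * ennreal (2 powr (real_of_int l * (r - 1))) * (?m l * (\<integral>\<^sup>+(k, Q). mass \<sigma> (cube_ball Q) \<partial>count_space ?Z))"
    proof -
      have "?c l = ennreal (4 powr r) * ennreal (2 powr (real_of_int l * (r - 1))) * ?m l"
        by (simp add: powr_add[symmetric] algebra_simps flip: ennreal_mult)
      then show ?thesis by (simp only: mult.assoc)
    qed
    also have "\<dots> \<le> ennreal (4 powr r) * ennreal (2 powr (real_of_int l * (r - 1))) *
        (2 * ennreal (ball_const TYPE('a)) * ennreal s * (\<integral>\<^sup>+x. g x * indicator {x. ?m l * \<sigma> x < g x} x \<partial>lebesgue))"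
      using fin by (intro mult_left_mono stopping_level_mass) auto
    also have "\<dots> = ennreal (4 powr r * D) * (ennreal (2 powr (real_of_int l * (r - 1))) *
         (\<integral>\<^sup>+x. g x * indicator {x. ?m l * \<sigma> x < g x} x \<partial>lebesgue))"
      unfolding D(2) using D(1) by (simp add: ennreal_mult mult_ac)
    also have "\<dots> = (\<integral>\<^sup>+x. ennreal (4 powr r * D) *
      (g x * (ennreal (2 powr (real_of_int l * (r - 1))) * indicator {x. ?m l * \<sigma> x < g x} x)) \<partial>lebesgue)"
      by (simp add: nn_integral_cmult[symmetric] mult_ac)
    finally show "(\<integral>\<^sup>+x. ?c l * (mass \<sigma> (cube_ball (snd x)) * indicator {x. ?P l (snd x)} x) \<partial>count_space ?X)
      \<le> (\<integral>\<^sup>+x. ennreal (4 powr r * D) *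
      (g x * (ennreal (2 powr (real_of_int l * (r - 1))) * indicator {x. ?m l * \<sigma> x < g x} x)) \<partial>lebesgue)" .
  qed
  also have "\<dots> = (\<integral>\<^sup>+x. \<integral>\<^sup>+l. ennreal (4 powr r * D) *
      (g x * (ennreal (2 powr (real_of_int l * (r - 1))) * indicator {x. ?m l * \<sigma> x < g x} x)) \<partial>count_space UNIV \<partial>lebesgue)"
    by (intro nn_integral_count_space_nn_integral[symmetric]) auto
  also have "\<dots> \<le> (\<integral>\<^sup>+x. ennreal (4 powr r * D * (2 + 2 / (r - 1))) * (ennpowr (g x) r * w x) \<partial>lebesgue)"
  proof (rule nn_integral_mono_AE)
    show "AE x in lebesgue. (\<integral>\<^sup>+l. ennreal (4 powr r * D) *
      (g x * (ennreal (2 powr (real_of_int l * (r - 1))) * indicator {x. ?m l * \<sigma> x < g x} x)) \<partial>count_space UNIV)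
       \<le> ennreal (4 powr r * D * (2 + 2 / (r - 1))) * (ennpowr (g x) r * w x)"
      using dual
    proof eventually_elim
      case (elim x)
      let ?L = "{l. ?m l < g x / \<sigma> x}"
      have "(\<integral>\<^sup>+l. ennreal (4 powr r * D) *
        (g x * (ennreal (2 powr (real_of_int l * (r - 1))) * indicator {x. ?m l * \<sigma> x < g x} x)) \<partial>count_space UNIV)
        = ennreal (4 powr r * D) * (g x * (\<integral>\<^sup>+l. ennreal (2 powr (real_of_int l * (r - 1))) * indicator ?L l \<partial>count_space UNIV))"
      proof -
        have "\<sigma> x \<noteq> 0" "\<sigma> x < top" using elim by auto
        from less_divide_ennreal[OF this] show ?thesis by (simp add: nn_integral_cmult indicator_def)
      qed
      also have "\<dots> \<le> ennreal (4 powr r * D) * (g x * (ennreal (2 + 2 / (r - 1)) * ennpowr (g x / \<sigma> x) (r - 1)))"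
        using r by (intro mult_left_mono dyadic_level_sum_le) auto
      also have "\<dots> = ennreal (4 powr r * D * (2 + 2 / (r - 1))) * (g x * ennpowr (g x / \<sigma> x) (r - 1))"
        using r D by (subst (2) ennreal_mult) (auto simp: mult_ac)
      also have "g x * ennpowr (g x / \<sigma> x) (r - 1) = ennpowr (g x) r * w x"
      proof -
        have "\<sigma> x / \<sigma> x = 1" using elim by (intro ennreal_divide_self) auto
        then have "ennpowr (g x) (r - 1) = ennpowr (g x / \<sigma> x * \<sigma> x) (r - 1)"
          by (simp add: ennreal_divide_times)
        also have "\<dots> = ennpowr (g x / \<sigma> x) (r - 1) * ennpowr (\<sigma> x) (r - 1)" using r by (simp add: ennpowr_mult)
        finally have "ennpowr (g x) (r - 1) * w x = ennpowr (g x / \<sigma> x) (r - 1) * (w x * ennpowr (\<sigma> x) (r - 1))"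
          by (simp only: mult_ac)
        moreover have "ennpowr (g x) r = g x * ennpowr (g x) (r - 1)"
          using ennpowr_add[of 1 "r - 1" "g x"] r by simp
        ultimately show ?thesis using elim by (simp add: mult.assoc)
      qed
      finally show ?case .
    qed
  qed
  also have "\<dots> = ennreal (4 powr r * D * (2 + 2 / (r - 1))) * (\<integral>\<^sup>+x. ennpowr (g x) r * w x \<partial>lebesgue)"
    by (rule nn_integral_cmult) simp
  finally show ?thesis unfolding D_def e_def case_prod_beta by (simp only: mult.assoc)
qed

text \<open>Multiply the A_r condition on the ball by the r-th power of the lower bound for the
  integral over Q, and cancel the volume and the power r - 1 of the \<open>\<sigma>\<close>-mass. At
  the cost of one factor A, the w-mass of the ball becomes a term of
  \<open>carleson_embedding\<close>.\<close>

lemma stopping_cube_mass: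
  assumes "Q \<in> stopping_cubes g k"
  shows "ennpowr (stopping_level TYPE('a) k) r * mass w (cube_ball Q)
    \<le> A * ennreal (ball_const TYPE('a) powr r) *
      (ennpowr (cube_integral g Q / mass \<sigma> (cube_ball Q)) r * mass \<sigma> (cube_ball Q))"
proof -
  let ?W = "mass w (cube_ball Q)" and ?S = "mass \<sigma> (cube_ball Q)"
  define C where "C = ball_const TYPE('a)"
  have C: "0 < C" using ball_const_ge_1[where 'a = 'a] by (simp add: C_def)
  have Q: "Q \<in> level_cubes g (stopping_level TYPE('a) k)" "Q \<in> cubes"
    using assms by (auto simp: stopping_cubes_def level_cubes_cubes)
  define v where "v = (2 powr real_of_int (fst Q)) ^ DIM('a)"
  have v: "emeasure lebesgue (cube Q) = ennreal v" "0 < v"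
    using emeasure_cube[OF Q(2)] by (auto simp: v_def)
  obtain S where S: "?S = ennreal S" "0 < S"
    using mass_cube_ball[of Q] by (cases ?S) auto
  have "?W * ennpowr ?S (r - 1) \<le> A * ennpowr (emeasure lebesgue (cube_ball Q)) r"
    unfolding cube_ball_def by (rule Ar) simp
  also have "\<dots> \<le> A * ennpowr (ennreal C * ennreal v) r"
    using emeasure_cube_ball_le[OF Q(2)] r unfolding v C_def by (intro mult_left_mono ennpowr_mono) auto
  also have "\<dots> = A * (ennreal (C powr r) * ennreal (v powr r))"
    using C v r by (simp add: ennpowr_mult ennpowr_ennreal)
  finally have 1: "?W * ennpowr ?S (r - 1) \<le> A * (ennreal (C powr r) * ennreal (v powr r))" .
  have "ennpowr (stopping_level TYPE('a) k * ennreal v) r \<le> ennpowr (cube_integral g Q) r"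
    using level_cubes_gt[OF Q(1)] r unfolding v by (intro ennpowr_mono) auto
  then have 2: "ennpowr (stopping_level TYPE('a) k) r * ennreal (v powr r) \<le> ennpowr (cube_integral g Q) r"
    using v r by (simp add: ennpowr_mult ennpowr_ennreal)
  have e: "ennpowr (cube_integral g Q / ?S) r * ?S * ennpowr ?S (r - 1) = ennpowr (cube_integral g Q) r"
  proof -
    have "cube_integral g Q = cube_integral g Q / ?S * ?S"
      using S by (simp add: ennreal_divide_times less_top[symmetric])
    then have "ennpowr (cube_integral g Q) r = ennpowr (cube_integral g Q / ?S) r * ennpowr ?S r"
      using ennpowr_mult[of r "cube_integral g Q / ?S" ?S] r by simp
    also have "ennpowr ?S r = ?S * ennpowr ?S (r - 1)" using ennpowr_add[of 1 "r - 1" ?S] r by simp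
    finally show ?thesis by (simp add: mult.assoc)
  qed
  have "ennreal (v powr r) * ennpowr ?S (r - 1) * (ennpowr (stopping_level TYPE('a) k) r * ?W)
      = (ennpowr (stopping_level TYPE('a) k) r * ennreal (v powr r)) * (?W * ennpowr ?S (r - 1))"
    by (simp only: mult_ac)
  also have "\<dots> \<le> ennpowr (cube_integral g Q) r * (A * (ennreal (C powr r) * ennreal (v powr r)))"
    by (intro mult_mono 1 2) auto
  also have "\<dots> = ennreal (v powr r) * ennpowr ?S (r - 1) *
      (A * ennreal (C powr r) * (ennpowr (cube_integral g Q / ?S) r * ?S))"
    unfolding e[symmetric] by (simp only: mult_ac)
  finally show ?thesis
    unfolding C_def using S v(2)
    by (subst (asm) ennreal_mult_le_mult_iff) (auto simp: ennpowr_ennreal ennreal_mult_eq_top_iff)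
qed

text \<open>Every positive average is comparable to some stopping level, and x then lies in the ball
  of a cube of that level, so the sum \<open>\<Phi>\<close> over all these balls is a majorant. The
  exponent is the A_r index itself, where the interpolation constant would be infinite.\<close>

lemma strong_type:
  assumes g [measurable]: "g \<in> borel_measurable lebesgue" and fin: "(\<integral>\<^sup>+x. g x \<partial>lebesgue) < \<infinity>"
  shows "\<exists>\<Phi>\<in>borel_measurable lebesgue. (\<forall>x t. 0 < t \<longrightarrow> ennpowr (average (ball x t) g) r \<le> \<Phi> x) \<and>
    (\<integral>\<^sup>+x. \<Phi> x * w x \<partial>lebesgue)
      \<le> ennreal ((4 * 2 ^ (DIM('a) + 1) * cover_const TYPE('a) * ball_const TYPE('a)) powr r
          * 2 * ball_const TYPE('a) * s * (2 + 2 / (r - 1))) * A * (\<integral>\<^sup>+x. ennpowr (g x) r * w x \<partial>lebesgue)"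
proof -
  define C where "C = cover_const TYPE('a)"
  have C: "1 \<le> C" unfolding C_def by (rule cover_const_ge_1)
  define b :: real where "b = 2 ^ (DIM('a) + 1)"
  have b: "1 < b" unfolding b_def using one_less_power[of "2::real" "DIM('a) + 1"] by simp
  define D where "D = ball_const TYPE('a)"
  have D: "1 \<le> D" unfolding D_def by (rule ball_const_ge_1)
  define c where "c k = ennreal ((b * C) powr r) * ennpowr (stopping_level TYPE('a) k) r" for k
  let ?X = "stopping_family g"
  let ?e = "\<lambda>Q. ennpowr (cube_integral g Q / mass \<sigma> (cube_ball Q)) r * mass \<sigma> (cube_ball Q)"
  define \<Phi> where "\<Phi> x = (\<integral>\<^sup>+i. c (fst i) * indicator (cube_ball (snd i)) x \<partial>count_space ?X)" for x
  have \<Phi>: "\<Phi> \<in> borel_measurable lebesgue"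
    unfolding \<Phi>_def by (intro nn_integral_count_space_measurable countable_stopping_family) auto
  have maj: "ennpowr (average (ball x t) g) r \<le> \<Phi> x" if t: "0 < t" for x t
  proof (cases "average (ball x t) g = 0")
    case True
    then show ?thesis using r by simp
  next
    case False
    then obtain k where k: "ennreal (C * b powr real_of_int k) < average (ball x t) g"
        "average (ball x t) g \<le> ennreal (b * C * b powr real_of_int k)"
      using level_exists[of "average (ball x t) g" C b] average_finite[OF fin t] C b
      by (auto simp: zero_less_iff_neq_zero)
    have sl: "stopping_level TYPE('a) k = ennreal (b powr real_of_int k)" by (simp add: stopping_level_def b_def)
    have "ennreal (cover_const TYPE('a)) * stopping_level TYPE('a) k < average (ball x t) g"
      using k(1) C unfolding sl by (simp add: ennreal_mult C_def)
    then obtain Q where Q: "Q \<in> level_cubes g (stopping_level TYPE('a) k)" "x \<in> cube_ball Q"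
      using level_cubes_cover[OF g fin stopping_level_pos t] by blast
    then have X: "(k, Q) \<in> ?X" by (simp add: stopping_family_def stopping_cubes_def)
    have "ennpowr (average (ball x t) g) r \<le> ennpowr (ennreal (b * C * b powr real_of_int k)) r"
      using k r by (intro ennpowr_mono) auto
    also have "\<dots> = c (fst (k, Q)) * indicator (cube_ball (snd (k, Q))) x"
    proof -
      have "ennpowr (ennreal (b * C * b powr real_of_int k)) r = ennreal ((b * C * b powr real_of_int k) powr r)"
        using b C by (intro ennpowr_ennreal) auto
      also have "\<dots> = ennreal ((b * C) powr r) * ennreal ((b powr real_of_int k) powr r)"
        using b C by (subst powr_mult) (auto simp: ennreal_mult)
      finally show ?thesis using b Q by (simp add: c_def sl ennpowr_ennreal)
    qed
    also have "\<dots> \<le> \<Phi> x" unfolding \<Phi>_def by (rule nn_integral_ge_point[OF X])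
    finally show ?thesis .
  qed
  have "(\<integral>\<^sup>+x. \<Phi> x * w x \<partial>lebesgue) = (\<integral>\<^sup>+x. \<integral>\<^sup>+i. c (fst i) * (w x * indicator (cube_ball (snd i)) x) \<partial>count_space ?X \<partial>lebesgue)"
    unfolding \<Phi>_def by (intro nn_integral_cong) (simp add: nn_integral_multc[symmetric] mult.assoc mult.commute[of "w _"])
  also have "\<dots> = (\<integral>\<^sup>+i. c (fst i) * mass w (cube_ball (snd i)) \<partial>count_space ?X)"
    using countable_stopping_family
    by (subst nn_integral_count_space_nn_integral) (auto simp: nn_integral_cmult mass_def)
  also have "\<dots> \<le> (\<integral>\<^sup>+i. ennreal ((b * C) powr r) * (A * ennreal (D powr r)) * ?e (snd i) \<partial>count_space ?X)"
  proof (rule nn_integral_mono)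
    fix i assume "i \<in> space (count_space ?X)"
    then have "snd i \<in> stopping_cubes g (fst i)" by (auto simp: stopping_family_def)
    from mult_left_mono[OF stopping_cube_mass[OF this], of "ennreal ((b * C) powr r)"]
    show "c (fst i) * mass w (cube_ball (snd i)) \<le> ennreal ((b * C) powr r) * (A * ennreal (D powr r)) * ?e (snd i)"
      by (simp add: c_def D_def mult.assoc)
  qed
  also have "\<dots> = ennreal ((b * C) powr r) * (A * ennreal (D powr r)) * (\<integral>\<^sup>+(k, Q). ?e Q \<partial>count_space ?X)"
    unfolding case_prod_beta by (rule nn_integral_cmult) simp
  also have "\<dots> \<le> ennreal ((b * C) powr r) * (A * ennreal (D powr r)) *
     (ennreal (4 powr r * 2 * D * s * (2 + 2 / (r - 1))) * (\<integral>\<^sup>+x. ennpowr (g x) r * w x \<partial>lebesgue))"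
    unfolding D_def by (intro mult_left_mono carleson_embedding g fin) auto
  also have "\<dots> = ennreal ((4 * b * C * D) powr r * 2 * D * s * (2 + 2 / (r - 1))) * A * (\<integral>\<^sup>+x. ennpowr (g x) r * w x \<partial>lebesgue)"
  proof -
    define Y where "Y = 4 powr r * 2 * D * s * (2 + 2 / (r - 1))"
    have Y: "0 \<le> Y" using D s r by (simp add: Y_def)
    have "(4 * b * C * D) powr r * 2 * D * s * (2 + 2 / (r - 1)) = (b * C) powr r * D powr r * Y"
      using b C D by (simp add: Y_def powr_mult mult_ac)
    then have "ennreal ((4 * b * C * D) powr r * 2 * D * s * (2 + 2 / (r - 1)))
       = ennreal ((b * C) powr r) * ennreal (D powr r) * ennreal Y"
      using Y by (simp add: ennreal_mult)
    then have "ennreal ((4 * b * C * D) powr r * 2 * D * s * (2 + 2 / (r - 1)))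
       = ennreal ((b * C) powr r) * ennreal (D powr r) * ennreal (4 powr r * 2 * D * s * (2 + 2 / (r - 1)))"
      unfolding Y_def .
    then show ?thesis by (simp only: mult_ac)
  qed
  finally show ?thesis using \<Phi> maj unfolding C_def D_def b_def by blast
qed

end

section \<open>The maximal theorem\<close>

lemma set_Jensen:
  fixes g :: "'a \<Rightarrow> ennreal"
  assumes [measurable]: "g \<in> borel_measurable M" "E \<in> sets M" and q: "1 \<le> q" and fin: "emeasure M E < \<infinity>"
  shows "ennpowr (\<integral>\<^sup>+x\<in>E. g x \<partial>M) q \<le> (\<integral>\<^sup>+x\<in>E. ennpowr (g x) q \<partial>M) * ennpowr (emeasure M E) (q - 1)"
proof -
  let ?N = "density M (indicator E)"
  have N: "emeasure ?N (space M) = emeasure M E"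
    by (simp add: emeasure_density)
  have I: "(\<integral>\<^sup>+x. f x \<partial>?N) = (\<integral>\<^sup>+x\<in>E. f x \<partial>M)" if "f \<in> borel_measurable M" for f :: "'a \<Rightarrow> ennreal"
    using that by (subst nn_integral_density) (auto simp: mult.commute)
  show ?thesis using Jensen_nn_integral[of g ?N q] q fin by (simp add: N I)
qed

text \<open>Jensen is used for the exponent p / r only; the power r stays outside, to be treated by
  an inequality with the weight.\<close>

lemma set_Jensen_iterated:
  fixes g :: "'a \<Rightarrow> ennreal"
  assumes "g \<in> borel_measurable M" "E \<in> sets M" and r: "1 \<le> r" "r \<le> p" and fin: "emeasure M E < \<infinity>"
  shows "ennpowr (\<integral>\<^sup>+x\<in>E. g x \<partial>M) p
    \<le> ennpowr (\<integral>\<^sup>+x\<in>E. ennpowr (g x) (p / r) \<partial>M) r * ennpowr (emeasure M E) (p - r)"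
proof (cases "r = p")
  case True
  with r show ?thesis by simp
next
  case False
  with r have "r < p" by simp
  have "ennpowr (\<integral>\<^sup>+x\<in>E. g x \<partial>M) p = ennpowr (ennpowr (\<integral>\<^sup>+x\<in>E. g x \<partial>M) (p / r)) r"
    using r by (simp add: ennpowr_ennpowr)
  also have "\<dots> \<le> ennpowr ((\<integral>\<^sup>+x\<in>E. ennpowr (g x) (p / r) \<partial>M) * ennpowr (emeasure M E) (p / r - 1)) r"
    using assms by (intro ennpowr_mono set_Jensen) auto
  also have "\<dots> = ennpowr (\<integral>\<^sup>+x\<in>E. ennpowr (g x) (p / r) \<partial>M) r * ennpowr (emeasure M E) (p - r)"
  proof -
    have "(p / r - 1) * r = p - r" using r by (simp add: field_simps)
    moreover have "0 < p / r - 1" using r \<open>r < p\<close> by simp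
    ultimately show ?thesis using r by (simp add: ennpowr_mult ennpowr_ennpowr)
  qed
  finally show ?thesis .
qed

lemma average_powr_times:
  assumes "0 < t" "0 < p"
  shows "ennpowr (average (ball x t) g) p * ennpowr (emeasure lebesgue (ball x t)) p
    = ennpowr (\<integral>\<^sup>+y\<in>ball x t. g y \<partial>lebesgue) p"
proof -
  let ?V = "emeasure lebesgue (ball x t)"
  have "?V / ?V = 1"
    using emeasure_ball_pos[OF assms(1), of x] emeasure_ball_finite[of x t] by (intro ennreal_divide_self) auto
  then have "average (ball x t) g * ?V = (\<integral>\<^sup>+y\<in>ball x t. g y \<partial>lebesgue)"
    unfolding average_def ennreal_divide_times by simp
  then show ?thesis using assms(2) ennpowr_mult[of p "average (ball x t) g" ?V] by simp
qed

lemma emeasure_ball_real: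
  assumes "0 < t"
  obtains v where "0 < v" "emeasure lebesgue (ball x t :: 'a::euclidean_space set) = ennreal v"
  using assms emeasure_ball_pos[of t x] emeasure_ball_finite[of x t]
  by (cases "emeasure lborel (ball x t)") auto

lemma average_Jensen:
  assumes [measurable]: "g \<in> borel_measurable lebesgue" and t: "0 < t" and q: "1 \<le> q"
  shows "ennpowr (average (ball x t) g) q \<le> average (ball x t) (\<lambda>y. ennpowr (g y) q)"
proof -
  obtain v where v: "0 < v" "emeasure lebesgue (ball x t) = ennreal v"
    using emeasure_ball_real[OF t] by blast
  let ?J = "\<integral>\<^sup>+y\<in>ball x t. ennpowr (g y) q \<partial>lebesgue"
  have "ennpowr (average (ball x t) g) q * ennreal (v powr q) \<le> ?J * ennreal (v powr (q - 1))"
    using average_powr_times[OF t, of q x g] set_Jensen[of g lebesgue "ball x t" q] v q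
    by (simp add: ennpowr_ennreal)
  also have "?J = average (ball x t) (\<lambda>y. ennpowr (g y) q) * ennreal v"
    using average_powr_times[OF t, of 1 x "\<lambda>y. ennpowr (g y) q"] v by simp
  also have "\<dots> * ennreal (v powr (q - 1)) = average (ball x t) (\<lambda>y. ennpowr (g y) q) * ennreal (v powr q)"
    using v by (simp add: mult.assoc powr_diff flip: ennreal_mult)
  finally show ?thesis
    using v by (simp add: mult.commute[of _ "ennreal _"] ennreal_mult_le_mult_iff)
qed

lemma ball_halving:
  assumes "0 < R"
  shows "emeasure lebesgue (ball x R :: 'a::euclidean_space set)
    = ennreal (2 powr (real j * DIM('a))) * emeasure lebesgue (ball x (R / 2 ^ j))"
proof -
  have "(2 powr (real j * DIM('a))) * (R / 2 ^ j) ^ DIM('a) = R ^ DIM('a)"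
    by (simp add: powr_realpow[symmetric] powr_powr[symmetric] power_divide)
  then have "unit_ball_vol DIM('a) * R ^ DIM('a) = 2 powr (real j * DIM('a)) * (unit_ball_vol DIM('a) * (R / 2 ^ j) ^ DIM('a))"
    by (metis mult.left_commute)
  then show ?thesis using assms
    by (simp only: emeasure_lebesgue_ball less_imp_le divide_pos_pos zero_less_power zero_less_numeral)
      (simp add: ennreal_mult)
qed

text \<open>Jensen on the small ball, then \<open>Ar_bound\<close> for g^p with the small ball as a
  subset of the large one. The ratio of the volumes appears to the first power, that is, r0 = 1 in
  \<open>riesz_inequality\<close>; this leads to p_star.\<close>

lemma far_estimate_A1:
  fixes w :: "'a::euclidean_space \<Rightarrow> ennreal"
  assumes Ar: "Ar_bound 1 A w" and p: "1 < p" and R: "0 < R"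
    and [measurable]: "g \<in> borel_measurable lebesgue" "w \<in> borel_measurable lebesgue"
  shows "ennpowr (average (ball x (R / 2 ^ j)) g) p * mass w (ball x R)
    \<le> A * ennreal (2 powr (real j * DIM('a))) * (\<integral>\<^sup>+x. ennpowr (g x) p * w x \<partial>lebesgue)"
proof -
  define t where "t = R / 2 ^ j"
  have t: "0 < t" "t \<le> R" using R by (auto simp: t_def divide_le_eq)
  obtain v where v: "0 < v" "emeasure lebesgue (ball x t) = ennreal v"
    using emeasure_ball_real[OF t(1)] by blast
  let ?J = "\<integral>\<^sup>+y\<in>ball x t. ennpowr (g y) p \<partial>lebesgue" and ?F = "\<integral>\<^sup>+x. ennpowr (g x) p * w x \<partial>lebesgue"
  have avg: "ennpowr (average (ball x t) g) p * ennreal (v powr p) = ennpowr (\<integral>\<^sup>+y\<in>ball x t. g y \<partial>lebesgue) p"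
    using average_powr_times[OF t(1), of p x g] ennpowr_ennreal[OF v(1), of p] v(2) p by simp
  have "ennreal (v powr p) * (ennpowr (average (ball x t) g) p * mass w (ball x R))
      = ennpowr (\<integral>\<^sup>+y\<in>ball x t. g y \<partial>lebesgue) p * mass w (ball x R)"
    using avg by (simp only: mult.assoc[symmetric] mult.commute[of _ "ennreal _"])
  also have "\<dots> \<le> ?J * ennreal (v powr (p - 1)) * mass w (ball x R)"
    using set_Jensen[of g lebesgue "ball x t" p] v p by (intro mult_right_mono) (auto simp: ennpowr_ennreal)
  also have "\<dots> = ennreal (v powr (p - 1)) * (ennpowr ?J 1 * mass w (ball x R))" by (simp add: mult_ac)
  also have "\<dots> \<le> ennreal (v powr (p - 1)) *
      (A * ennpowr (emeasure lebesgue (ball x R)) 1 * (\<integral>\<^sup>+y\<in>ball x t. ennpowr (ennpowr (g y) p) 1 * w y \<partial>lebesgue))"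
    using Ar[unfolded Ar_bound_def, rule_format, of R "ball x t" x "\<lambda>y. ennpowr (g y) p"] R t subset_ball[OF t(2), of x]
    by (intro mult_left_mono) (auto intro: subset_ball)
  also have "\<dots> \<le> ennreal (v powr (p - 1)) * (A * (ennreal (2 powr (real j * DIM('a))) * ennreal v) * ?F)"
  proof (intro mult_left_mono mult_mono)
    show "(\<integral>\<^sup>+y\<in>ball x t. ennpowr (ennpowr (g y) p) 1 * w y \<partial>lebesgue) \<le> ?F"
      by (intro nn_integral_mono) (auto split: split_indicator)
    show "ennpowr (emeasure lebesgue (ball x R)) 1 \<le> ennreal (2 powr (real j * DIM('a))) * ennreal v"
      using ball_halving[OF R, of x j] v unfolding t_def[symmetric] by simp
  qed auto
  also have "\<dots> = ennreal (v powr (p - 1)) * ennreal v * (A * ennreal (2 powr (real j * DIM('a))) * ?F)"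
    by (simp only: mult_ac)
  also have "ennreal (v powr (p - 1)) * ennreal v = ennreal (v powr p)"
    using v by (simp add: powr_diff flip: ennreal_mult)
  finally show ?thesis using v unfolding t_def by (subst (asm) ennreal_mult_le_mult_iff) auto
qed

text \<open>Dominates both routes to the maximal theorem. It is the base 4 times 2^(DIM + 1) times
  \<open>cover_const\<close> times \<open>ball_const\<close> of \<open>strong_type\<close>,
  multiplied by 8 \<open>ball_const\<close>: the factors of \<open>strong_type\<close> outside the
  power, absorbed because 8 D \<le> (8 D)^p.\<close>

definition max_const :: "'a::euclidean_space itself \<Rightarrow> real" where
  "max_const _ = 2 ^ (DIM('a) + 6) * cover_const TYPE('a) * (ball_const TYPE('a))\<^sup>2"

lemma max_const_ge_1: "1 \<le> max_const TYPE('a::euclidean_space)"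
proof -
  have "1 * 1 * 1\<^sup>2 \<le> max_const TYPE('a)"
    unfolding max_const_def using cover_const_ge_1[where 'a = 'a] ball_const_ge_1[where 'a = 'a]
    by (intro mult_mono power_mono one_le_power) auto
  then show ?thesis by simp
qed

text \<open>If p - r is at least (p - 1) / 2, the interpolation factor is at most 4 p'; the 4
  disappears into the p-th power.\<close>

lemma marcinkiewicz_const_le:
  fixes p r :: real
  assumes r: "1 \<le> r" "r < p" and pr: "(p - 1) / 2 \<le> p - r"
  shows "(4 * cover_const TYPE('a::euclidean_space)) powr p * ball_const TYPE('a) powr r * (2 + 2 / (p - r))
    \<le> max_const TYPE('a) powr p * (p / (p - 1))"
proof -
  define C where "C = cover_const TYPE('a)"
  define D where "D = ball_const TYPE('a)"
  have C: "1 \<le> C" and D: "1 \<le> D" by (simp_all add: C_def D_def cover_const_ge_1 ball_const_ge_1)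
  have "2 / (p - r) \<le> 2 / ((p - 1) / 2)" using r pr by (intro divide_left_mono) auto
  then have "2 + 2 / (p - r) \<le> 2 + 4 / (p - 1)" by simp
  also have "\<dots> \<le> 4 * (p / (p - 1))"
  proof -
    have "p / (p - 1) = 1 + 1 / (p - 1)" using r by (simp add: field_simps)
    then show ?thesis by simp
  qed
  finally have 1: "2 + 2 / (p - r) \<le> 4 * (p / (p - 1))" .
  have "D powr r \<le> D powr p" using D r by (intro powr_mono) auto
  then have "(4 * C) powr p * D powr r * (2 + 2 / (p - r)) \<le> (4 * C) powr p * D powr p * (4 * (p / (p - 1)))"
    using 1 r by (intro mult_mono) auto
  also have "\<dots> = (4 * C * D) powr p * 4 * (p / (p - 1))" using C D by (simp add: powr_mult)
  also have "\<dots> \<le> (4 * C * D) powr p * 4 powr p * (p / (p - 1))"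
  proof (intro mult_right_mono mult_left_mono)
    show "4 \<le> 4 powr p" using powr_mono[of 1 p 4] r by simp
  qed (use r in auto)
  also have "\<dots> = (16 * C * D) powr p * (p / (p - 1))" using C D by (simp add: powr_mult[symmetric] mult_ac)
  also have "\<dots> \<le> max_const TYPE('a) powr p * (p / (p - 1))"
  proof (intro mult_right_mono powr_mono2)
    have "16 * C * (D * 1) \<le> 2 ^ (DIM('a) + 6) * C * (D * D)"
    proof (intro mult_mono)
      have "(2::real) ^ 4 \<le> 2 ^ (DIM('a) + 6)" by (intro power_increasing) auto
      then show "(16::real) \<le> 2 ^ (DIM('a) + 6)" by simp
    qed (use C D in auto)
    then show "16 * C * D \<le> max_const TYPE('a)" by (simp add: max_const_def C_def D_def power2_eq_square)
  qed (use C D r in auto)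
  finally show ?thesis by (simp add: C_def D_def)
qed

lemma maximal_theorem_A1:
  fixes w :: "'a::euclidean_space \<Rightarrow> ennreal"
  assumes Ar: "Ar_bound 1 A w" and p: "1 < p"
    and g [measurable]: "g \<in> borel_measurable lebesgue" and [measurable]: "w \<in> borel_measurable lebesgue"
    and fin: "(\<integral>\<^sup>+x. g x \<partial>lebesgue) < \<infinity>"
  shows "\<exists>\<Phi>\<in>borel_measurable lebesgue. (\<forall>x t. 0 < t \<longrightarrow> ennpowr (average (ball x t) g) p \<le> \<Phi> x) \<and>
    (\<integral>\<^sup>+x. \<Phi> x * w x \<partial>lebesgue)
      \<le> ennreal (max_const TYPE('a) powr p * (p / (p - 1))) * A * (\<integral>\<^sup>+x. ennpowr (g x) p * w x \<partial>lebesgue)"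
proof -
  obtain \<Phi> where \<Phi>: "\<Phi> \<in> borel_measurable lebesgue" "\<forall>x t. 0 < t \<longrightarrow> ennpowr (average (ball x t) g) p \<le> \<Phi> x"
    and le: "(\<integral>\<^sup>+x. \<Phi> x * w x \<partial>lebesgue)
      \<le> ennreal ((4 * cover_const TYPE('a)) powr p * ball_const TYPE('a) powr 1 * (2 + 2 / (p - 1)))
          * A * (\<integral>\<^sup>+x. ennpowr (g x) p * w x \<partial>lebesgue)"
    using marcinkiewicz[OF Ar order_refl p g] fin by auto
  note le
  also have "\<dots> \<le> ennreal (max_const TYPE('a) powr p * (p / (p - 1))) * A * (\<integral>\<^sup>+x. ennpowr (g x) p * w x \<partial>lebesgue)"
    using p by (intro mult_right_mono ennreal_leI marcinkiewicz_const_le) auto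
  finally show ?thesis using \<Phi> by blast
qed

context dual_pair
begin

text \<open>Jensen for g / \<sigma> with respect to the measure of density \<sigma> on E, since (g /
  \<sigma>)^r \<sigma> = g^r w.\<close>

lemma Holder:
  assumes [measurable]: "g \<in> borel_measurable lebesgue" "E \<in> sets lebesgue" and fin: "mass \<sigma> E < \<infinity>"
  shows "ennpowr (\<integral>\<^sup>+x\<in>E. g x \<partial>lebesgue) r
    \<le> (\<integral>\<^sup>+x\<in>E. ennpowr (g x) r * w x \<partial>lebesgue) * ennpowr (mass \<sigma> E) (r - 1)"
proof -
  let ?N = "density lebesgue (\<lambda>x. \<sigma> x * indicator E x)"
  have N: "emeasure ?N (space ?N) = mass \<sigma> E"
    by (subst emeasure_density) (auto simp: mass_def)
  have I: "(\<integral>\<^sup>+x. f x \<partial>?N) = (\<integral>\<^sup>+x. \<sigma> x * indicator E x * f x \<partial>lebesgue)" if "f \<in> borel_measurable lebesgue" for f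
    using that by (intro nn_integral_density) auto
  have div: "g x = g x / \<sigma> x * \<sigma> x" if "0 < \<sigma> x \<and> \<sigma> x < \<infinity>" for x
  proof -
    have "\<sigma> x / \<sigma> x = 1" using that by (intro ennreal_divide_self) auto
    then show ?thesis by (simp add: ennreal_divide_times)
  qed
  have 1: "(\<integral>\<^sup>+x. g x / \<sigma> x \<partial>?N) = (\<integral>\<^sup>+x\<in>E. g x \<partial>lebesgue)"
  proof (rule trans[OF I], simp, rule nn_integral_cong_AE)
    show "AE x in lebesgue. \<sigma> x * indicator E x * (g x / \<sigma> x) = g x * indicator E x"
      using dual
    proof eventually_elim
      case (elim x)
      have "\<sigma> x * indicator E x * (g x / \<sigma> x) = (g x / \<sigma> x * \<sigma> x) * indicator E x" by (simp only: mult_ac)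
      then show ?case using div[of x] elim by simp
    qed
  qed
  have 2: "(\<integral>\<^sup>+x. ennpowr (g x / \<sigma> x) r \<partial>?N) = (\<integral>\<^sup>+x\<in>E. ennpowr (g x) r * w x \<partial>lebesgue)"
  proof (rule trans[OF I], simp, rule nn_integral_cong_AE)
    show "AE x in lebesgue. \<sigma> x * indicator E x * ennpowr (g x / \<sigma> x) r = ennpowr (g x) r * w x * indicator E x"
      using dual
    proof eventually_elim
      case (elim x)
      have "ennpowr (g x) r = ennpowr (g x / \<sigma> x) r * ennpowr (\<sigma> x) r"
        using ennpowr_mult[of r "g x / \<sigma> x" "\<sigma> x"] div[of x] elim r by simp
      also have "ennpowr (\<sigma> x) r = \<sigma> x * ennpowr (\<sigma> x) (r - 1)"
        using ennpowr_add[of 1 "r - 1" "\<sigma> x"] r by simp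
      finally have "ennpowr (g x) r * w x = ennpowr (g x / \<sigma> x) r * \<sigma> x * (w x * ennpowr (\<sigma> x) (r - 1))"
        by (simp only: mult_ac)
      then show ?case using elim by (simp add: mult_ac)
    qed
  qed
  show ?thesis
    using Jensen_nn_integral[of "\<lambda>x. g x / \<sigma> x" ?N r] r fin unfolding N 1 2 by simp
qed

lemma Ar_bound: "Ar_bound r A w"
  unfolding Ar_bound_def
proof (intro allI impI)
  fix z :: 'a and t E and g :: "'a \<Rightarrow> ennreal"
  assume t: "0 < t" and E: "E \<in> sets lebesgue" "E \<subseteq> ball z t" and g: "g \<in> borel_measurable lebesgue"
  let ?F = "\<integral>\<^sup>+x\<in>E. ennpowr (g x) r * w x \<partial>lebesgue"
  have sub: "mass \<sigma> E \<le> mass \<sigma> (ball z t)" by (rule mass_mono[OF E(2)])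
  have "ennpowr (\<integral>\<^sup>+x\<in>E. g x \<partial>lebesgue) r * mass w (ball z t) \<le> ?F * ennpowr (mass \<sigma> E) (r - 1) * mass w (ball z t)"
    using sub mass_finite[OF t, of z] by (intro mult_right_mono Holder g E) (auto intro: le_less_trans)
  also have "\<dots> \<le> ?F * ennpowr (mass \<sigma> (ball z t)) (r - 1) * mass w (ball z t)"
    using sub r by (intro mult_right_mono mult_left_mono ennpowr_mono) auto
  also have "\<dots> = ?F * (mass w (ball z t) * ennpowr (mass \<sigma> (ball z t)) (r - 1))" by (simp only: mult_ac)
  also have "\<dots> \<le> ?F * (A * ennpowr (emeasure lebesgue (ball z t)) r)"
    by (intro mult_left_mono Ar t) auto
  finally show "ennpowr (\<integral>\<^sup>+x\<in>E. g x \<partial>lebesgue) r * mass w (ball z t)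
      \<le> A * ennpowr (emeasure lebesgue (ball z t)) r * ?F"
    by (simp only: mult_ac)
qed

end

context dual_weights
begin

lemma maximal_theorem:
  assumes p: "r \<le> p"
    and g [measurable]: "g \<in> borel_measurable lebesgue"
    and fin: "(\<integral>\<^sup>+x. g x \<partial>lebesgue) < \<infinity>" "(\<integral>\<^sup>+x. ennpowr (g x) (p / r) \<partial>lebesgue) < \<infinity>"
  shows "\<exists>\<Phi>\<in>borel_measurable lebesgue. (\<forall>x t. 0 < t \<longrightarrow> ennpowr (average (ball x t) g) p \<le> \<Phi> x) \<and>
    (\<integral>\<^sup>+x. \<Phi> x * w x \<partial>lebesgue)
      \<le> ennreal (max_const TYPE('a) powr p * (p / (p - 1)) * s) * A * (\<integral>\<^sup>+x. ennpowr (g x) p * w x \<partial>lebesgue)"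
proof (cases "(p - 1) / 2 \<le> p - r")
  case True
  \<comment> \<open>Here r is far enough from p for interpolation to cost only a multiple of p'; the
    factor s \<ge> 1 is inserted to give both cases the same form.\<close>
  then have pr: "r < p" using r by simp
  obtain \<Phi> where \<Phi>: "\<Phi> \<in> borel_measurable lebesgue" "\<forall>x t. 0 < t \<longrightarrow> ennpowr (average (ball x t) g) p \<le> \<Phi> x"
    and le: "(\<integral>\<^sup>+x. \<Phi> x * w x \<partial>lebesgue)
      \<le> ennreal ((4 * cover_const TYPE('a)) powr p * ball_const TYPE('a) powr r * (2 + 2 / (p - r)))
          * A * (\<integral>\<^sup>+x. ennpowr (g x) p * w x \<partial>lebesgue)"
    using marcinkiewicz[OF Ar_bound _ pr g w_measurable fin(1)] r by auto
  note le
  also have "\<dots> \<le> ennreal (max_const TYPE('a) powr p * (p / (p - 1)) * s) * A * (\<integral>\<^sup>+x. ennpowr (g x) p * w x \<partial>lebesgue)"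
  proof (intro mult_right_mono ennreal_leI)
    have "(4 * cover_const TYPE('a)) powr p * ball_const TYPE('a) powr r * (2 + 2 / (p - r))
      \<le> max_const TYPE('a) powr p * (p / (p - 1)) * 1"
      using marcinkiewicz_const_le[OF _ pr True, where 'a = 'a] r by simp
    also have "\<dots> \<le> max_const TYPE('a) powr p * (p / (p - 1)) * s"
      using s r p by (intro mult_left_mono) auto
    finally show "(4 * cover_const TYPE('a)) powr p * ball_const TYPE('a) powr r * (2 + 2 / (p - r))
      \<le> max_const TYPE('a) powr p * (p / (p - 1)) * s" .
  qed auto
  finally show ?thesis using \<Phi> by blast
next
  case False
  \<comment> \<open>Now r - 1 > (p - 1) / 2, so the factor 2 / (r - 1) of \<open>strong_type\<close>
    is again at most a multiple of p'. As h^r = g^p, and the average of g to the power p / r is at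
    most the average of h, exponent r for h gives exponent p for g.\<close>
  define h where "h x = ennpowr (g x) (p / r)" for x
  have [measurable]: "h \<in> borel_measurable lebesgue" unfolding h_def by measurable
  have hr: "ennpowr (h x) r = ennpowr (g x) p" for x
    unfolding h_def using r p by (simp add: ennpowr_ennpowr)
  define C where "C = cover_const TYPE('a)"
  define D where "D = ball_const TYPE('a)"
  have C: "1 \<le> C" and D: "1 \<le> D" by (simp_all add: C_def D_def cover_const_ge_1 ball_const_ge_1)
  obtain \<Phi> where \<Phi>: "\<Phi> \<in> borel_measurable lebesgue" "\<forall>x t. 0 < t \<longrightarrow> ennpowr (average (ball x t) h) r \<le> \<Phi> x"
    and le: "(\<integral>\<^sup>+x. \<Phi> x * w x \<partial>lebesgue)
      \<le> ennreal ((4 * 2 ^ (DIM('a) + 1) * C * D) powr r * 2 * D * s * (2 + 2 / (r - 1)))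
          * A * (\<integral>\<^sup>+x. ennpowr (h x) r * w x \<partial>lebesgue)"
    using strong_type[of h] fin(2) unfolding C_def D_def h_def by auto
  note le
  also have "\<dots> \<le> ennreal (max_const TYPE('a) powr p * (p / (p - 1)) * s) * A * (\<integral>\<^sup>+x. ennpowr (h x) r * w x \<partial>lebesgue)"
  proof (intro mult_right_mono ennreal_leI)
    have "2 / (r - 1) \<le> 2 / ((p - 1) / 2)" using False r p by (intro divide_left_mono) auto
    then have "2 + 2 / (r - 1) \<le> 2 + 4 / (p - 1)" by simp
    also have "\<dots> \<le> 4 * (p / (p - 1))"
    proof -
      have "p / (p - 1) = 1 + 1 / (p - 1)" using r p by (simp add: field_simps)
      then show ?thesis by simp
    qed
    finally have 1: "2 + 2 / (r - 1) \<le> 4 * (p / (p - 1))" .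
    define K where "K = 4 * 2 ^ (DIM('a) + 1) * C * D"
    have "1 * 1 * 1 * 1 \<le> K" unfolding K_def using C D by (intro mult_mono one_le_power) auto
    then have K: "1 \<le> K" by simp
    have "K powr r * 2 * D * s * (2 + 2 / (r - 1)) \<le> K powr p * 2 * D * s * (4 * (p / (p - 1)))"
      using C D s r p 1 K by (intro mult_mono powr_mono) auto
    also have "\<dots> = K powr p * (8 * D) * ((p / (p - 1)) * s)" by (simp add: mult_ac)
    also have "\<dots> \<le> K powr p * (8 * D) powr p * ((p / (p - 1)) * s)"
    proof (intro mult_right_mono mult_left_mono)
      show "8 * D \<le> (8 * D) powr p" using powr_mono[of 1 p "8 * D"] r p D by simp
    qed (use r p s in auto)
    also have "K powr p * (8 * D) powr p = (K * (8 * D)) powr p" using K D by (simp add: powr_mult)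
    also have "K * (8 * D) = max_const TYPE('a)"
      by (simp add: K_def max_const_def C_def D_def power2_eq_square power_add)
    finally show "(4 * 2 ^ (DIM('a) + 1) * C * D) powr r * 2 * D * s * (2 + 2 / (r - 1))
      \<le> max_const TYPE('a) powr p * (p / (p - 1)) * s" by (simp add: K_def mult_ac)
  qed auto
  finally have "(\<integral>\<^sup>+x. \<Phi> x * w x \<partial>lebesgue)
    \<le> ennreal (max_const TYPE('a) powr p * (p / (p - 1)) * s) * A * (\<integral>\<^sup>+x. ennpowr (g x) p * w x \<partial>lebesgue)"
    unfolding hr .
  moreover have "ennpowr (average (ball x t) g) p \<le> \<Phi> x" if t: "0 < t" for x t
  proof -
    have "ennpowr (average (ball x t) g) p = ennpowr (ennpowr (average (ball x t) g) (p / r)) r"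
      using r p by (simp add: ennpowr_ennpowr)
    also have "\<dots> \<le> ennpowr (average (ball x t) h) r"
      unfolding h_def using r p t by (intro ennpowr_mono average_Jensen g) auto
    finally show ?thesis using \<Phi>(2) t by (meson order_trans)
  qed
  ultimately show ?thesis using \<Phi>(1) by blast
qed

text \<open>The exponent \<open>r - (r - 1) / (\<tau> s)\<close> is the one in the definition of \<open>q\<^sub>r\<close>. It comes directly
  from the decay of \<open>\<sigma>\<close> on concentric balls, without a reverse Hoelder inequality.\<close>

lemma far_estimate:
  assumes p: "r \<le> p" and R: "0 < R" and [measurable]: "g \<in> borel_measurable lebesgue"
  shows "ennpowr (average (ball x (R / 2 ^ j)) g) p * mass w (ball x R)
    \<le> ennreal (exp p) * A * ennreal (2 powr (real j * DIM('a) * (r - (r - 1) / (2 ^ (DIM('a) + 1) * s))))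
        * (\<integral>\<^sup>+x. ennpowr (g x) p * w x \<partial>lebesgue)"
proof -
  define t where "t = R / 2 ^ j"
  have t: "0 < t" "t \<le> R" using R by (auto simp: t_def divide_le_eq)
  obtain v where v: "0 < v" "emeasure lebesgue (ball x t) = ennreal v"
    using emeasure_ball_real[OF t(1)] by blast
  let ?G = "\<integral>\<^sup>+y\<in>ball x t. ennpowr (g y) p * w y \<partial>lebesgue" and ?F = "\<integral>\<^sup>+x. ennpowr (g x) p * w x \<partial>lebesgue"
  let ?J = "\<integral>\<^sup>+y\<in>ball x t. ennpowr (g y) (p / r) \<partial>lebesgue"
  let ?d = "exp (1 - j / (2 * s))" and ?E = "2 powr (real j * DIM('a))"
  have GF: "?G \<le> ?F" by (intro nn_integral_mono) (auto split: split_indicator)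
  have avg: "ennpowr (average (ball x t) g) p * ennreal (v powr p) = ennpowr (\<integral>\<^sup>+y\<in>ball x t. g y \<partial>lebesgue) p"
    using average_powr_times[OF t(1), of p x g] ennpowr_ennreal[OF v(1), of p] v(2) p r by simp
  have "ennreal (v powr p) * (ennpowr (average (ball x t) g) p * mass w (ball x R))
      = ennpowr (\<integral>\<^sup>+y\<in>ball x t. g y \<partial>lebesgue) p * mass w (ball x R)"
    using avg by (simp only: mult.assoc[symmetric] mult.commute[of _ "ennreal _"])
  also have "\<dots> \<le> ennpowr ?J r * ennreal (v powr (p - r)) * mass w (ball x R)"
    using set_Jensen_iterated[of g lebesgue "ball x t" r p] v p r by (intro mult_right_mono) (auto simp: ennpowr_ennreal)
  also have "\<dots> \<le> (?G * ennpowr (mass \<sigma> (ball x t)) (r - 1)) * ennreal (v powr (p - r)) * mass w (ball x R)"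
    using Holder[of "\<lambda>y. ennpowr (g y) (p / r)" "ball x t"] mass_finite[OF t(1), of x] r p
    by (intro mult_right_mono) (auto simp: ennpowr_ennpowr)
  also have "\<dots> \<le> (?F * ennpowr (ennreal ?d * mass \<sigma> (ball x R)) (r - 1)) * ennreal (v powr (p - r)) * mass w (ball x R)"
    using mass_decay[OF R, of x j] r unfolding t_def[symmetric]
    by (intro mult_right_mono mult_mono GF ennpowr_mono) auto
  also have "\<dots> = ?F * ennreal (?d powr (r - 1)) * ennreal (v powr (p - r)) * (mass w (ball x R) * ennpowr (mass \<sigma> (ball x R)) (r - 1))"
    using r by (simp add: ennpowr_mult ennpowr_ennreal mult_ac)
  also have "\<dots> \<le> ?F * ennreal (?d powr (r - 1)) * ennreal (v powr (p - r)) * (A * ennpowr (emeasure lebesgue (ball x R)) r)"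
    by (intro mult_left_mono Ar R) auto
  also have "ennpowr (emeasure lebesgue (ball x R)) r = ennreal (?E powr r) * ennreal (v powr r)"
    unfolding ball_halving[OF R, of x j] t_def[symmetric] v(2) using v r by (simp add: ennpowr_mult ennpowr_ennreal)
  also have "?F * ennreal (?d powr (r - 1)) * ennreal (v powr (p - r)) * (A * (ennreal (?E powr r) * ennreal (v powr r)))
     = (ennreal (v powr (p - r)) * ennreal (v powr r)) * (ennreal (?d powr (r - 1)) * ennreal (?E powr r) * A * ?F)"
    by (simp only: mult_ac)
  also have "ennreal (v powr (p - r)) * ennreal (v powr r) = ennreal (v powr p)"
    using v by (simp add: powr_diff flip: ennreal_mult)
  also have "ennreal (?d powr (r - 1)) * ennreal (?E powr r) = ennreal (?d powr (r - 1) * ?E powr r)"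
    by (simp add: ennreal_mult)
  finally have *: "ennpowr (average (ball x t) g) p * mass w (ball x R) \<le> ennreal (?d powr (r - 1) * ?E powr r) * A * ?F"
    using v by (subst (asm) ennreal_mult_le_mult_iff) auto
  define \<tau> :: real where "\<tau> = 2 ^ (DIM('a) + 1)"
  \<comment> \<open>The decay exp (- j (r - 1) / (2 s)) is at least as strong as 2^(- j n (r - 1) /
    (\<tau> s)), because n ln 2 \<le> 2^n = \<tau> / 2: this is how \<tau> = 2^(n + 1) arises. The
    leading factor e of \<open>mass_decay\<close> contributes exp (r - 1) \<le> exp p.\<close>
  have num: "?d powr (r - 1) * ?E powr r \<le> exp p * 2 powr (real j * DIM('a) * (r - (r - 1) / (\<tau> * s)))"
  proof -
    have \<tau>: "0 < \<tau>" by (simp add: \<tau>_def)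
    have "ln 2 * real DIM('a) \<le> 1 * 2 ^ DIM('a)"
      using ln_2_less_1 of_nat_less_two_power[of "DIM('a)"] by (intro mult_mono) (auto simp: less_imp_le)
    then have "ln 2 * real DIM('a) / \<tau> \<le> 1 / 2" using \<tau> by (simp add: \<tau>_def field_simps)
    then have "(real j * (r - 1) / s) * (ln 2 * real DIM('a) / \<tau>) \<le> (real j * (r - 1) / s) * (1 / 2)"
      using r s by (intro mult_left_mono) auto
    then have a: "ln 2 * (real j * DIM('a) * ((r - 1) / (\<tau> * s))) \<le> j / (2 * s) * (r - 1)"
      by (simp add: field_simps)
    have "?d powr (r - 1) * ?E powr r = exp ((1 - j / (2 * s)) * (r - 1) + ln 2 * (real j * DIM('a) * r))"
      by (simp add: powr_def exp_add mult_ac)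
    also have "\<dots> \<le> exp (p + ln 2 * (real j * DIM('a) * (r - (r - 1) / (\<tau> * s))))"
      using a p by (simp add: left_diff_distrib right_diff_distrib)
    also have "\<dots> = exp p * 2 powr (real j * DIM('a) * (r - (r - 1) / (\<tau> * s)))"
      by (simp add: powr_def exp_add mult_ac)
    finally show ?thesis .
  qed
  note *
  also have "ennreal (?d powr (r - 1) * ?E powr r) * A * ?F
     \<le> ennreal (exp p * 2 powr (real j * DIM('a) * (r - (r - 1) / (\<tau> * s)))) * A * ?F"
    using num by (intro mult_right_mono ennreal_leI) auto
  finally show ?thesis unfolding t_def \<tau>_def by (simp add: ennreal_mult mult_ac)
qed

end

section \<open>Hedberg's inequality\<close>

lemma suminf_int_le:
  fixes f :: "int \<Rightarrow> ennreal"
  shows "(\<Sum>j. f (int j)) \<le> (\<integral>\<^sup>+k. f k \<partial>count_space UNIV)" "(\<Sum>j. f (- int j)) \<le> (\<integral>\<^sup>+k. f k \<partial>count_space UNIV)"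
proof -
  have *: "(\<Sum>j. h (- int j)) \<le> (\<integral>\<^sup>+k. h k \<partial>count_space UNIV)" for h :: "int \<Rightarrow> ennreal"
  proof -
    have "(\<Sum>j. h (- int j)) = (\<integral>\<^sup>+k. h k * indicator {..0} k \<partial>count_space UNIV)"
      using nn_integral_int_shift[of 0 h] nn_integral_count_space_subset[of "{..0}" UNIV h] by simp
    also have "\<dots> \<le> (\<integral>\<^sup>+k. h k \<partial>count_space UNIV)"
      by (intro nn_integral_mono) (auto split: split_indicator)
    finally show ?thesis .
  qed
  show "(\<Sum>j. f (- int j)) \<le> (\<integral>\<^sup>+k. f k \<partial>count_space UNIV)" by (rule *)
  have "bij_betw uminus (UNIV :: int set) UNIV" by (rule bij_betw_byWitness[where f' = uminus]) auto
  from nn_integral_bij_count_space[OF this, of f] *[of "\<lambda>k. f (- k)"]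
  show "(\<Sum>j. f (int j)) \<le> (\<integral>\<^sup>+k. f k \<partial>count_space UNIV)" by simp
qed

text \<open>The two bounds cross where 2^j = y. Below y the terms K 2^(j (\<beta> - \<alpha>)) grow,
  above it the terms M 2^(-j \<alpha>) decay, so each geometric sum is controlled by its value at
  the crossing; there both equal M^(1 - \<alpha>/\<beta>) K^(\<alpha>/\<beta>).\<close>

lemma hedberg_sum:
  fixes \<alpha> \<beta> M K :: real
  assumes \<alpha>: "0 < \<alpha>" "\<alpha> < \<beta>" and M: "0 < M" and K: "0 < K"
  shows "(\<Sum>j. ennreal (2 powr (- (real j * \<alpha>))) * min (ennreal M) (ennreal (K * 2 powr (real j * \<beta>))))
    \<le> ennreal (M powr (1 - \<alpha> / \<beta>) * K powr (\<alpha> / \<beta>) * (2 + 2 / (\<beta> - \<alpha>) + 2 powr \<alpha> * (2 + 2 / \<alpha>)))"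
proof -
  define y where "y = (M / K) powr (1 / \<beta>)"
  have y: "0 < y" using M K by (simp add: y_def)
  define f1 where "f1 k = ennreal (2 powr (real_of_int k * (\<beta> - \<alpha>))) * indicator {k. ennreal (2 powr real_of_int k) < ennreal y} k" for k
  \<comment> \<open>Used at the index -j: 2^j \<ge> y means 2^(-j) \<le> 1 / y, and the threshold 2
    / y makes this strict at the cost of a factor 2^\<alpha>.\<close>
  define f2 where "f2 k = ennreal (2 powr (real_of_int k * \<alpha>)) * indicator {k. ennreal (2 powr real_of_int k) < ennreal (2 / y)} k" for k
  have "(\<Sum>j. ennreal (2 powr (- (real j * \<alpha>))) * min (ennreal M) (ennreal (K * 2 powr (real j * \<beta>))))
      \<le> (\<Sum>j. ennreal K * f1 (int j) + ennreal M * f2 (- int j))"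
  proof (intro suminf_le)
    fix j
    let ?l = "ennreal (2 powr (- (real j * \<alpha>))) * min (ennreal M) (ennreal (K * 2 powr (real j * \<beta>)))"
    show "?l \<le> ennreal K * f1 (int j) + ennreal M * f2 (- int j)"
    proof (cases "2 powr real j < y")
      case True
      have "?l \<le> ennreal (2 powr (- (real j * \<alpha>))) * ennreal (K * 2 powr (real j * \<beta>))"
        by (intro mult_left_mono) auto
      also have "\<dots> = ennreal (K * (2 powr (- (real j * \<alpha>)) * 2 powr (real j * \<beta>)))"
        using K by (simp add: mult_ac flip: ennreal_mult)
      also have "2 powr (- (real j * \<alpha>)) * 2 powr (real j * \<beta>) = 2 powr (real j * (\<beta> - \<alpha>))"
        by (simp add: powr_add[symmetric] algebra_simps)
      also have "ennreal (K * 2 powr (real j * (\<beta> - \<alpha>))) = ennreal K * f1 (int j)"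
        using True K y by (simp add: f1_def ennreal_mult ennreal_less_iff)
      finally show ?thesis by (rule order_trans) simp
    next
      case False
      then have "2 powr (- real j) < 2 / y" using y by (simp add: powr_minus field_simps)
      then have "ennreal M * f2 (- int j) = ennreal M * ennreal (2 powr (- (real j * \<alpha>)))"
        using y by (simp add: f2_def ennreal_less_iff)
      moreover have "?l \<le> ennreal (2 powr (- (real j * \<alpha>))) * ennreal M" by (intro mult_left_mono) auto
      ultimately have "?l \<le> ennreal M * f2 (- int j)" by (simp add: mult.commute)
      then show ?thesis by (rule order_trans) simp
    qed
  qed auto
  also have "\<dots> = ennreal K * (\<Sum>j. f1 (int j)) + ennreal M * (\<Sum>j. f2 (- int j))"
    by (simp add: suminf_add[symmetric])
  also have "\<dots> \<le> ennreal K * (ennreal (2 + 2 / (\<beta> - \<alpha>)) * ennpowr (ennreal y) (\<beta> - \<alpha>))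
      + ennreal M * (ennreal (2 + 2 / \<alpha>) * ennpowr (ennreal (2 / y)) \<alpha>)"
    using \<alpha> unfolding f1_def f2_def
    by (intro add_mono mult_left_mono order_trans[OF suminf_int_le(1)] order_trans[OF suminf_int_le(2)] dyadic_level_sum_le) auto
  also have "\<dots> = ennreal (K * ((2 + 2 / (\<beta> - \<alpha>)) * y powr (\<beta> - \<alpha>)) + M * ((2 + 2 / \<alpha>) * (2 / y) powr \<alpha>))"
  proof -
    have "0 \<le> 2 + 2 / (\<beta> - \<alpha>)" "0 \<le> 2 + 2 / \<alpha>" using \<alpha> by auto
    then show ?thesis using \<alpha> M K y
      by (simp only: ennpowr_ennreal divide_pos_pos zero_less_numeral ennreal_mult ennreal_plus mult_nonneg_nonneg powr_ge_zero less_imp_le)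
  qed
  also have "K * ((2 + 2 / (\<beta> - \<alpha>)) * y powr (\<beta> - \<alpha>)) + M * ((2 + 2 / \<alpha>) * (2 / y) powr \<alpha>)
     = M powr (1 - \<alpha> / \<beta>) * K powr (\<alpha> / \<beta>) * (2 + 2 / (\<beta> - \<alpha>) + 2 powr \<alpha> * (2 + 2 / \<alpha>))"
  proof -
    have "y powr (\<beta> - \<alpha>) = (M / K) powr (1 - \<alpha> / \<beta>)"
      using \<alpha> by (simp add: y_def powr_powr diff_divide_distrib)
    then have 1: "K * y powr (\<beta> - \<alpha>) = M powr (1 - \<alpha> / \<beta>) * K powr (\<alpha> / \<beta>)"
      using M K by (simp add: powr_divide powr_diff)
    have "(2 / y) powr \<alpha> = 2 powr \<alpha> / y powr \<alpha>" using y by (simp add: powr_divide)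
    also have "y powr \<alpha> = (M / K) powr (\<alpha> / \<beta>)" by (simp add: y_def powr_powr)
    also have "(M / K) powr (\<alpha> / \<beta>) = M powr (\<alpha> / \<beta>) / K powr (\<alpha> / \<beta>)" using M K by (simp add: powr_divide)
    finally have 2: "M * (2 / y) powr \<alpha> = 2 powr \<alpha> * (M powr (1 - \<alpha> / \<beta>) * K powr (\<alpha> / \<beta>))"
      using M K by (simp add: powr_diff)
    have "K * ((2 + 2 / (\<beta> - \<alpha>)) * y powr (\<beta> - \<alpha>)) + M * ((2 + 2 / \<alpha>) * (2 / y) powr \<alpha>)
      = (2 + 2 / (\<beta> - \<alpha>)) * (K * y powr (\<beta> - \<alpha>)) + (2 + 2 / \<alpha>) * (M * (2 / y) powr \<alpha>)"
      by (simp only: mult_ac)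
    also have "\<dots> = M powr (1 - \<alpha> / \<beta>) * K powr (\<alpha> / \<beta>) * (2 + 2 / (\<beta> - \<alpha>) + 2 powr \<alpha> * (2 + 2 / \<alpha>))"
      unfolding 1 2 by (simp only: distrib_left mult_ac)
    finally show ?thesis .
  qed
  finally show ?thesis .
qed

section \<open>The potential as a sum of averages over shrinking balls\<close>

definition pos_potential :: "real \<Rightarrow> ('a::euclidean_space \<Rightarrow> real) \<Rightarrow> 'a \<Rightarrow> ennreal" where
  "pos_potential \<alpha> f x = (\<integral>\<^sup>+y. ennreal (\<bar>f y\<bar> / norm (x - y) powr (real DIM('a) - \<alpha>)) \<partial>lebesgue)"

text \<open>The triangle inequality for the positive and negative parts. It survives divergence: if
  a part is infinite, so is the right side, whatever value the difference takes.\<close>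

lemma riesz_potential_le:
  fixes f :: "'a::euclidean_space \<Rightarrow> real"
  assumes [measurable]: "f \<in> borel_measurable lebesgue"
  shows "e2ennreal \<bar>riesz_potential \<alpha> f x\<bar> \<le> pos_potential \<alpha> f x"
proof -
  define h where "h y = f y / norm (x - y) powr (real DIM('a) - \<alpha>)" for y
  have [measurable]: "(\<lambda>y. norm (x - y)) \<in> borel_measurable lebesgue"
    by (rule measurable_completion) measurable
  have [measurable]: "h \<in> borel_measurable lebesgue" unfolding h_def by measurable
  let ?a = "\<integral>\<^sup>+y. ennreal (h y) \<partial>lebesgue" and ?b = "\<integral>\<^sup>+y. ennreal (- h y) \<partial>lebesgue"
  have "\<bar>riesz_potential \<alpha> f x\<bar> = \<bar>enn2ereal ?a - enn2ereal ?b\<bar>"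
    by (simp add: riesz_potential_def ext_integral_def h_def)
  also have "\<dots> \<le> enn2ereal (?a + ?b)"
    unfolding plus_ennreal.rep_eq
    by (cases "enn2ereal ?a"; cases "enn2ereal ?b") (use enn2ereal_nonneg[of ?a] enn2ereal_nonneg[of ?b] in auto)
  finally have "e2ennreal \<bar>riesz_potential \<alpha> f x\<bar> \<le> e2ennreal (enn2ereal (?a + ?b))" by (rule e2ennreal_mono)
  also have "\<dots> = (\<integral>\<^sup>+y. ennreal (h y) + ennreal (- h y) \<partial>lebesgue)"
    by (subst nn_integral_add) auto
  also have "\<dots> = pos_potential \<alpha> f x"
    unfolding pos_potential_def
  proof (intro nn_integral_cong)
    fix y
    have "ennreal (h y) + ennreal (- h y) = ennreal \<bar>h y\<bar>" by (cases "0 \<le> h y") (auto simp: ennreal_neg)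
    then show "ennreal (h y) + ennreal (- h y) = ennreal (\<bar>f y\<bar> / norm (x - y) powr (real DIM('a) - \<alpha>))"
      by (simp add: h_def abs_divide)
  qed
  finally show ?thesis .
qed

text \<open>On the shell R / 2^(j + 1) \<le> |x - y| < R / 2^j the kernel is at most its value at
  the inner radius; each shell is then enlarged to the full ball.\<close>

lemma pos_potential_le_averages:
  fixes f :: "'a::euclidean_space \<Rightarrow> real" and \<alpha> :: real
  assumes [measurable]: "f \<in> borel_measurable lebesgue" and \<alpha>: "0 < \<alpha>" "\<alpha> < DIM('a)" and R: "0 < R"
    and supp: "\<And>y. y \<notin> ball x R \<Longrightarrow> f y = 0"
  shows "pos_potential \<alpha> f x \<le> ennreal (2 ^ DIM('a) * unit_ball_vol DIM('a) * R powr \<alpha>) *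
    (\<Sum>j. ennreal (2 powr (- (real j * \<alpha>))) * average (ball x (R / 2 ^ j)) (\<lambda>y. ennreal \<bar>f y\<bar>))"
proof -
  let ?g = "\<lambda>y. ennreal \<bar>f y\<bar>"
  let ?c = "\<lambda>j::nat. ennreal (1 / (R / 2 ^ Suc j) powr (real DIM('a) - \<alpha>))"
  have "pos_potential \<alpha> f x \<le> (\<integral>\<^sup>+y. (\<Sum>j. ?c j * (?g y * indicator (ball x (R / 2 ^ j)) y)) \<partial>lebesgue)"
    unfolding pos_potential_def
  proof (rule nn_integral_mono)
    fix y
    define d where "d = norm (x - y)"
    show "ennreal (\<bar>f y\<bar> / norm (x - y) powr (real DIM('a) - \<alpha>)) \<le> (\<Sum>j. ?c j * (?g y * indicator (ball x (R / 2 ^ j)) y))"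
    proof (cases "y \<in> ball x R \<and> d \<noteq> 0")
      \<comment> \<open>At y = x the kernel has the value 0, since 0 powr a = 0 and division by 0
        gives 0.\<close>
      case False
      then show ?thesis using supp[of y] by (auto simp: d_def)
    next
      case True
      then have d: "0 < d" "d < R" by (auto simp: d_def dist_norm)
      obtain m where "(1 / 2) ^ m < d / R" using real_arch_pow_inv[of "d / R" "1 / 2"] d R by auto
      then have ex: "R / 2 ^ m \<le> d" using R by (simp add: field_simps power_divide)
      \<comment> \<open>The first radius not exceeding d. It is not R itself because d < R, so its
        predecessor j is the index of the shell of y.\<close>
      define i where "i = (LEAST i. R / 2 ^ i \<le> d)"
      have i: "R / 2 ^ i \<le> d" unfolding i_def using ex by (rule LeastI)
      have "i \<noteq> 0"
      proof
        assume "i = 0"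
        then show False using i d by simp
      qed
      then obtain j where j: "i = Suc j" by (cases i) auto
      have "\<not> R / 2 ^ j \<le> d" using not_less_Least[of j "\<lambda>i. R / 2 ^ i \<le> d"] j unfolding i_def by auto
      then have y: "y \<in> ball x (R / 2 ^ j)" by (simp add: d_def dist_norm)
      have "(R / 2 ^ Suc j) powr (real DIM('a) - \<alpha>) \<le> d powr (real DIM('a) - \<alpha>)"
        using i j R \<alpha> by (intro powr_mono2) auto
      then have "1 / d powr (real DIM('a) - \<alpha>) \<le> 1 / (R / 2 ^ Suc j) powr (real DIM('a) - \<alpha>)"
        using R d by (intro divide_left_mono mult_pos_pos) auto
      then have "1 / d powr (real DIM('a) - \<alpha>) * \<bar>f y\<bar> \<le> 1 / (R / 2 ^ Suc j) powr (real DIM('a) - \<alpha>) * \<bar>f y\<bar>"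
        by (intro mult_right_mono) auto
      then have "ennreal (\<bar>f y\<bar> / norm (x - y) powr (real DIM('a) - \<alpha>)) \<le> ennreal (1 / (R / 2 ^ Suc j) powr (real DIM('a) - \<alpha>) * \<bar>f y\<bar>)"
        by (intro ennreal_leI) (simp add: d_def)
      also have "\<dots> = ?c j * (?g y * indicator (ball x (R / 2 ^ j)) y)"
        using y by (subst ennreal_mult) auto
      also have "\<dots> \<le> (\<Sum>j. ?c j * (?g y * indicator (ball x (R / 2 ^ j)) y))"
        using sum_le_suminf[of "\<lambda>j. ?c j * (?g y * indicator (ball x (R / 2 ^ j)) y)" "{j}"] by simp
      finally show ?thesis .
    qed
  qed
  also have "\<dots> = (\<Sum>j. ?c j * (\<integral>\<^sup>+y\<in>ball x (R / 2 ^ j). ?g y \<partial>lebesgue))"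
    by (subst nn_integral_suminf) (auto simp: nn_integral_cmult)
  also have "\<dots> \<le> (\<Sum>j. ennreal (2 ^ DIM('a) * unit_ball_vol DIM('a) * R powr \<alpha>) *
     (ennreal (2 powr (- (real j * \<alpha>))) * average (ball x (R / 2 ^ j)) ?g))"
  proof (intro suminf_le)
    fix j
    define t where "t = R / 2 ^ j"
    have t: "0 < t" using R by (simp add: t_def)
    have V: "emeasure lebesgue (ball x t) = ennreal (unit_ball_vol DIM('a) * t ^ DIM('a))"
      using t by (intro emeasure_lebesgue_ball) simp
    have I: "(\<integral>\<^sup>+y\<in>ball x t. ?g y \<partial>lebesgue) = average (ball x t) ?g * emeasure lebesgue (ball x t)"
      using average_powr_times[OF t, of 1 x ?g] by simp
    have "1 / (t / 2) powr (real DIM('a) - \<alpha>) * (unit_ball_vol DIM('a) * t ^ DIM('a))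
      = 2 powr (real DIM('a) - \<alpha>) * unit_ball_vol DIM('a) * t powr \<alpha>"
      using t by (simp add: powr_divide powr_diff powr_realpow)
    also have "\<dots> \<le> 2 ^ DIM('a) * unit_ball_vol DIM('a) * t powr \<alpha>"
    proof (intro mult_right_mono)
      have "(2::real) powr (real DIM('a) - \<alpha>) \<le> 2 powr DIM('a)" using \<alpha> by (intro powr_mono) auto
      then show "(2::real) powr (real DIM('a) - \<alpha>) \<le> 2 ^ DIM('a)" by (simp add: powr_realpow)
    qed auto
    also have "t powr \<alpha> = R powr \<alpha> * 2 powr (- (real j * \<alpha>))"
    proof -
      have "(2 ^ j :: real) powr \<alpha> = 2 powr (real j * \<alpha>)" 
        by (subst powr_realpow[symmetric]) (simp_all add: powr_powr)
      moreover have "t powr \<alpha> = R powr \<alpha> / (2 ^ j) powr \<alpha>" unfolding t_def by (rule powr_divide)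
      ultimately show ?thesis by (simp add: powr_minus divide_inverse)
    qed
    finally have le: "1 / (t / 2) powr (real DIM('a) - \<alpha>) * (unit_ball_vol DIM('a) * t ^ DIM('a))
      \<le> 2 ^ DIM('a) * unit_ball_vol DIM('a) * R powr \<alpha> * 2 powr (- (real j * \<alpha>))" by (simp add: mult.assoc)
    have "?c j * (\<integral>\<^sup>+y\<in>ball x t. ?g y \<partial>lebesgue)
       = ennreal (1 / (t / 2) powr (real DIM('a) - \<alpha>) * (unit_ball_vol DIM('a) * t ^ DIM('a))) * average (ball x t) ?g"
      unfolding I V using t by (subst ennreal_mult) (auto simp: t_def mult_ac)
    also have "\<dots> \<le> ennreal (2 ^ DIM('a) * unit_ball_vol DIM('a) * R powr \<alpha> * 2 powr (- (real j * \<alpha>))) * average (ball x t) ?g"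
      by (intro mult_right_mono ennreal_leI le) auto
    also have "\<dots> = ennreal (2 ^ DIM('a) * unit_ball_vol DIM('a) * R powr \<alpha>) *
       (ennreal (2 powr (- (real j * \<alpha>))) * average (ball x t) ?g)"
      using R by (subst ennreal_mult) (auto simp: mult_ac)
    finally show "?c j * (\<integral>\<^sup>+y\<in>ball x (R / 2 ^ j). ?g y \<partial>lebesgue) \<le> ennreal (2 ^ DIM('a) * unit_ball_vol DIM('a) * R powr \<alpha>) *
       (ennreal (2 powr (- (real j * \<alpha>))) * average (ball x (R / 2 ^ j)) ?g)" unfolding t_def .
  qed auto
  finally show ?thesis by simp
qed

text \<open>The shell constant, the bound 2^DIM for 2^\<alpha> from the radius 2 \<rho>, and a
  bracket that bounds the geometric factors of \<open>hedberg_sum\<close> by a multiple of p_star /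
  \<alpha>.\<close>

definition hedberg_const :: "'a::euclidean_space itself \<Rightarrow> real" where
  "hedberg_const _ = 2 ^ DIM('a) * unit_ball_vol DIM('a) * 2 ^ DIM('a) * (4 * DIM('a) + 2 ^ DIM('a) * (2 * DIM('a) + 2))"

lemma hedberg_const_pos: "0 < hedberg_const TYPE('a::euclidean_space)"
  unfolding hedberg_const_def by (intro mult_pos_pos) (auto simp: add_nonneg_pos)

text \<open>\<open>near\<close> supplies M = \<Phi>^(1/p), and \<open>far\<close> supplies K 2^(j
  \<beta>) with \<beta> = n r0 / p. Then \<alpha>/\<beta> = 1 - p/q, and the q-th power of M^(p/q)
  K^(1 - p/q) is K^(q - p) \<Phi>, which is linear in \<open>\<Phi>\<close> and can be integrated
  against w.\<close>

lemma hedberg: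
  fixes f :: "'a::euclidean_space \<Rightarrow> real" and \<alpha> \<rho> p q r0 K :: real
  assumes [measurable]: "f \<in> borel_measurable lebesgue" and \<alpha>: "0 < \<alpha>" "\<alpha> < DIM('a)" and \<rho>: "0 < \<rho>"
    and p: "1 < p" "p < DIM('a) / \<alpha>" and r0: "1 \<le> r0" and q: "1 / q = 1 / p - \<alpha> / (DIM('a) * r0)"
    and supp: "\<And>y. y \<notin> ball x (2 * \<rho>) \<Longrightarrow> f y = 0" and K: "0 < K"
    and near: "\<And>j. ennpowr (average (ball x (2 * \<rho> / 2 ^ j)) (\<lambda>y. ennreal \<bar>f y\<bar>)) p \<le> \<Phi>"
    and far: "\<And>j. ennpowr (average (ball x (2 * \<rho> / 2 ^ j)) (\<lambda>y. ennreal \<bar>f y\<bar>)) p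
        \<le> ennreal (K powr p * 2 powr (real j * DIM('a) * r0))"
  shows "ennpowr (pos_potential \<alpha> f x) q
    \<le> ennreal ((hedberg_const TYPE('a) / \<alpha> * (DIM('a) * p / (DIM('a) - \<alpha> * p)) * \<rho> powr \<alpha>) powr q * K powr (q - p)) * \<Phi>"
proof -
  define n where "n = real DIM('a)"
  have n: "1 \<le> n" using DIM_ge_Suc0[where 'a = 'a] unfolding n_def by linarith
  define ps where "ps = n * p / (n - \<alpha> * p)"
  have nap: "0 < n - \<alpha> * p" using p \<alpha> by (simp add: n_def pos_less_divide_eq mult.commute)
  have ps: "1 / ps = 1 / p - \<alpha> / n" using n p nap by (simp add: ps_def field_simps)
  have "0 < ps" using n p nap by (simp add: ps_def)
  have "\<alpha> / (n * r0) \<le> \<alpha> / n" using n r0 \<alpha> by (intro divide_left_mono) auto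
  then have "1 / ps \<le> 1 / q" using q ps by (simp add: n_def)
  then have q0: "0 < q" "q \<le> ps" using \<open>0 < ps\<close>
    by (smt (verit) zero_less_divide_1_iff) (use \<open>0 < ps\<close> \<open>1 / ps \<le> 1 / q\<close> in \<open>smt (verit) divide_strict_left_mono mult_pos_pos zero_less_divide_1_iff\<close>)
  have "1 / q < 1 / p" using q n r0 \<alpha> by (simp add: n_def[symmetric])
  then have pq: "p < q" using p q0 by (simp add: field_simps)
  define \<beta> where "\<beta> = n * r0 / p"
  have \<beta>0: "0 < \<beta>" using n r0 p by (simp add: \<beta>_def)
  have \<beta>\<alpha>: "\<beta> - \<alpha> = \<beta> * p / q"
  proof -
    have "\<beta> * p * (1 / q) = \<beta> * p * (1 / p - \<alpha> / (n * r0))" using q by (simp add: n_def)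
    also have "\<dots> = \<beta> - \<alpha>" using n r0 p by (simp add: \<beta>_def field_simps)
    finally show ?thesis by simp
  qed
  have \<beta>: "\<alpha> < \<beta>"
  proof -
    have "0 < \<beta> * p / q" using \<beta>0 p q0 by simp
    then show ?thesis using \<beta>\<alpha> by linarith
  qed
  have ex: "\<alpha> / \<beta> = 1 - p / q" using \<beta>\<alpha> \<beta>0 by (simp add: field_simps)
  define T where "T = hedberg_const TYPE('a) / \<alpha> * ps * \<rho> powr \<alpha>"
  have T: "0 < T" using hedberg_const_pos[where 'a = 'a] \<alpha> \<open>0 < ps\<close> \<rho> by (simp add: T_def)
  let ?avg = "\<lambda>j::nat. average (ball x (2 * \<rho> / 2 ^ j)) (\<lambda>y. ennreal \<bar>f y\<bar>)"
  let ?D = "2 ^ DIM('a) * unit_ball_vol DIM('a) * (2 * \<rho>) powr \<alpha>"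
  have J: "pos_potential \<alpha> f x \<le> ennreal ?D * (\<Sum>j. ennreal (2 powr (- (real j * \<alpha>))) * ?avg j)"
    using pos_potential_le_averages[of f \<alpha> "2 * \<rho>" x] \<alpha> \<rho> supp by auto
  consider "\<Phi> = \<infinity>" | "\<Phi> = 0" | M' where "\<Phi> = ennreal M'" "0 < M'"
    by (cases \<Phi>) (force simp: le_less)+
  then show ?thesis
  proof cases
    case 1
    moreover have "ennreal c * top = top" if "0 < c" for c :: real using that by (simp add: ennreal_mult_top)
    moreover have "0 < T powr q * K powr (q - p)"
      using T K by (metis mult_pos_pos powr_gt_zero less_irrefl)
    ultimately have "ennreal (T powr q * K powr (q - p)) * \<Phi> = \<infinity>"
      by (metis infinity_ennreal_def)
    then show ?thesis unfolding T_def n_def ps_def by simp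
  next
    case 2
    then have "?avg j = 0" for j using near[of j] p by (simp add: ennpowr_eq_0_iff)
    then have "pos_potential \<alpha> f x = 0" using J by simp
    then show ?thesis using q0 by simp
  next
    case 3
    define M where "M = M' powr (1 / p)"
    have M: "0 < M" "M' = M powr p" using 3 p by (auto simp: M_def powr_powr)
    have "?avg j \<le> min (ennreal M) (ennreal (K * 2 powr (real j * \<beta>)))" for j
    proof (rule min.boundedI)
      have "ennpowr (?avg j) p \<le> ennpowr (ennreal M) p" using near[of j] 3 M by (simp add: ennpowr_ennreal)
      then show "?avg j \<le> ennreal M" using p by (simp add: ennpowr_le_iff)
      have "ennpowr (?avg j) p \<le> ennpowr (ennreal (K * 2 powr (real j * \<beta>))) p"
        using far[of j] K p by (simp add: ennpowr_ennreal powr_mult powr_powr \<beta>_def n_def mult.assoc)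
      then show "?avg j \<le> ennreal (K * 2 powr (real j * \<beta>))" using p by (simp add: ennpowr_le_iff)
    qed
    then have "(\<Sum>j. ennreal (2 powr (- (real j * \<alpha>))) * ?avg j)
       \<le> (\<Sum>j. ennreal (2 powr (- (real j * \<alpha>))) * min (ennreal M) (ennreal (K * 2 powr (real j * \<beta>))))"
      by (intro suminf_le mult_left_mono) auto
    also have "\<dots> \<le> ennreal (M powr (1 - \<alpha> / \<beta>) * K powr (\<alpha> / \<beta>) * (2 + 2 / (\<beta> - \<alpha>) + 2 powr \<alpha> * (2 + 2 / \<alpha>)))"
      by (rule hedberg_sum[OF \<alpha>(1) \<beta> M(1) K])
    finally have "pos_potential \<alpha> f x \<le> ennreal ?D * ennreal (M powr (1 - \<alpha> / \<beta>) * K powr (\<alpha> / \<beta>) * (2 + 2 / (\<beta> - \<alpha>) + 2 powr \<alpha> * (2 + 2 / \<alpha>)))"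
      using J by (meson mult_left_mono order_trans zero_le)
    also have "\<dots> = ennreal (?D * (M powr (1 - \<alpha> / \<beta>) * K powr (\<alpha> / \<beta>) * (2 + 2 / (\<beta> - \<alpha>) + 2 powr \<alpha> * (2 + 2 / \<alpha>))))"
      by (rule ennreal_mult[symmetric]) (use \<alpha> \<beta> in auto)
    also have "\<dots> \<le> ennreal (T * (M powr (1 - \<alpha> / \<beta>) * K powr (\<alpha> / \<beta>)))"
    proof (intro ennreal_leI)
      have ps1: "1 \<le> ps" using pq p q0 by linarith
      have na: "1 \<le> n / \<alpha>" using \<alpha> by (simp add: n_def)
      have p1: "n / \<alpha> * 1 \<le> n / \<alpha> * ps" and p2: "1 * ps \<le> n / \<alpha> * ps"
        using ps1 na by (intro mult_left_mono mult_right_mono; simp)+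
      \<comment> \<open>Origin of p_star / \<alpha>: 1 / (\<beta> - \<alpha>) is at most q \<le>
        p_star, and since p_star \<ge> 1 and n / \<alpha> \<ge> 1, both geometric factors are
        dominated by multiples of p_star / \<alpha>.\<close>
      have "2 / (\<beta> - \<alpha>) = 2 * (q / (n * r0))" using p n r0 by (simp add: \<beta>\<alpha>) (simp add: \<beta>_def)
      also have "\<dots> \<le> 2 * (q / 1)"
      proof (intro mult_left_mono divide_left_mono)
        show "1 \<le> n * r0" using mult_mono[of 1 n 1 r0] n r0 by simp
      qed (use q0 n r0 in auto)
      finally have b: "2 / (\<beta> - \<alpha>) \<le> 2 * ps" using q0 by simp
      have "2 powr \<alpha> \<le> 2 powr n" using \<alpha> by (intro powr_mono) (auto simp: n_def)
      then have two: "2 powr \<alpha> \<le> 2 ^ DIM('a)" by (simp add: n_def powr_realpow)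
      have "2 powr \<alpha> * (2 + 2 / \<alpha>) \<le> 2 ^ DIM('a) * ((2 * n + 2) * (ps / \<alpha>))"
      proof (intro mult_mono two)
        have "1 / \<alpha> \<le> ps / \<alpha>" using ps1 \<alpha> by (intro divide_right_mono) auto
        moreover have "1 \<le> n * (ps / \<alpha>)" using na p1 by simp
        moreover have "2 / \<alpha> = 2 * (1 / \<alpha>)" by simp
        moreover have "(2 * n + 2) * (ps / \<alpha>) = 2 * (n * (ps / \<alpha>)) + 2 * (ps / \<alpha>)" by (simp only: distrib_right mult.assoc)
        ultimately show "2 + 2 / \<alpha> \<le> (2 * n + 2) * (ps / \<alpha>)" by linarith
      qed (use \<alpha> in auto)
      moreover have "2 + 2 / (\<beta> - \<alpha>) \<le> 4 * n * (ps / \<alpha>)"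
      proof -
        have "4 * n * (ps / \<alpha>) = 4 * (n / \<alpha> * ps)" by simp
        then show ?thesis using b na p1 p2 by linarith
      qed
      ultimately have S: "2 + 2 / (\<beta> - \<alpha>) + 2 powr \<alpha> * (2 + 2 / \<alpha>) \<le> (4 * n + 2 ^ DIM('a) * (2 * n + 2)) * (ps / \<alpha>)"
        by (subst distrib_right) (simp only: mult.assoc add_mono)
      have "(2 * \<rho>) powr \<alpha> \<le> 2 ^ DIM('a) * \<rho> powr \<alpha>"
        using two \<rho> by (simp add: powr_mult)
      then have D: "?D \<le> 2 ^ DIM('a) * unit_ball_vol DIM('a) * (2 ^ DIM('a) * \<rho> powr \<alpha>)"
        by (intro mult_left_mono) auto
      have S0: "0 \<le> 2 + 2 / (\<beta> - \<alpha>) + 2 powr \<alpha> * (2 + 2 / \<alpha>)" using \<alpha> \<beta> by simp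
      have "?D * (2 + 2 / (\<beta> - \<alpha>) + 2 powr \<alpha> * (2 + 2 / \<alpha>))
        \<le> 2 ^ DIM('a) * unit_ball_vol DIM('a) * (2 ^ DIM('a) * \<rho> powr \<alpha>) * ((4 * n + 2 ^ DIM('a) * (2 * n + 2)) * (ps / \<alpha>))"
        by (rule mult_mono[OF D S _ S0]) simp
      also have "\<dots> = T" by (simp add: T_def hedberg_const_def n_def algebra_simps add_divide_distrib)
      finally have "?D * (2 + 2 / (\<beta> - \<alpha>) + 2 powr \<alpha> * (2 + 2 / \<alpha>)) * (M powr (1 - \<alpha> / \<beta>) * K powr (\<alpha> / \<beta>))
        \<le> T * (M powr (1 - \<alpha> / \<beta>) * K powr (\<alpha> / \<beta>))"
        by (rule mult_right_mono) simp
      then show "?D * (M powr (1 - \<alpha> / \<beta>) * K powr (\<alpha> / \<beta>) * (2 + 2 / (\<beta> - \<alpha>) + 2 powr \<alpha> * (2 + 2 / \<alpha>)))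
        \<le> T * (M powr (1 - \<alpha> / \<beta>) * K powr (\<alpha> / \<beta>))" by (simp only: mult_ac)
    qed
    finally have "ennpowr (pos_potential \<alpha> f x) q \<le> ennpowr (ennreal (T * (M powr (1 - \<alpha> / \<beta>) * K powr (\<alpha> / \<beta>)))) q"
      using q0 by (intro ennpowr_mono) auto
    also have "\<dots> = ennreal ((T * (M powr (p / q) * K powr (1 - p / q))) powr q)"
      unfolding ex using T M K by (subst ennpowr_ennreal) auto
    also have "(T * (M powr (p / q) * K powr (1 - p / q))) powr q = T powr q * K powr (q - p) * M'"
    proof -
      have "(1 - p / q) * q = q - p" using q0 by (simp add: field_simps)
      then show ?thesis using T M K q0 by (simp add: powr_mult powr_powr)
    qed
    also have "ennreal (T powr q * K powr (q - p) * M') = ennreal (T powr q * K powr (q - p)) * \<Phi>"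
      using 3 by (simp add: ennreal_mult)
    finally show ?thesis by (simp only: T_def n_def ps_def)
  qed
qed

section \<open>The weighted inequality\<close>

text \<open>At almost every point of the ball the mean of w is at most M w \<le> A w; multiply by g
  and integrate over E.\<close>

lemma A1_bound:
  fixes w :: "'a::euclidean_space \<Rightarrow> ennreal"
  assumes w: "weight w" and fin: "A_const 1 w < \<infinity>" and w_fin: "AE x in lebesgue. w x < \<infinity>"
  shows "Ar_bound 1 (A_const 1 w) w"
  unfolding Ar_bound_def
proof (intro allI impI)
  fix z :: 'a and t :: real and E and g :: "'a \<Rightarrow> ennreal"
  assume t: "0 < t" and E [measurable]: "E \<in> sets lebesgue" and sub: "E \<subseteq> ball z t"
    and [measurable]: "g \<in> borel_measurable lebesgue"
  have [measurable]: "w \<in> borel_measurable lebesgue" using w by (simp add: weight_def)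
  let ?A = "A_const 1 w" and ?V = "emeasure lebesgue (ball z t)"
  have A: "?A = esssup lebesgue (\<lambda>x. maximal w x / w x)" by (simp add: A_const_def)
  have "AE x in lebesgue. maximal w x / w x \<le> ?A" unfolding A by (rule esssup_AE)
  with w_fin have "AE x in lebesgue. maximal w x \<le> ?A * w x"
  proof eventually_elim
    case (elim x)
    show ?case
    proof (cases "w x = 0")
      \<comment> \<open>A nonzero number divided by 0 is \<infinity>, so a finite constant forces
        the maximal function to vanish where w does.\<close>
      case True
      then show ?thesis using elim fin by (auto split: if_splits simp: top_unique)
    next
      case False
      then show ?thesis using elim by (subst (asm) divide_le_ennreal) auto
    qed
  qed
  then have le: "AE x in lebesgue. g x * indicator E x * mass w (ball z t) \<le> ?A * ?V * (g x * w x * indicator E x)"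
  proof eventually_elim
    case (elim x)
    show ?case
    proof (cases "x \<in> E")
      case True
      have "mass w (ball z t) = average (ball z t) w * ?V"
        using average_powr_times[OF t, of 1 z w] by (simp add: mass_def)
      also have "\<dots> \<le> (?A * w x) * ?V"
        using maximal_ge[OF t, of x z w] True sub elim by (intro mult_right_mono) auto
      finally have "g x * mass w (ball z t) \<le> g x * ((?A * w x) * ?V)" by (rule mult_left_mono) simp
      then show ?thesis using True by (simp add: mult_ac)
    qed simp
  qed
  have "(\<integral>\<^sup>+x\<in>E. g x \<partial>lebesgue) * mass w (ball z t) = (\<integral>\<^sup>+x. g x * indicator E x * mass w (ball z t) \<partial>lebesgue)"
    by (rule nn_integral_multc[symmetric]) simp
  also have "\<dots> \<le> (\<integral>\<^sup>+x. ?A * ?V * (g x * w x * indicator E x) \<partial>lebesgue)"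
    by (rule nn_integral_mono_AE[OF le])
  also have "\<dots> = ?A * ?V * (\<integral>\<^sup>+x\<in>E. g x * w x \<partial>lebesgue)"
    by (rule nn_integral_cmult) simp
  finally show "ennpowr (\<integral>\<^sup>+x\<in>E. g x \<partial>lebesgue) 1 * mass w (ball z t)
    \<le> ?A * ennpowr ?V 1 * (\<integral>\<^sup>+x\<in>E. ennpowr (g x) 1 * w x \<partial>lebesgue)" by simp
qed

section \<open>Finiteness and positivity of the weights\<close>

lemma AE_lebesgue_balls:
  assumes "\<And>k. 0 < k \<Longrightarrow> AE x in lebesgue. x \<in> ball (0::'a::euclidean_space) (real k) \<longrightarrow> P x"
  shows "AE x in lebesgue. P x"
proof -
  have "AE x in lebesgue. \<forall>k::nat. 0 < k \<longrightarrow> x \<in> ball (0::'a) (real k) \<longrightarrow> P x"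
    using assms by (subst AE_all_countable) auto
  then show ?thesis
  proof eventually_elim
    case (elim x)
    obtain k where "norm x < real k" using reals_Archimedean2 by blast
    moreover from this have "0 < k" by (metis less_le_trans norm_ge_zero of_nat_0_less_iff order_less_le_trans le_less_trans)
    ultimately show ?case using elim by auto
  qed
qed

lemma AE_finite_of_mass_finite:
  fixes w :: "'a::euclidean_space \<Rightarrow> ennreal"
  assumes [measurable]: "w \<in> borel_measurable lebesgue" and fin: "\<And>t. 0 < t \<Longrightarrow> mass w (ball 0 t) < \<infinity>"
  shows "AE x in lebesgue. w x < \<infinity>"
proof (rule AE_lebesgue_balls)
  fix k :: nat assume "0 < k"
  then have "(\<integral>\<^sup>+x. w x * indicator (ball 0 (real k)) x \<partial>lebesgue) \<noteq> \<infinity>"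
    using fin[of "real k"] by (simp add: mass_def less_top)
  then have "AE x in lebesgue. w x * indicator (ball 0 (real k)) x \<noteq> \<infinity>"
    by (intro nn_integral_PInf_AE) auto
  then show "AE x in lebesgue. x \<in> ball 0 (real k) \<longrightarrow> w x < \<infinity>"
    by eventually_elim (auto simp: less_top split: split_indicator_asm)
qed

lemma weight_AE_finite: "weight w \<Longrightarrow> AE x in lebesgue. w x < \<infinity>"
  by (rule AE_finite_of_mass_finite) (auto simp: weight_def intro: ball_in_balls)

text \<open>The constant is at least 1 because on the ball the maximal function of the restricted
  \<open>\<sigma>\<close> dominates the mean of \<open>\<sigma>\<close>.\<close>

lemma Ainf_const_ball:
  assumes "0 < t" "0 < mass \<sigma> (ball z t)" "mass \<sigma> (ball z t) < \<infinity>"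
  shows "(\<integral>\<^sup>+x\<in>ball z t. maximal (\<lambda>y. \<sigma> y * indicator (ball z t) y) x \<partial>lebesgue) \<le> Ainf_const \<sigma> * mass \<sigma> (ball z t)"
    and "1 \<le> Ainf_const \<sigma>"
proof -
  let ?B = "ball z t" and ?m = "mass \<sigma> (ball z t)"
  let ?M = "\<integral>\<^sup>+x\<in>?B. maximal (\<lambda>y. \<sigma> y * indicator ?B y) x \<partial>lebesgue"
  have le: "?M / ?m \<le> Ainf_const \<sigma>"
    unfolding Ainf_const_def by (rule SUP_upper) (rule ball_in_balls[OF assms(1)])
  then show M: "?M \<le> Ainf_const \<sigma> * ?m"
    using assms(2,3) by (subst (asm) divide_le_ennreal) auto
  have "?m = average ?B \<sigma> * emeasure lebesgue ?B"
    using average_powr_times[OF assms(1), of 1 z \<sigma>] by (simp add: mass_def)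
  also have "\<dots> = (\<integral>\<^sup>+x\<in>?B. average ?B \<sigma> \<partial>lebesgue)"
    by (simp add: nn_integral_cmult_indicator)
  also have "\<dots> \<le> ?M"
  proof (rule nn_integral_mono)
    fix x
    have "average ?B (\<lambda>y. \<sigma> y * indicator ?B y) = average ?B \<sigma>"
      by (simp add: average_restricted) (simp add: average_def mass_def)
    then show "average ?B \<sigma> * indicator ?B x \<le> maximal (\<lambda>y. \<sigma> y * indicator ?B y) x * indicator ?B x"
      using maximal_ge[OF assms(1), of x z "\<lambda>y. \<sigma> y * indicator ?B y"] by (auto split: split_indicator)
  qed
  finally have "?m / ?m \<le> ?M / ?m" by (rule divide_right_mono_ennreal)
  then have "1 \<le> ?M / ?m" using assms(2,3) by (subst (asm) ennreal_divide_self) auto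
  then show "1 \<le> Ainf_const \<sigma>" using le by (rule order_trans)
qed

text \<open>Balls of mass 0 or \<infinity> contribute the quotient 0. The dichotomy fixes the sign
  of q in \<open>riesz_Ar\<close>, where \<open>\<sigma>\<close> may be degenerate.\<close>

lemma Ainf_const_cases: "Ainf_const \<sigma> = 0 \<or> 1 \<le> Ainf_const \<sigma>"
proof (cases "\<exists>z t. 0 < t \<and> 0 < mass \<sigma> (ball z t) \<and> mass \<sigma> (ball z t) < \<infinity>")
  case True
  then show ?thesis using Ainf_const_ball(2)[of _ \<sigma>] by blast
next
  case False
  have "(\<integral>\<^sup>+x\<in>B. maximal (\<lambda>y. \<sigma> y * indicator B y) x \<partial>lebesgue) / mass \<sigma> B = 0" if B: "B \<in> balls" for B
  proof (cases "mass \<sigma> B = 0")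
    case True
    have "average B' (\<lambda>y. \<sigma> y * indicator B y) * indicator B' x = 0" if "B' \<in> balls" for B' x
    proof -
      have "(\<integral>\<^sup>+y\<in>B'. (\<sigma> y * indicator B y) \<partial>lebesgue) \<le> mass \<sigma> B"
        unfolding mass_def by (intro nn_integral_mono) (auto split: split_indicator)
      then show ?thesis using True by (simp add: average_def)
    qed
    then have "maximal (\<lambda>y. \<sigma> y * indicator B y) x = 0" for x
      unfolding maximal_def by (simp add: SUP_eq_iff bot_ennreal[symmetric])
    then show ?thesis by simp
  next
    case nz: False
    obtain z t where "B = ball z t" "0 < t" using B by (auto simp: balls_def)
    then have "\<not> (0 < mass \<sigma> B \<and> mass \<sigma> B < \<infinity>)" using False by blast
    then have "mass \<sigma> B = \<infinity>" using nz by (simp add: zero_less_iff_neq_zero not_less top_unique)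
    then show ?thesis by simp
  qed
  then have "Ainf_const \<sigma> = 0" unfolding Ainf_const_def by (simp add: bot_ennreal[symmetric])
  then show ?thesis ..
qed

text \<open>One ball of positive w-mass suffices: on any larger ball the A_r condition then forces
  the mass of \<open>\<sigma>\<close> to be finite, so \<open>\<sigma>\<close> is finite and w
  positive almost everywhere. Without such a ball, w = 0 and \<open>\<sigma>\<close> = \<infinity>
  almost everywhere.\<close>

lemma dual_pair_of_Ar:
  fixes w :: "'a::euclidean_space \<Rightarrow> ennreal"
  assumes r: "1 < r" and w: "weight w" and A: "A_const r w < \<infinity>" and pos: "0 < \<rho>" "0 < mass w (ball z \<rho>)"
    and \<sigma>: "\<sigma> = (\<lambda>x. ennpowr (w x) (1 - conj_exp r))"
  shows "dual_pair r (A_const r w) w \<sigma>"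
proof -
  have wm [measurable]: "w \<in> borel_measurable lebesgue" using w by (simp add: weight_def)
  have sm [measurable]: "\<sigma> \<in> borel_measurable lebesgue" unfolding \<sigma> by measurable
  have expo: "1 - conj_exp r = - (1 / (r - 1))" using r by (simp add: conj_exp_def field_simps)
  have Ar: "mass w (ball y t) * ennpowr (mass \<sigma> (ball y t)) (r - 1) \<le> A_const r w * ennpowr (emeasure lebesgue (ball y t)) r"
    if t: "0 < t" for y t
  proof -
    let ?V = "emeasure lebesgue (ball y t)"
    have avg: "mass f (ball y t) = average (ball y t) f * ?V" for f
      using average_powr_times[OF t, of 1 y f] by (simp add: mass_def)
    have "average (ball y t) w * ennpowr (average (ball y t) \<sigma>) (r - 1) \<le> A_const r w"
      using r ball_in_balls[OF t, of y] unfolding A_const_def \<sigma> by (auto intro: SUP_upper)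
    then have "average (ball y t) w * ennpowr (average (ball y t) \<sigma>) (r - 1) * ennpowr ?V r \<le> A_const r w * ennpowr ?V r"
      by (rule mult_right_mono) simp
    moreover have "ennpowr ?V r = ?V * ennpowr ?V (r - 1)" using ennpowr_add[of 1 "r - 1" ?V] r by simp
    ultimately show ?thesis using r unfolding avg by (simp add: ennpowr_mult mult_ac)
  qed
  have mass_fin: "mass \<sigma> (ball y t) < \<infinity>" if t: "0 < t" for y t
  proof -
    \<comment> \<open>A ball about z that contains the given ball and also the one of positive
      w-mass.\<close>
    define T where "T = max \<rho> (t + dist z y)"
    have T: "0 < T" "ball z \<rho> \<subseteq> ball z T" "ball y t \<subseteq> ball z T"
      using pos t by (auto simp: T_def less_max_iff_disj) (metis add.commute add_less_cancel_left dist_commute dist_triangle_lt dist_triangle le_less_trans)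
    have "0 < mass w (ball z T)" using pos mass_mono[OF T(2), of w] by (rule_tac less_le_trans)
    moreover have "mass w (ball z T) * ennpowr (mass \<sigma> (ball z T)) (r - 1) < \<infinity>"
    proof (rule le_less_trans[OF Ar[OF T(1), of z]])
      show "A_const r w * ennpowr (emeasure lebesgue (ball z T)) r < \<infinity>"
        using A emeasure_ball_finite[of z T] r ennpowr_less_top[of r "emeasure lebesgue (ball z T)"]
        by (simp add: ennreal_mult_less_top)
    qed
    ultimately have "ennpowr (mass \<sigma> (ball z T)) (r - 1) \<noteq> top"
      by (auto simp: ennreal_mult_top split: if_splits)
    then have "mass \<sigma> (ball z T) \<noteq> top" using r by auto
    then have "mass \<sigma> (ball z T) < \<infinity>" by (simp add: less_top[symmetric])
    then show ?thesis using mass_mono[OF T(3), of \<sigma>] by (rule le_less_trans[rotated])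
  qed
  have AEw: "AE x in lebesgue. w x < \<infinity>" by (rule weight_AE_finite[OF w])
  have AEs: "AE x in lebesgue. \<sigma> x < \<infinity>" by (rule AE_finite_of_mass_finite[OF sm mass_fin])
  have dual: "AE x in lebesgue. 0 < \<sigma> x \<and> \<sigma> x < \<infinity> \<and> w x * ennpowr (\<sigma> x) (r - 1) = 1"
    using AEw AEs
  proof eventually_elim
    case (elim x)
    have neg: "1 - conj_exp r < 0" unfolding expo using r by simp
    have "w x \<noteq> 0" using elim(2) neg by (auto simp: \<sigma> ennpowr_def)
    then have w0: "0 < w x" by (simp add: zero_less_iff_neq_zero)
    have "w x * ennpowr (ennpowr (w x) (- (1 / (r - 1)))) (1 / (1 / (r - 1))) = 1"
      using w0 elim r by (intro ennpowr_times_dual) auto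
    then have 1: "w x * ennpowr (\<sigma> x) (r - 1) = 1" by (simp add: \<sigma> expo)
    moreover have "\<sigma> x \<noteq> 0" using 1 r by auto
    ultimately show ?case using elim by (simp add: zero_less_iff_neq_zero)
  qed
  have mass_pos: "0 < mass \<sigma> (ball y t)" if t: "0 < t" for y t
  proof (rule ccontr)
    assume "\<not> 0 < mass \<sigma> (ball y t)"
    then have "(\<integral>\<^sup>+x. \<sigma> x * indicator (ball y t) x \<partial>lebesgue) = 0" by (simp add: mass_def zero_less_iff_neq_zero)
    then have "AE x in lebesgue. \<sigma> x * indicator (ball y t) x = 0" by (subst (asm) nn_integral_0_iff_AE) auto
    with dual have "AE x in lebesgue. x \<notin> ball y t" by eventually_elim (auto split: split_indicator_asm)
    then have "emeasure lebesgue (ball y t) = 0" by (subst (asm) AE_iff_measurable[of "ball y t"]) auto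
    then show False using emeasure_ball_pos[OF t, of y] by simp
  qed
  show ?thesis
    by unfold_locales (use r wm sm dual mass_pos mass_fin Ar in auto)
qed

lemma (in dual_pair) dual_weights_of_Ainf:
  assumes fin: "Ainf_const \<sigma> < \<infinity>"
  shows "dual_weights r A w \<sigma> (enn2real (Ainf_const \<sigma>))"
proof unfold_locales
  have s: "ennreal (enn2real (Ainf_const \<sigma>)) = Ainf_const \<sigma>" using fin by simp
  have "1 \<le> Ainf_const \<sigma>" using Ainf_const_ball(2)[of 1 \<sigma> 0] mass_pos mass_finite by simp
  then have "ennreal 1 \<le> ennreal (enn2real (Ainf_const \<sigma>))" using s by simp
  then show "1 \<le> enn2real (Ainf_const \<sigma>)" by (subst (asm) ennreal_le_iff) auto
  show "(\<integral>\<^sup>+x\<in>ball y t. maximal (\<lambda>u. \<sigma> u * indicator (ball y t) u) x \<partial>lebesgue)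
      \<le> ennreal (enn2real (Ainf_const \<sigma>)) * mass \<sigma> (ball y t)" if "0 < t" for y t
    unfolding s by (rule Ainf_const_ball) (use that mass_pos mass_finite in auto)
qed

text \<open>The factor exp 1 is the p-th root of the factor exp p in
  \<open>far_estimate\<close>.\<close>

definition riesz_const :: "'a::euclidean_space itself \<Rightarrow> real" where
  "riesz_const _ = hedberg_const TYPE('a) * max_const TYPE('a) * exp 1"

lemma riesz_const_pos: "0 < riesz_const TYPE('a::euclidean_space)"
  unfolding riesz_const_def using hedberg_const_pos[where 'a = 'a] max_const_ge_1[where 'a = 'a] by simp

text \<open>Here \<open>A\<close> and \<open>s\<close> stand for the constants of \<open>w\<close> and of its dual weight, with \<open>s = 1\<close> for \<open>r = 1\<close>.\<close>

lemma riesz_inequality: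
  fixes f :: "'a::euclidean_space \<Rightarrow> real" and \<alpha> p q r0 A s W F \<rho> :: real
  assumes [measurable]: "f \<in> borel_measurable lebesgue" "w \<in> borel_measurable lebesgue"
    and \<alpha>: "0 < \<alpha>" "\<alpha> < DIM('a)" and \<rho>: "0 < \<rho>"
    and p: "1 < p" "p < DIM('a) / \<alpha>" and r0: "1 \<le> r0" and q: "1 / q = 1 / p - \<alpha> / (DIM('a) * r0)"
    and supp: "\<And>y. y \<notin> ball z \<rho> \<Longrightarrow> f y = 0"
    and A: "1 \<le> A" and s: "1 \<le> s" and W: "0 < W" "mass w (ball z \<rho>) = ennreal W"
    and F: "0 < F" "(\<integral>\<^sup>+x. ennpowr (ennreal \<bar>f x\<bar>) p * w x \<partial>lebesgue) = ennreal F"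
    and \<Phi> [measurable]: "\<Phi> \<in> borel_measurable lebesgue"
    and near: "\<And>x t. 0 < t \<Longrightarrow> ennpowr (average (ball x t) (\<lambda>y. ennreal \<bar>f y\<bar>)) p \<le> \<Phi> x"
    and near_int: "(\<integral>\<^sup>+x. \<Phi> x * w x \<partial>lebesgue) \<le> ennreal (max_const TYPE('a) powr p * (p / (p - 1)) * s) * ennreal A * ennreal F"
    and far: "\<And>x j. ennpowr (average (ball x (2 * \<rho> / 2 ^ j)) (\<lambda>y. ennreal \<bar>f y\<bar>)) p * mass w (ball x (2 * \<rho>))
        \<le> ennreal (exp p) * ennreal A * ennreal (2 powr (real j * DIM('a) * r0)) * ennreal F"
  shows "ennpowr (waverage w (ball z \<rho>) (\<lambda>x. ennpowr (e2ennreal \<bar>riesz_potential \<alpha> f x\<bar>) q)) (1 / q)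
    \<le> ennreal (riesz_const TYPE('a) / \<alpha> * (DIM('a) * p / (DIM('a) - \<alpha> * p)) * conj_exp p powr (1 / q))
       * ennreal (A powr (1 / p)) * ennreal (s powr (1 / q)) * ennreal (\<rho> powr \<alpha>) * ennreal ((F / W) powr (1 / p))"
proof -
  define n where "n = real DIM('a)"
  have n: "1 \<le> n" using DIM_ge_Suc0[where 'a = 'a] unfolding n_def by linarith
  define ps where "ps = n * p / (n - \<alpha> * p)"
  have nap: "0 < n - \<alpha> * p" using p \<alpha> by (simp add: n_def pos_less_divide_eq mult.commute)
  have ps: "0 < ps" using n p nap by (simp add: ps_def)
  have "\<alpha> / (n * r0) \<le> \<alpha> / n" using n r0 \<alpha> by (intro divide_left_mono) auto
  moreover have "1 / p - \<alpha> / n = 1 / ps" using n p nap by (simp add: ps_def field_simps)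
  ultimately have "1 / ps \<le> 1 / q" using q by (simp add: n_def)
  then have q0: "0 < q" using ps by (smt (verit) zero_less_divide_1_iff)
  have "1 / q < 1 / p" using q n r0 \<alpha> by (simp add: n_def[symmetric])
  then have pq: "p < q" using p q0 by (simp add: field_simps)
  \<comment> \<open>Chosen so that dividing \<open>far\<close> by W leaves K^p 2^(j n r0): for x in
    the ball, the ball of radius 2 \<rho> about x contains it, so its mass is at least W.\<close>
  define K where "K = (exp p * A * F / W) powr (1 / p)"
  have K: "0 < K" using A F W by (simp add: K_def)
  have Kp: "K powr p = exp p * A * F / W" using A F W p by (simp add: K_def powr_powr)
  define T where "T = hedberg_const TYPE('a) / \<alpha> * ps * \<rho> powr \<alpha>"
  have T: "0 < T" using hedberg_const_pos[where 'a = 'a] \<alpha> ps \<rho> by (simp add: T_def)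
  define L where "L = max_const TYPE('a)"
  have L: "1 \<le> L" unfolding L_def by (rule max_const_ge_1)
  define p' where "p' = conj_exp p"
  have p': "p' = p / (p - 1)" "0 < p'" using p by (auto simp: p'_def conj_exp_def)
  have sub: "ball z \<rho> \<subseteq> ball x (2 * \<rho>)" if "x \<in> ball z \<rho>" for x
  proof
    fix y assume "y \<in> ball z \<rho>"
    then show "y \<in> ball x (2 * \<rho>)" using that dist_triangle[of x y z] by (simp add: dist_commute)
  qed
  have pt: "ennpowr (e2ennreal \<bar>riesz_potential \<alpha> f x\<bar>) q \<le> ennreal (T powr q * K powr (q - p)) * \<Phi> x"
    if x: "x \<in> ball z \<rho>" for x
  proof -
    have "ennpowr (e2ennreal \<bar>riesz_potential \<alpha> f x\<bar>) q \<le> ennpowr (pos_potential \<alpha> f x) q"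
      using q0 by (intro ennpowr_mono riesz_potential_le) auto
    also have "\<dots> \<le> ennreal ((hedberg_const TYPE('a) / \<alpha> * (DIM('a) * p / (DIM('a) - \<alpha> * p)) * \<rho> powr \<alpha>) powr q * K powr (q - p)) * \<Phi> x"
    proof (rule hedberg[OF _ \<alpha> \<rho> p r0 q _ K])
      show "f y = 0" if "y \<notin> ball x (2 * \<rho>)" for y using sub[OF x] supp that by blast
      fix j
      show "ennpowr (average (ball x (2 * \<rho> / 2 ^ j)) (\<lambda>y. ennreal \<bar>f y\<bar>)) p \<le> \<Phi> x"
        using \<rho> by (intro near) simp
      let ?a = "ennpowr (average (ball x (2 * \<rho> / 2 ^ j)) (\<lambda>y. ennreal \<bar>f y\<bar>)) p"
      let ?E = "2 powr (real j * DIM('a) * r0)"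
      have "ennreal W * ?a \<le> ?a * mass w (ball x (2 * \<rho>))"
        using mass_mono[OF sub[OF x], of w] W(2) by (subst mult.commute) (intro mult_left_mono, simp_all)
      also have "\<dots> \<le> ennreal (exp p) * ennreal A * ennreal ?E * ennreal F" by (rule far)
      also have "\<dots> = ennreal W * ennreal (K powr p * ?E)"
        unfolding Kp using A F W by (simp add: mult_ac flip: ennreal_mult)
      finally show "?a \<le> ennreal (K powr p * ?E)"
        using W by (subst (asm) ennreal_mult_le_mult_iff) auto
    qed auto
    finally show ?thesis by (simp add: T_def ps_def n_def)
  qed
  have "(\<integral>\<^sup>+x\<in>ball z \<rho>. ennpowr (e2ennreal \<bar>riesz_potential \<alpha> f x\<bar>) q * w x \<partial>lebesgue)
     \<le> (\<integral>\<^sup>+x. ennreal (T powr q * K powr (q - p)) * (\<Phi> x * w x) \<partial>lebesgue)"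
  proof (rule nn_integral_mono)
    fix x
    show "ennpowr (e2ennreal \<bar>riesz_potential \<alpha> f x\<bar>) q * w x * indicator (ball z \<rho>) x
      \<le> ennreal (T powr q * K powr (q - p)) * (\<Phi> x * w x)"
    proof (cases "x \<in> ball z \<rho>")
      case True
      then show ?thesis using mult_right_mono[OF pt[OF True], of "w x"] by (simp add: mult.assoc)
    qed simp
  qed
  also have "\<dots> = ennreal (T powr q * K powr (q - p)) * (\<integral>\<^sup>+x. \<Phi> x * w x \<partial>lebesgue)"
    by (rule nn_integral_cmult) simp
  also have "\<dots> \<le> ennreal (T powr q * K powr (q - p)) * (ennreal (L powr p * p' * s) * ennreal A * ennreal F)"
    using near_int unfolding L_def p' by (rule mult_left_mono) simp
  also have "\<dots> = ennreal (T powr q * K powr (q - p) * (L powr p * p' * s * A * F))"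
    using T K L p'(2) s A F(1) by (simp add: mult_ac flip: ennreal_mult)
  finally have "waverage w (ball z \<rho>) (\<lambda>x. ennpowr (e2ennreal \<bar>riesz_potential \<alpha> f x\<bar>) q)
     \<le> ennreal (T powr q * K powr (q - p) * (L powr p * p' * s * A * F)) / ennreal W"
    unfolding waverage_def W(2) by (rule divide_right_mono_ennreal)
  also have "\<dots> = ennreal (T powr q * K powr (q - p) * (L powr p * p' * s * A * F) / W)"
    using T K L p'(2) s A F(1) W(1) by (intro divide_ennreal) auto
  also have "\<dots> \<le> ennreal ((T * L * p' powr (1 / q) * s powr (1 / q) * K) powr q)"
  proof (intro ennreal_leI)
    \<comment> \<open>Completes q-th powers: A F / W is absorbed into K^p, and L^p into L^q. So A
      appears in K^q, with the power 1/p after taking the root, while p' and s occur once and keep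
      the power 1/q.\<close>
    have "A * F / W \<le> exp p * (A * F / W)"
      using A F W p mult_right_mono[of 1 "exp p" "A * F / W"] by simp
    then have 1: "A * F / W \<le> K powr p" by (simp add: Kp)
    have 2: "L powr p \<le> L powr q" using L pq by (intro powr_mono) auto
    have "T powr q * K powr (q - p) * (L powr p * p' * s * A * F) / W
        = T powr q * K powr (q - p) * (p' * s) * (L powr p * (A * F / W))" by simp
    also have "\<dots> \<le> T powr q * K powr (q - p) * (p' * s) * (L powr q * K powr p)"
      using 1 2 A F(1) W(1) p'(2) s by (intro mult_left_mono mult_mono) auto
    also have "\<dots> = T powr q * L powr q * p' * s * (K powr (q - p) * K powr p)" by (simp only: mult_ac)
    also have "K powr (q - p) * K powr p = K powr q" using K by (simp flip: powr_add)
    also have "T powr q * L powr q * p' * s * K powr q = (T * L * p' powr (1 / q) * s powr (1 / q) * K) powr q"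
      using T L p'(2) s K q0 by (simp add: powr_mult powr_powr)
    finally show "T powr q * K powr (q - p) * (L powr p * p' * s * A * F) / W
      \<le> (T * L * p' powr (1 / q) * s powr (1 / q) * K) powr q" .
  qed
  finally have "ennpowr (waverage w (ball z \<rho>) (\<lambda>x. ennpowr (e2ennreal \<bar>riesz_potential \<alpha> f x\<bar>) q)) (1 / q)
     \<le> ennpowr (ennreal ((T * L * p' powr (1 / q) * s powr (1 / q) * K) powr q)) (1 / q)"
    using q0 by (intro ennpowr_mono) auto
  also have "\<dots> = ennreal (T * L * p' powr (1 / q) * s powr (1 / q) * K)"
    using T L p'(2) s K q0 by (subst ennpowr_ennreal) (auto simp: powr_powr)
  also have "K = exp 1 * A powr (1 / p) * (F / W) powr (1 / p)"
  proof -
    have "exp p powr (1 / p) = exp 1" using p by (simp add: powr_def)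
    moreover have "exp p * A * F / W = exp p * A * (F / W)" by simp
    ultimately show ?thesis unfolding K_def using A F W by (simp only: powr_mult)
  qed
  also have "T * L * p' powr (1 / q) * s powr (1 / q) * (exp 1 * A powr (1 / p) * (F / W) powr (1 / p))
      = (riesz_const TYPE('a) / \<alpha> * ps * p' powr (1 / q)) * A powr (1 / p) * s powr (1 / q) * \<rho> powr \<alpha> * (F / W) powr (1 / p)"
    by (simp add: T_def L_def riesz_const_def)
  also have "ennreal \<dots> = ennreal (riesz_const TYPE('a) / \<alpha> * ps * p' powr (1 / q)) * ennreal (A powr (1 / p))
      * ennreal (s powr (1 / q)) * ennreal (\<rho> powr \<alpha>) * ennreal ((F / W) powr (1 / p))"
    using riesz_const_pos[where 'a = 'a] \<alpha> ps by (subst ennreal_mult, simp, simp)+ simp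
  finally show ?thesis by (simp only: ps_def n_def p'_def)
qed

section \<open>Degenerate data and the cases r = 1 and r > 1\<close>

lemma zero_ext_measurable:
  assumes "f \<in> Lp_on p B w"
  shows "zero_ext B f \<in> borel_measurable lebesgue"
proof -
  have "zero_ext B f = (\<lambda>x. indicator B x *\<^sub>R f x)" by (auto simp: zero_ext_def)
  then show ?thesis using assms by (simp add: Lp_on_def set_borel_measurable_def)
qed

lemma zero_ext_power_integral:
  assumes "0 < p"
  shows "(\<integral>\<^sup>+x. ennpowr (ennreal \<bar>zero_ext B f x\<bar>) p * w x \<partial>lebesgue) = (\<integral>\<^sup>+x\<in>B. ennreal (\<bar>f x\<bar> powr p) * w x \<partial>lebesgue)"
  using assms by (intro nn_integral_cong) (auto simp: zero_ext_def ennpowr_ennreal' split: split_indicator)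

lemma waverage_null:
  fixes w :: "'a::euclidean_space \<Rightarrow> ennreal"
  assumes [measurable]: "w \<in> borel_measurable lebesgue" "B \<in> sets lebesgue" and null: "mass w B = 0"
  shows "waverage w B h = 0"
proof -
  have "AE x in lebesgue. w x * indicator B x = 0"
    using null unfolding mass_def by (subst (asm) nn_integral_0_iff_AE) auto
  then have "(\<integral>\<^sup>+x\<in>B. h x * w x \<partial>lebesgue) = (\<integral>\<^sup>+x. 0 \<partial>(lebesgue :: 'a measure))"
    by (intro nn_integral_cong_AE) (auto simp: mult.assoc)
  then show ?thesis by (simp add: waverage_def)
qed

text \<open>Test with g = 1 on the whole ball.\<close>

lemma Ar_bound_ge_1:
  fixes w :: "'a::euclidean_space \<Rightarrow> ennreal"
  assumes "Ar_bound r A w" "1 \<le> r" "0 < t" "mass w (ball z t) = ennreal W" "0 < W"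
  shows "1 \<le> A"
proof -
  obtain v where v: "0 < v" "emeasure lebesgue (ball z t) = ennreal v"
    using emeasure_ball_real[OF assms(3)] by blast
  have "(\<integral>\<^sup>+x\<in>ball z t. 1 \<partial>lebesgue) = ennreal v" using v by simp
  moreover have "(\<integral>\<^sup>+x\<in>ball z t. ennpowr 1 r * w x \<partial>lebesgue) = ennreal W"
    using assms(2,4) by (simp add: mass_def ennpowr_def)
  ultimately have "ennpowr (ennreal v) r * ennreal W \<le> A * ennpowr (ennreal v) r * ennreal W"
    using assms(1)[unfolded Ar_bound_def, rule_format, of t "ball z t" z "\<lambda>_. 1"] assms(3,4) v by simp
  then have "ennreal (v powr r * W) * 1 \<le> ennreal (v powr r * W) * A"
    using v assms(5) by (simp add: ennpowr_ennreal ennreal_mult mult_ac)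
  then show ?thesis using v(1) assms(5) by (subst (asm) ennreal_mult_le_mult_iff) auto
qed

text \<open>\<open>Ar_bound\<close> applied to g^(p/r) on the ball, then Jensen. The maximal
  theorems require these integrals to be finite, so that maximal cubes exist.\<close>

lemma Ar_bound_integrable:
  fixes w :: "'a::euclidean_space \<Rightarrow> ennreal"
  assumes Ar: "Ar_bound r A w" and r: "1 \<le> r" "r \<le> p" and t: "0 < t" and W: "mass w (ball z t) \<noteq> 0" and A: "A < \<infinity>"
    and [measurable]: "g \<in> borel_measurable lebesgue" and F: "(\<integral>\<^sup>+x. ennpowr (g x) p * w x \<partial>lebesgue) < \<infinity>"
  shows "(\<integral>\<^sup>+x\<in>ball z t. ennpowr (g x) (p / r) \<partial>lebesgue) < \<infinity>" "(\<integral>\<^sup>+x\<in>ball z t. g x \<partial>lebesgue) < \<infinity>"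
proof -
  obtain v where v: "0 < v" "emeasure lebesgue (ball z t) = ennreal v"
    using emeasure_ball_real[OF t] by blast
  let ?J = "\<integral>\<^sup>+x\<in>ball z t. ennpowr (g x) (p / r) \<partial>lebesgue" and ?I = "\<integral>\<^sup>+x\<in>ball z t. g x \<partial>lebesgue"
  have "ennpowr ?J r * mass w (ball z t)
      \<le> A * ennpowr (ennreal v) r * (\<integral>\<^sup>+x\<in>ball z t. ennpowr (ennpowr (g x) (p / r)) r * w x \<partial>lebesgue)"
    using Ar[unfolded Ar_bound_def, rule_format, of t "ball z t" z "\<lambda>x. ennpowr (g x) (p / r)"] t v by simp
  also have "\<dots> \<le> A * ennpowr (ennreal v) r * (\<integral>\<^sup>+x. ennpowr (g x) p * w x \<partial>lebesgue)"
    using r by (intro mult_left_mono nn_integral_mono) (auto simp: ennpowr_ennpowr split: split_indicator)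
  also have "\<dots> < \<infinity>" using A F v by (simp add: ennreal_mult_less_top ennpowr_ennreal)
  finally have "ennpowr ?J r \<noteq> top" using W by (auto simp: ennreal_top_mult)
  then have "?J \<noteq> top" using r by auto
  then show J: "?J < \<infinity>" by (simp add: less_top[symmetric])
  have "ennpowr ?I p \<le> ennpowr ?J r * ennpowr (ennreal v) (p - r)"
    using set_Jensen_iterated[of g lebesgue "ball z t" r p] r v by simp
  also have "\<dots> < \<infinity>"
    using ennpowr_less_top[of r ?J] J r v by (simp add: ennreal_mult_less_top ennpowr_ennreal)
  finally have "?I \<noteq> top" using r by auto
  then show "?I < \<infinity>" by (simp add: less_top[symmetric])
qed

text \<open>If |f|^p w vanishes almost everywhere, so does |f|^r w, and \<open>Ar_bound\<close> on
  the ball forces the integral of |f| to be 0. Hence f is null for Lebesgue measure, not only for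
  w.\<close>

lemma riesz_potential_null:
  fixes w :: "'a::euclidean_space \<Rightarrow> ennreal"
  assumes Ar: "Ar_bound r A w" and r: "1 \<le> r" "r \<le> p" and t: "0 < t" and W: "mass w (ball z t) \<noteq> 0"
    and [measurable]: "w \<in> borel_measurable lebesgue" "f \<in> borel_measurable lebesgue"
    and supp: "\<And>y. y \<notin> ball z t \<Longrightarrow> f y = 0"
    and F: "(\<integral>\<^sup>+x. ennpowr (ennreal \<bar>f x\<bar>) p * w x \<partial>lebesgue) = 0"
  shows "e2ennreal \<bar>riesz_potential \<alpha> f x\<bar> = 0"
proof -
  let ?g = "\<lambda>x. ennreal \<bar>f x\<bar>"
  have "AE x in lebesgue. ennpowr (?g x) p * w x = 0"
    using F by (subst (asm) nn_integral_0_iff_AE) auto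
  then have "AE x in lebesgue. ennpowr (?g x) r * w x * indicator (ball z t) x = 0"
    by eventually_elim (use r in \<open>auto simp: ennpowr_eq_0_iff\<close>)
  then have "(\<integral>\<^sup>+x\<in>ball z t. ennpowr (?g x) r * w x \<partial>lebesgue) = 0"
    by (subst nn_integral_0_iff_AE) auto
  then have "ennpowr (\<integral>\<^sup>+x\<in>ball z t. ?g x \<partial>lebesgue) r * mass w (ball z t) \<le> 0"
    using Ar[unfolded Ar_bound_def, rule_format, of t "ball z t" z ?g] t by simp
  then have "(\<integral>\<^sup>+x\<in>ball z t. ?g x \<partial>lebesgue) = 0" using W r by (auto simp: ennpowr_eq_0_iff)
  then have "AE x in lebesgue. ?g x * indicator (ball z t) x = 0" by (subst (asm) nn_integral_0_iff_AE) auto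
  then have "AE x in lebesgue. f x = 0"
    by eventually_elim (use supp in \<open>auto split: split_indicator_asm\<close>)
  then have "pos_potential \<alpha> f x = (\<integral>\<^sup>+y. 0 \<partial>(lebesgue :: 'a measure))"
    unfolding pos_potential_def by (intro nn_integral_cong_AE) auto
  then show ?thesis using riesz_potential_le[of f \<alpha> x] by simp
qed

text \<open>Reduces to the case where all constants are positive real numbers.\<close>

lemma riesz_cases:
  fixes w :: "'a::euclidean_space \<Rightarrow> ennreal"
  assumes w: "weight w" and Ar: "mass w (ball z \<rho>) \<noteq> 0 \<Longrightarrow> Ar_bound r A w" and A: "A < \<infinity>" and r: "1 \<le> r" "r \<le> p"
    and q: "0 < q" and f: "f \<in> Lp_on p (ball z \<rho>) w" and \<rho>: "0 < \<rho>"
    and main: "\<And>W F A'. 0 < W \<Longrightarrow> mass w (ball z \<rho>) = ennreal W \<Longrightarrow> 0 < F \<Longrightarrow>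
      (\<integral>\<^sup>+x. ennpowr (ennreal \<bar>zero_ext (ball z \<rho>) f x\<bar>) p * w x \<partial>lebesgue) = ennreal F \<Longrightarrow>
      waverage w (ball z \<rho>) (\<lambda>x. ennreal (\<bar>f x\<bar> powr p)) = ennreal (F / W) \<Longrightarrow>
      1 \<le> A' \<Longrightarrow> A = ennreal A' \<Longrightarrow> Ar_bound r A w \<Longrightarrow>
      (\<integral>\<^sup>+x. ennreal \<bar>zero_ext (ball z \<rho>) f x\<bar> \<partial>lebesgue) < \<infinity> \<Longrightarrow>
      (\<integral>\<^sup>+x. ennpowr (ennreal \<bar>zero_ext (ball z \<rho>) f x\<bar>) (p / r) \<partial>lebesgue) < \<infinity> \<Longrightarrow>
      ennpowr (waverage w (ball z \<rho>) (\<lambda>x. ennpowr (e2ennreal \<bar>riesz_potential \<alpha> (zero_ext (ball z \<rho>) f) x\<bar>) q)) (1 / q) \<le> R"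
  shows "ennpowr (waverage w (ball z \<rho>) (\<lambda>x. ennpowr (e2ennreal \<bar>riesz_potential \<alpha> (zero_ext (ball z \<rho>) f) x\<bar>) q)) (1 / q) \<le> R"
proof -
  let ?B = "ball z \<rho>"
  define h where "h = zero_ext ?B f"
  have [measurable]: "w \<in> borel_measurable lebesgue" using w by (simp add: weight_def)
  have hm [measurable]: "h \<in> borel_measurable lebesgue" unfolding h_def by (rule zero_ext_measurable[OF f])
  have supp: "h y = 0" if "y \<notin> ?B" for y using that by (simp add: h_def zero_ext_def)
  have p0: "0 < p" using r by simp
  let ?F = "\<integral>\<^sup>+x. ennpowr (ennreal \<bar>h x\<bar>) p * w x \<partial>lebesgue"
  have F_fin: "?F < \<infinity>" unfolding h_def zero_ext_power_integral[OF p0] using f by (simp add: Lp_on_def)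
  show ?thesis
  proof (cases "mass w ?B = 0")
    case True
    then show ?thesis using q by (simp add: waverage_null)
  next
    case W: False
    have bound: "Ar_bound r A w" by (rule Ar[OF W])
    show ?thesis
    proof (cases "?F = 0")
      case True
      have "e2ennreal \<bar>riesz_potential \<alpha> h x\<bar> = 0" for x
        by (rule riesz_potential_null[OF bound r \<rho> W _ hm supp True]) simp
      then show ?thesis using q by (simp add: h_def[symmetric] waverage_def)
    next
      case False
      have "mass w ?B < \<infinity>" using w ball_in_balls[OF \<rho>, of z] by (auto simp: weight_def)
      then obtain W' where W': "mass w ?B = ennreal W'" "0 < W'"
        using W by (cases "mass w ?B") (auto simp: less_le)
      obtain F' where F': "?F = ennreal F'" "0 < F'"
        using False F_fin by (cases ?F) (auto simp: less_le)
      have avg: "waverage w ?B (\<lambda>x. ennreal (\<bar>f x\<bar> powr p)) = ennreal (F' / W')"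
        unfolding waverage_def W'(1) using F' W'(2)
        by (simp add: zero_ext_power_integral[OF p0, symmetric] h_def[symmetric] divide_ennreal)
      have "1 \<le> A" by (rule Ar_bound_ge_1[OF bound r(1) \<rho> W'])
      then obtain A' where A': "A = ennreal A'" "1 \<le> A'"
        using A by (cases A) (auto simp: ennreal_ge_1)
      have eq: "(\<integral>\<^sup>+x\<in>?B. k (ennreal \<bar>h x\<bar>) \<partial>lebesgue) = (\<integral>\<^sup>+x. k (ennreal \<bar>h x\<bar>) \<partial>lebesgue)" if "k 0 = 0" for k
        using that supp by (intro nn_integral_cong) (auto split: split_indicator)
      have pr: "0 < p / r" using r by simp
      note int = Ar_bound_integrable[OF bound r \<rho> W A, of "\<lambda>x. ennreal \<bar>h x\<bar>", OF _ F_fin]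
      show ?thesis
        using main[OF W'(2,1) F'(2) _ avg A'(2,1) bound] int F'(1) eq[of "\<lambda>x. ennpowr x (p / r)"] eq[of "\<lambda>x. x"] pr
        by (simp add: h_def[symmetric])
    qed
  qed
qed

text \<open>\<open>riesz_inequality\<close> with r0 = 1 and s = 1. Its hypothesis on large balls
  carries a factor exp p, which \<open>far_estimate_A1\<close> allows to insert because exp p \<ge>
  1.\<close>

lemma riesz_A1:
  fixes w :: "'a::euclidean_space \<Rightarrow> ennreal" and \<alpha> p q \<rho> :: real
  assumes \<alpha>: "0 < \<alpha>" "\<alpha> < DIM('a)" and p: "1 < p" "p < DIM('a) / \<alpha>" and w: "w \<in> A_class 1"
    and q: "q = DIM('a) * p / (DIM('a) - \<alpha> * p)" and \<rho>: "0 < \<rho>" and f: "f \<in> Lp_on p (ball z \<rho>) w"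
  shows "ennpowr (waverage w (ball z \<rho>) (\<lambda>x. ennpowr (e2ennreal \<bar>riesz_potential \<alpha> (zero_ext (ball z \<rho>) f) x\<bar>) q)) (1 / q)
    \<le> ennreal (riesz_const TYPE('a) / \<alpha> * (DIM('a) * p / (DIM('a) - \<alpha> * p)) * conj_exp p powr (1 / q))
       * ennpowr (A_const 1 w) (1 / p) * ennreal (\<rho> powr \<alpha>)
       * ennpowr (waverage w (ball z \<rho>) (\<lambda>x. ennreal (\<bar>f x\<bar> powr p))) (1 / p)"
proof -
  define n where "n = real DIM('a)"
  have n: "1 \<le> n" using DIM_ge_Suc0[where 'a = 'a] unfolding n_def by linarith
  have nap: "0 < n - \<alpha> * p" using p \<alpha> by (simp add: n_def pos_less_divide_eq mult.commute)
  have q0: "0 < q" using n p nap by (simp add: q n_def)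
  have q': "1 / q = 1 / p - \<alpha> / (real DIM('a) * 1)" using n p nap by (simp add: q n_def[symmetric] field_simps)
  have weight: "weight w" and A: "A_const 1 w < \<infinity>" using w by (auto simp: A_class_def)
  have [measurable]: "w \<in> borel_measurable lebesgue" using weight by (simp add: weight_def)
  let ?h = "zero_ext (ball z \<rho>) f"
  have hm [measurable]: "?h \<in> borel_measurable lebesgue" by (rule zero_ext_measurable[OF f])
  have Ar: "Ar_bound 1 (A_const 1 w) w" by (rule A1_bound[OF weight A weight_AE_finite[OF weight]])
  show ?thesis
  proof (rule riesz_cases[OF weight Ar A order_refl _ q0 f \<rho>])
    show "1 \<le> p" using p by simp
    fix W F A' :: real
    assume W: "0 < W" "mass w (ball z \<rho>) = ennreal W" and F: "0 < F"
        "(\<integral>\<^sup>+x. ennpowr (ennreal \<bar>?h x\<bar>) p * w x \<partial>lebesgue) = ennreal F"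
      and avg: "waverage w (ball z \<rho>) (\<lambda>x. ennreal (\<bar>f x\<bar> powr p)) = ennreal (F / W)"
      and A': "1 \<le> A'" "A_const 1 w = ennreal A'"
      and fin: "(\<integral>\<^sup>+x. ennreal \<bar>?h x\<bar> \<partial>lebesgue) < \<infinity>"
    obtain \<Phi> where \<Phi>: "\<Phi> \<in> borel_measurable lebesgue" "\<And>x t. 0 < t \<Longrightarrow> ennpowr (average (ball x t) (\<lambda>y. ennreal \<bar>?h y\<bar>)) p \<le> \<Phi> x"
        "(\<integral>\<^sup>+x. \<Phi> x * w x \<partial>lebesgue) \<le> ennreal (max_const TYPE('a) powr p * (p / (p - 1))) * A_const 1 w *
           (\<integral>\<^sup>+x. ennpowr (ennreal \<bar>?h x\<bar>) p * w x \<partial>lebesgue)"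
      using maximal_theorem_A1[OF Ar p(1) _ _ fin] by auto
    have "ennpowr (waverage w (ball z \<rho>) (\<lambda>x. ennpowr (e2ennreal \<bar>riesz_potential \<alpha> ?h x\<bar>) q)) (1 / q)
      \<le> ennreal (riesz_const TYPE('a) / \<alpha> * (DIM('a) * p / (DIM('a) - \<alpha> * p)) * conj_exp p powr (1 / q))
       * ennreal (A' powr (1 / p)) * ennreal (1 powr (1 / q)) * ennreal (\<rho> powr \<alpha>) * ennreal ((F / W) powr (1 / p))"
    proof (rule riesz_inequality[OF hm _ \<alpha> \<rho> p order_refl q' _ A'(1) order_refl W F \<Phi>(1,2)])
      show "?h y = 0" if "y \<notin> ball z \<rho>" for y using that by (simp add: zero_ext_def)
      show "(\<integral>\<^sup>+x. \<Phi> x * w x \<partial>lebesgue) \<le> ennreal (max_const TYPE('a) powr p * (p / (p - 1)) * 1) * ennreal A' * ennreal F"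
        using \<Phi>(3) unfolding F(2) A'(2) by simp
      fix x j
      have "ennpowr (average (ball x (2 * \<rho> / 2 ^ j)) (\<lambda>y. ennreal \<bar>?h y\<bar>)) p * mass w (ball x (2 * \<rho>))
        \<le> 1 * (ennreal A' * ennreal (2 powr (real j * DIM('a))) * ennreal F)"
        using far_estimate_A1[OF Ar p(1), of "2 * \<rho>" "\<lambda>y. ennreal \<bar>?h y\<bar>" x j] \<rho> by (simp add: F(2) A'(2))
      also have "\<dots> \<le> ennreal (exp p) * (ennreal A' * ennreal (2 powr (real j * DIM('a))) * ennreal F)"
        using p by (intro mult_right_mono) (auto simp: ennreal_ge_1)
      finally show "ennpowr (average (ball x (2 * \<rho> / 2 ^ j)) (\<lambda>y. ennreal \<bar>?h y\<bar>)) p * mass w (ball x (2 * \<rho>))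
        \<le> ennreal (exp p) * ennreal A' * ennreal (2 powr (real j * DIM('a) * 1)) * ennreal F" by (simp add: mult.assoc)
    qed simp_all
    then show "ennpowr (waverage w (ball z \<rho>) (\<lambda>x. ennpowr (e2ennreal \<bar>riesz_potential \<alpha> ?h x\<bar>) q)) (1 / q)
      \<le> ennreal (riesz_const TYPE('a) / \<alpha> * (DIM('a) * p / (DIM('a) - \<alpha> * p)) * conj_exp p powr (1 / q))
       * ennpowr (A_const 1 w) (1 / p) * ennreal (\<rho> powr \<alpha>)
       * ennpowr (waverage w (ball z \<rho>) (\<lambda>x. ennreal (\<bar>f x\<bar> powr p))) (1 / p)"
      unfolding avg A'(2) using A' W F by (simp add: ennpowr_ennreal)
  qed
qed

lemma riesz_Ar:
  fixes w :: "'a::euclidean_space \<Rightarrow> ennreal" and \<alpha> p q r s \<tau> \<rho> :: real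
  defines "\<tau> \<equiv> 2 ^ (DIM('a) + 1)"
  assumes \<alpha>: "0 < \<alpha>" "\<alpha> < DIM('a)" and p: "1 < p" "p < DIM('a) / \<alpha>" and r: "1 < r" "r \<le> p" and w: "w \<in> A_class r"
    and \<sigma>: "\<sigma> = (\<lambda>x. ennpowr (w x) (1 - conj_exp r))" and s: "s = enn2real (Ainf_const \<sigma>)"
    and q: "1 / p - 1 / q = \<alpha> / DIM('a) * (\<tau> * s / (1 + r * (\<tau> * s - 1)))"
    and \<rho>: "0 < \<rho>" and f: "f \<in> Lp_on p (ball z \<rho>) w"
  shows "ennpowr (waverage w (ball z \<rho>) (\<lambda>x. ennpowr (e2ennreal \<bar>riesz_potential \<alpha> (zero_ext (ball z \<rho>) f) x\<bar>) q)) (1 / q)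
    \<le> ennreal (riesz_const TYPE('a) / \<alpha> * (DIM('a) * p / (DIM('a) - \<alpha> * p)) * conj_exp p powr (1 / q))
       * ennpowr (A_const r w) (1 / p) * ennpowr (Ainf_const \<sigma>) (1 / q) * ennreal (\<rho> powr \<alpha>)
       * ennpowr (waverage w (ball z \<rho>) (\<lambda>x. ennreal (\<bar>f x\<bar> powr p))) (1 / p)"
proof -
  define n where "n = real DIM('a)"
  have n: "1 \<le> n" using DIM_ge_Suc0[where 'a = 'a] unfolding n_def by linarith
  have nap: "0 < n - \<alpha> * p" using p \<alpha> by (simp add: n_def pos_less_divide_eq mult.commute)
  have \<tau>: "1 \<le> \<tau>" unfolding \<tau>_def by (rule one_le_power) simp
  \<comment> \<open>The fraction in the equation for q is 1 / r0, since r - (r - 1) / x = (1 + r (x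
    - 1)) / x at x = \<tau> s.\<close>
  define r0 where "r0 = r - (r - 1) / (\<tau> * s)"
  have r0: "1 \<le> r0" "1 / q = 1 / p - \<alpha> / (DIM('a) * r0)" if s1: "1 \<le> s"
  proof -
    have \<tau>s: "1 \<le> \<tau> * s" using mult_mono[of 1 \<tau> 1 s] \<tau> s1 by simp
    have "(r - 1) / (\<tau> * s) \<le> (r - 1) / 1" using r \<tau>s by (intro divide_left_mono) auto
    then show "1 \<le> r0" by (simp add: r0_def)
    have "r - (r - 1) / x = (1 + r * (x - 1)) / x" if "1 \<le> x" for x :: real using that by (simp add: field_simps)
    from this[OF \<tau>s] have "r0 = (1 + r * (\<tau> * s - 1)) / (\<tau> * s)" by (simp only: r0_def)
    then have "\<tau> * s / (1 + r * (\<tau> * s - 1)) = 1 / r0" by simp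
    then show "1 / q = 1 / p - \<alpha> / (DIM('a) * r0)" using q by simp
  qed
  \<comment> \<open>If the A_\<infinity> constant is 0 or \<infinity>, then s = 0 and the equation
    gives q = p. Otherwise s \<ge> 1, r0 \<ge> 1 and 1/q \<ge> 1/p - \<alpha>/n > 0.\<close>
  have q0: "0 < q"
  proof -
    consider "s = 0" | "1 \<le> s"
    proof (cases "Ainf_const \<sigma> = \<infinity> \<or> Ainf_const \<sigma> = 0")
      case True
      then show ?thesis using that(1) s by auto
    next
      case False
      then have "1 \<le> Ainf_const \<sigma>" using Ainf_const_cases[of \<sigma>] by auto
      then have "1 \<le> s" using False unfolding s by (cases "Ainf_const \<sigma>") (auto simp: ennreal_ge_1)
      then show ?thesis by (rule that(2))
    qed
    then have "0 < 1 / q"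
    proof cases
      case 1
      then show ?thesis using q p by simp
    next
      case 2
      have "\<alpha> / (n * r0) \<le> \<alpha> / (n * 1)" using n r0(1)[OF 2] \<alpha> by (intro divide_left_mono mult_left_mono mult_pos_pos) auto
      moreover have "\<alpha> / n < 1 / p" using nap n p by (simp add: field_simps)
      ultimately show ?thesis using r0(2)[OF 2] by (simp add: n_def)
    qed
    then show ?thesis by simp
  qed
  have weight: "weight w" and A: "A_const r w < \<infinity>" using w by (auto simp: A_class_def)
  have [measurable]: "w \<in> borel_measurable lebesgue" using weight by (simp add: weight_def)
  let ?h = "zero_ext (ball z \<rho>) f"
  have hm [measurable]: "?h \<in> borel_measurable lebesgue" by (rule zero_ext_measurable[OF f])
  let ?L = "ennpowr (waverage w (ball z \<rho>) (\<lambda>x. ennpowr (e2ennreal \<bar>riesz_potential \<alpha> ?h x\<bar>) q)) (1 / q)"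
  let ?c = "riesz_const TYPE('a) / \<alpha> * (DIM('a) * p / (DIM('a) - \<alpha> * p)) * conj_exp p powr (1 / q)"
  let ?R = "ennreal ?c * ennpowr (A_const r w) (1 / p) * ennpowr (Ainf_const \<sigma>) (1 / q) * ennreal (\<rho> powr \<alpha>)
       * ennpowr (waverage w (ball z \<rho>) (\<lambda>x. ennreal (\<bar>f x\<bar> powr p))) (1 / p)"
  show ?thesis
  proof (rule riesz_cases[OF weight _ A less_imp_le[OF r(1)] r(2) q0 f \<rho>])
    assume "mass w (ball z \<rho>) \<noteq> 0"
    then have "dual_pair r (A_const r w) w \<sigma>"
      using dual_pair_of_Ar[OF r(1) weight A \<rho> _ \<sigma>, of z] by (simp add: zero_less_iff_neq_zero)
    then show "Ar_bound r (A_const r w) w" by (rule dual_pair.Ar_bound)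
  next
    fix W F A' :: real
    assume W: "0 < W" "mass w (ball z \<rho>) = ennreal W" and F: "0 < F"
        "(\<integral>\<^sup>+x. ennpowr (ennreal \<bar>?h x\<bar>) p * w x \<partial>lebesgue) = ennreal F"
      and avg: "waverage w (ball z \<rho>) (\<lambda>x. ennreal (\<bar>f x\<bar> powr p)) = ennreal (F / W)"
      and A': "1 \<le> A'" "A_const r w = ennreal A'"
      and fin: "(\<integral>\<^sup>+x. ennreal \<bar>?h x\<bar> \<partial>lebesgue) < \<infinity>" "(\<integral>\<^sup>+x. ennpowr (ennreal \<bar>?h x\<bar>) (p / r) \<partial>lebesgue) < \<infinity>"
    have pair: "dual_pair r (A_const r w) w \<sigma>"
      using dual_pair_of_Ar[OF r(1) weight A \<rho> _ \<sigma>, of z] W by simp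
    have c: "0 < ?c"
      using riesz_const_pos[where 'a = 'a] \<alpha> p nap n by (simp add: n_def conj_exp_def)
    show "?L \<le> ?R"
    proof (cases "Ainf_const \<sigma> < \<infinity>")
      case False
      \<comment> \<open>An infinite A_\<infinity> constant makes the right side infinite, as every
        other factor is positive; the value s = 0 given by \<open>enn2real\<close> then affects only
        q.\<close>
      then have top: "Ainf_const \<sigma> = top" by (simp add: less_top[symmetric])
      have pos: "x * top * y * z = top" if "0 < x" "0 < y" "0 < z" for x y z :: ennreal
        using that by (auto simp: ennreal_mult_top ennreal_top_mult)
      have "?R = ennreal ?c * ennreal (A' powr (1 / p)) * top * ennreal (\<rho> powr \<alpha>) * ennreal ((F / W) powr (1 / p))"
        unfolding top avg A'(2) using A' W F q0 by (simp add: ennpowr_ennreal)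
      also have "\<dots> = top"
        using c A' \<rho> F W by (intro pos) (simp_all only: ennreal_zero_less_mult_iff ennreal_less_zero_iff, simp_all)
      finally show ?thesis by simp
    next
      case True
      have s': "Ainf_const \<sigma> = ennreal s" using True by (simp add: s)
      interpret dual_weights r "A_const r w" w \<sigma> s
        unfolding s by (rule dual_pair.dual_weights_of_Ainf[OF pair True])
      have s1: "1 \<le> s" by (rule dual_weights.s[OF dual_weights_axioms])
      obtain \<Phi> where \<Phi>: "\<Phi> \<in> borel_measurable lebesgue" "\<And>x t. 0 < t \<Longrightarrow> ennpowr (average (ball x t) (\<lambda>y. ennreal \<bar>?h y\<bar>)) p \<le> \<Phi> x"
          "(\<integral>\<^sup>+x. \<Phi> x * w x \<partial>lebesgue) \<le> ennreal (max_const TYPE('a) powr p * (p / (p - 1)) * s) * A_const r w *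
             (\<integral>\<^sup>+x. ennpowr (ennreal \<bar>?h x\<bar>) p * w x \<partial>lebesgue)"
        using maximal_theorem[OF \<open>r \<le> p\<close> _ fin] by auto
      have "?L \<le> ennreal ?c * ennreal (A' powr (1 / p)) * ennreal (s powr (1 / q)) * ennreal (\<rho> powr \<alpha>) * ennreal ((F / W) powr (1 / p))"
      proof (rule riesz_inequality[OF hm _ \<alpha> \<rho> p r0[OF s1] _ A'(1) s1 W F \<Phi>(1,2)])
        show "?h y = 0" if "y \<notin> ball z \<rho>" for y using that by (simp add: zero_ext_def)
        show "(\<integral>\<^sup>+x. \<Phi> x * w x \<partial>lebesgue) \<le> ennreal (max_const TYPE('a) powr p * (p / (p - 1)) * s) * ennreal A' * ennreal F"
          using \<Phi>(3) unfolding F(2) A'(2) .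
        show "ennpowr (average (ball x (2 * \<rho> / 2 ^ j)) (\<lambda>y. ennreal \<bar>?h y\<bar>)) p * mass w (ball x (2 * \<rho>))
          \<le> ennreal (exp p) * ennreal A' * ennreal (2 powr (real j * DIM('a) * r0)) * ennreal F" for x j
          using far_estimate[OF \<open>r \<le> p\<close>, of "2 * \<rho>" "\<lambda>y. ennreal \<bar>?h y\<bar>" x j] \<rho>
          unfolding F(2) A'(2) r0_def \<tau>_def by simp
      qed simp_all
      also have "\<dots> = ?R"
        unfolding avg A'(2) s' using A' W F s1 by (simp add: ennpowr_ennreal)
      finally show ?thesis .
    qed
  qed
qed

theorem theorem2p1:
  shows "\<exists>c>0. \<forall>\<alpha> p r :: real. \<forall>w :: (real ^ 'n) \<Rightarrow> ennreal.
    0 < \<alpha> \<and> \<alpha> < real CARD('n) \<and> 1 < p \<and> p < real CARD('n) / \<alpha> \<and>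
    1 \<le> r \<and> r \<le> p \<and> w \<in> A_class r \<longrightarrow>
    (let n = real CARD('n);
         p_star = n * p / (n - \<alpha> * p);
         \<tau> = 2 ^ (CARD('n) + 1);
         \<sigma> = (\<lambda>x. ennpowr (w x) (1 - conj_exp r));
         s = enn2real (Ainf_const \<sigma>)
     in
       (r > 1 \<longrightarrow>
         (\<forall>q. 1 / p - 1 / q = \<alpha> / n * (\<tau> * s / (1 + r * (\<tau> * s - 1))) \<longrightarrow>
           (\<forall>z \<rho>. \<forall>f \<in> Lp_on p (ball z \<rho>) w. \<rho> > 0 \<longrightarrow>
             ennpowr (waverage w (ball z \<rho>)
               (\<lambda>x. ennpowr (e2ennreal \<bar>riesz_potential \<alpha> (zero_ext (ball z \<rho>) f) x\<bar>) q)) (1 / q)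
             \<le> ennreal (c / \<alpha> * p_star * conj_exp p powr (1 / q))
                * ennpowr (A_const r w) (1 / p) * ennpowr (Ainf_const \<sigma>) (1 / q)
                * ennreal (\<rho> powr \<alpha>)
                * ennpowr (waverage w (ball z \<rho>) (\<lambda>x. ennreal (\<bar>f x\<bar> powr p))) (1 / p)))) \<and>
       (r = 1 \<longrightarrow>
         (\<forall>q. q = p_star \<longrightarrow>
           (\<forall>z \<rho>. \<forall>f \<in> Lp_on p (ball z \<rho>) w. \<rho> > 0 \<longrightarrow>
             ennpowr (waverage w (ball z \<rho>)
               (\<lambda>x. ennpowr (e2ennreal \<bar>riesz_potential \<alpha> (zero_ext (ball z \<rho>) f) x\<bar>) q)) (1 / q)
             \<le> ennreal (c / \<alpha> * p_star * conj_exp p powr (1 / q))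
                * ennpowr (A_const r w) (1 / p)
                * ennreal (\<rho> powr \<alpha>)
                * ennpowr (waverage w (ball z \<rho>) (\<lambda>x. ennreal (\<bar>f x\<bar> powr p))) (1 / p)))))"
proof (intro exI[of _ "riesz_const TYPE(real ^ 'n)"] conjI allI impI, goal_cases)
  case 1
  show ?case by (rule riesz_const_pos)
next
  case (2 \<alpha> p r w)
  have DIM: "DIM(real ^ 'n) = CARD('n)" by simp
  show ?case
    unfolding Let_def
  proof (intro conjI allI impI ballI, goal_cases)
    case (1 q z \<rho> f)
    then show ?case
      using 2 by (intro riesz_Ar[where 'a = "real ^ 'n", unfolded DIM, OF _ _ _ _ _ _ _ refl refl]) auto
  next
    case (2 q z \<rho> f)
    show ?case
      using 2 \<open>0 < \<alpha> \<and> _\<close> unfolding \<open>r = 1\<close>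
      by (intro riesz_A1[where 'a = "real ^ 'n", unfolded DIM]) auto
  qed
qed

end
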